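(* Let $\theta$ be an automorphism of a locally compact group $\Gamma$ with Kazhdan's Property (T), and let $G=\Gamma\rtimes_\theta\mathbb{Z}$. Let $M$ be a unitary $G$-module. Let $t$ be the generator of $\mathbb{Z}$ such that $tht^{-1}=\theta(h)$ for all $h\in\Gamma$. Then: (i) $H^1(G,M)=0$ if and only if $1$ is not a spectral value of $t|_{M^\Gamma}$; (ii) $\overline{H}^1(G,M)=0$ if and only if $1$ is not an eigenvalue of $t|_{M^\Gamma}$.
   Context: An automorphism of a locally compact group means a topological group automorphism. A unitary $G$-module $M$ is a Hilbert space with a strongly continuous unitary representation of $G$; $M^\Gamma$ is the closed subspace of $\Gamma$-fixed vectors, which is invariant under $t$. $H^1(G,M)=Z^1(G,M)/B^1(G,M)$ (continuous 1-cocycles modulo 1-coboundaries) and $\overline{H}^1(G,M)=Z^1(G,M)/\overline{B^1(G,M)}$, the closure being for uniform convergence on compact subsets of $G$. *)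

theory Defs
  imports
    "HOL-Analysis.Analysis"
    "HOL-Algebra.Bij"
    "HOL-Algebra.Elementary_Groups"
    "HOL-Library.Function_Algebras"
begin

section \<open>Locally compact groups\<close>

locale topological_group = group G for G :: "('a, 'b) monoid_scheme" (structure) +
  fixes T :: "'a topology"
  assumes topspace_eq: "topspace T = carrier G"
    and continuous_mult: "continuous_map (prod_topology T T) T (\<lambda>(x, y). x \<otimes> y)"
    and continuous_inv: "continuous_map T T (\<lambda>x. inv x)"

locale locally_compact_group = topological_group +
  assumes Hausdorff: "Hausdorff_space T"
    and locally_compact: "locally_compact_space T"

definition topological_auto :: "('a, 'b) monoid_scheme \<Rightarrow> 'a topology \<Rightarrow> ('a \<Rightarrow> 'a) set"
  where "topological_auto G T = {\<theta> \<in> auto G. homeomorphic_map T T \<theta>}"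

text \<open>
  Integer powers of \<open>\<theta>\<close> are taken in the automorphism group, so that negative powers are
  powers of the inverse automorphism. The generator below satisfies \<open>t \<otimes> h \<otimes> inv t = \<theta> h\<close>,
  see \<open>int_generator_conj\<close>.
\<close>

definition semidirect_int :: "('a, 'b) monoid_scheme \<Rightarrow> ('a \<Rightarrow> 'a) \<Rightarrow> ('a \<times> int) monoid"
  where "semidirect_int \<Gamma> \<theta> =
    \<lparr>carrier = carrier \<Gamma> \<times> UNIV,
     mult = \<lambda>(h, m) (k, n). (h \<otimes>\<^bsub>\<Gamma>\<^esub> (\<theta> [^]\<^bsub>AutoGroup \<Gamma>\<^esub> m) k, m + n),
     one = (\<one>\<^bsub>\<Gamma>\<^esub>, 0)\<rparr>"

definition semidirect_int_topology :: "'a topology \<Rightarrow> ('a \<times> int) topology"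
  where "semidirect_int_topology T = prod_topology T (discrete_topology UNIV)"

definition int_generator :: "('a, 'b) monoid_scheme \<Rightarrow> 'a \<times> int"
  where "int_generator \<Gamma> = (\<one>\<^bsub>\<Gamma>\<^esub>, 1)"


section \<open>Complex Hilbert spaces\<close>

text \<open>
  A Hilbert space is a linear subspace \<open>H\<close> of some ambient complex vector space, so that closed
  subspaces such as spaces of fixed vectors are again Hilbert spaces over the same type.
  The inner product is linear in its first argument; its values outside \<open>H\<close> are irrelevant.
\<close>

definition hnorm :: "('v \<Rightarrow> 'v \<Rightarrow> complex) \<Rightarrow> 'v \<Rightarrow> real"
  where "hnorm ip v = sqrt (Re (ip v v))"

text \<open>The library locale \<open>Metric_space\<close> wants symmetry and nonnegativity off the carrier as well.\<close>

definition hdist :: "'v::ab_group_add set \<Rightarrow> ('v \<Rightarrow> 'v \<Rightarrow> complex) \<Rightarrow> 'v \<Rightarrow> 'v \<Rightarrow> real"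
  where "hdist H ip u v = (if u \<in> H \<and> v \<in> H then hnorm ip (u - v) else 0)"

definition htopology :: "'v::ab_group_add set \<Rightarrow> ('v \<Rightarrow> 'v \<Rightarrow> complex) \<Rightarrow> 'v topology"
  where "htopology H ip = Metric_space.mtopology H (hdist H ip)"

locale complex_hilbert_space = vector_space smul
  for smul :: "complex \<Rightarrow> 'v::ab_group_add \<Rightarrow> 'v" +
  fixes H :: "'v set" and ip :: "'v \<Rightarrow> 'v \<Rightarrow> complex"
  assumes subspace_H: "subspace H"
    and ip_add_left: "\<lbrakk>u \<in> H; v \<in> H; w \<in> H\<rbrakk> \<Longrightarrow> ip (u + v) w = ip u w + ip v w"
    and ip_scale_left: "\<lbrakk>u \<in> H; v \<in> H\<rbrakk> \<Longrightarrow> ip (smul c u) v = c * ip u v"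
    and ip_cnj: "\<lbrakk>u \<in> H; v \<in> H\<rbrakk> \<Longrightarrow> ip u v = cnj (ip v u)"
    and ip_pos: "\<lbrakk>u \<in> H; u \<noteq> 0\<rbrakk> \<Longrightarrow> Re (ip u u) > 0"
    and complete: "Metric_space.mcomplete H (hdist H ip)"

definition linear_on_space ::
    "(complex \<Rightarrow> 'v::ab_group_add \<Rightarrow> 'v) \<Rightarrow> 'v set \<Rightarrow> ('v \<Rightarrow> 'v) \<Rightarrow> bool"
  where "linear_on_space smul H A \<longleftrightarrow>
    A \<in> H \<rightarrow> H \<and> (\<forall>u\<in>H. \<forall>v\<in>H. A (u + v) = A u + A v) \<and> (\<forall>c. \<forall>u\<in>H. A (smul c u) = smul c (A u))"

definition bounded_operator ::
    "(complex \<Rightarrow> 'v::ab_group_add \<Rightarrow> 'v) \<Rightarrow> 'v set \<Rightarrow> ('v \<Rightarrow> 'v \<Rightarrow> complex) \<Rightarrow> ('v \<Rightarrow> 'v) \<Rightarrow> bool"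
  where "bounded_operator smul H ip A \<longleftrightarrow>
    linear_on_space smul H A \<and> (\<exists>C. \<forall>v\<in>H. hnorm ip (A v) \<le> C * hnorm ip v)"

definition unitary_operator ::
    "(complex \<Rightarrow> 'v::ab_group_add \<Rightarrow> 'v) \<Rightarrow> 'v set \<Rightarrow> ('v \<Rightarrow> 'v \<Rightarrow> complex) \<Rightarrow> ('v \<Rightarrow> 'v) \<Rightarrow> bool"
  where "unitary_operator smul H ip U \<longleftrightarrow>
    linear_on_space smul H U \<and> bij_betw U H H \<and> (\<forall>u\<in>H. \<forall>v\<in>H. ip (U u) (U v) = ip u v)"

definition spectral_values ::
    "(complex \<Rightarrow> 'v::ab_group_add \<Rightarrow> 'v) \<Rightarrow> 'v set \<Rightarrow> ('v \<Rightarrow> 'v \<Rightarrow> complex) \<Rightarrow> ('v \<Rightarrow> 'v) \<Rightarrow> complex set"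
  where "spectral_values smul H ip A =
    {c. \<not> (\<exists>B. bounded_operator smul H ip B \<and>
               (\<forall>v\<in>H. B (smul c v - A v) = v \<and> smul c (B v) - A (B v) = v))}"

definition eigenvalues ::
    "(complex \<Rightarrow> 'v::ab_group_add \<Rightarrow> 'v) \<Rightarrow> 'v set \<Rightarrow> ('v \<Rightarrow> 'v) \<Rightarrow> complex set"
  where "eigenvalues smul H A = {c. \<exists>v\<in>H. v \<noteq> 0 \<and> A v = smul c v}"


section \<open>Unitary modules and Property (T)\<close>

locale unitary_module = complex_hilbert_space smul H ip
  for G :: "('g, 'b) monoid_scheme" (structure) and T :: "'g topology"
    and smul :: "complex \<Rightarrow> 'v::ab_group_add \<Rightarrow> 'v" and H :: "'v set"
    and ip :: "'v \<Rightarrow> 'v \<Rightarrow> complex" +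
  fixes \<pi> :: "'g \<Rightarrow> 'v \<Rightarrow> 'v"
  assumes unitary: "g \<in> carrier G \<Longrightarrow> unitary_operator smul H ip (\<pi> g)"
    and action_mult:
      "\<lbrakk>g \<in> carrier G; h \<in> carrier G; v \<in> H\<rbrakk> \<Longrightarrow> \<pi> (g \<otimes> h) v = \<pi> g (\<pi> h v)"
    and strongly_continuous: "v \<in> H \<Longrightarrow> continuous_map T (htopology H ip) (\<lambda>g. \<pi> g v)"

definition fixed_vectors :: "'g set \<Rightarrow> 'v set \<Rightarrow> ('g \<Rightarrow> 'v \<Rightarrow> 'v) \<Rightarrow> 'v set"
  where "fixed_vectors S H \<pi> = {v \<in> H. \<forall>g\<in>S. \<pi> g v = v}"

definition almost_invariant ::
    "'g set \<Rightarrow> real \<Rightarrow> ('v::ab_group_add \<Rightarrow> 'v \<Rightarrow> complex) \<Rightarrow> ('g \<Rightarrow> 'v \<Rightarrow> 'v) \<Rightarrow> 'v \<Rightarrow> bool"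
  where "almost_invariant Q \<epsilon> ip \<pi> v \<longleftrightarrow>
    v \<noteq> 0 \<and> (\<forall>g\<in>Q. hnorm ip (\<pi> g v - v) < \<epsilon> * hnorm ip v)"

text \<open>
  The last argument is the type in which the representation spaces live.
\<close>

definition kazhdan_pair ::
    "('g, 'b) monoid_scheme \<Rightarrow> 'g topology \<Rightarrow> 'g set \<Rightarrow> real \<Rightarrow> 'v::ab_group_add itself \<Rightarrow> bool"
  where "kazhdan_pair G T Q \<epsilon> (_ :: 'v itself) \<longleftrightarrow>
    (\<forall>smul (H :: 'v set) ip \<pi>. unitary_module G T smul H ip \<pi> \<longrightarrow>
       (\<exists>v\<in>H. almost_invariant Q \<epsilon> ip \<pi> v) \<longrightarrow>
       (\<exists>v\<in>fixed_vectors (carrier G) H \<pi>. v \<noteq> 0))"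

text \<open>
  One cannot quantify over all types inside a formula. Function spaces on the group suffice:
  by \<open>kazhdan_pair_universal\<close> below, a Kazhdan pair for the representations living in the
  type \<open>'g \<Rightarrow> complex\<close> is a Kazhdan pair for the representations living in any type.
\<close>

definition property_T :: "('g, 'b) monoid_scheme \<Rightarrow> 'g topology \<Rightarrow> bool"
  where "property_T G T \<longleftrightarrow>
    (\<exists>Q \<epsilon>. compactin T Q \<and> \<epsilon> > 0 \<and> kazhdan_pair G T Q \<epsilon> TYPE('g \<Rightarrow> complex))"


section \<open>First cohomology\<close>

text \<open>
  Cocycles are extensional functions, so that equality of cocycles is equality on the group.
\<close>

definition cocycles ::
    "('g, 'b) monoid_scheme \<Rightarrow> 'g topology \<Rightarrow> 'v::ab_group_add set \<Rightarrow> ('v \<Rightarrow> 'v \<Rightarrow> complex) \<Rightarrow>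
     ('g \<Rightarrow> 'v \<Rightarrow> 'v) \<Rightarrow> ('g \<Rightarrow> 'v) set"
  where "cocycles G T H ip \<pi> =
    {b \<in> carrier G \<rightarrow>\<^sub>E H. continuous_map T (htopology H ip) b \<and>
       (\<forall>g\<in>carrier G. \<forall>h\<in>carrier G. b (g \<otimes>\<^bsub>G\<^esub> h) = b g + \<pi> g (b h))}"

definition coboundaries ::
    "('g, 'b) monoid_scheme \<Rightarrow> 'v::ab_group_add set \<Rightarrow> ('g \<Rightarrow> 'v \<Rightarrow> 'v) \<Rightarrow> ('g \<Rightarrow> 'v) set"
  where "coboundaries G H \<pi> = (\<lambda>v. \<lambda>g\<in>carrier G. \<pi> g v - v) ` H"

definition cocycle_group ::
    "('g, 'b) monoid_scheme \<Rightarrow> 'g topology \<Rightarrow> 'v::ab_group_add set \<Rightarrow> ('v \<Rightarrow> 'v \<Rightarrow> complex) \<Rightarrow>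
     ('g \<Rightarrow> 'v \<Rightarrow> 'v) \<Rightarrow> ('g \<Rightarrow> 'v) monoid"
  where "cocycle_group G T H ip \<pi> =
    \<lparr>carrier = cocycles G T H ip \<pi>,
     mult = \<lambda>b c. \<lambda>g\<in>carrier G. b g + c g,
     one = \<lambda>g\<in>carrier G. 0\<rparr>"

text \<open>The topology on cocycles of uniform convergence on compact subsets of the group:\<close>

definition cocycle_topology ::
    "('g, 'b) monoid_scheme \<Rightarrow> 'g topology \<Rightarrow> 'v::ab_group_add set \<Rightarrow> ('v \<Rightarrow> 'v \<Rightarrow> complex) \<Rightarrow>
     ('g \<Rightarrow> 'v \<Rightarrow> 'v) \<Rightarrow> ('g \<Rightarrow> 'v) topology"
  where "cocycle_topology G T H ip \<pi> =
    topology (\<lambda>U. U \<subseteq> cocycles G T H ip \<pi> \<and>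
      (\<forall>b\<in>U. \<exists>K \<epsilon>. compactin T K \<and> \<epsilon> > 0 \<and>
         {c \<in> cocycles G T H ip \<pi>. \<forall>g\<in>K. hnorm ip (c g - b g) < \<epsilon>} \<subseteq> U))"

definition H1 ::
    "('g, 'b) monoid_scheme \<Rightarrow> 'g topology \<Rightarrow> 'v::ab_group_add set \<Rightarrow> ('v \<Rightarrow> 'v \<Rightarrow> complex) \<Rightarrow>
     ('g \<Rightarrow> 'v \<Rightarrow> 'v) \<Rightarrow> ('g \<Rightarrow> 'v) set monoid"
  where "H1 G T H ip \<pi> = cocycle_group G T H ip \<pi> Mod coboundaries G H \<pi>"

definition reduced_H1 ::
    "('g, 'b) monoid_scheme \<Rightarrow> 'g topology \<Rightarrow> 'v::ab_group_add set \<Rightarrow> ('v \<Rightarrow> 'v \<Rightarrow> complex) \<Rightarrow>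
     ('g \<Rightarrow> 'v \<Rightarrow> 'v) \<Rightarrow> ('g \<Rightarrow> 'v) set monoid"
  where "reduced_H1 G T H ip \<pi> =
    cocycle_group G T H ip \<pi> Mod (cocycle_topology G T H ip \<pi> closure_of coboundaries G H \<pi>)"


section \<open>Basic properties of Hilbert spaces\<close>

context complex_hilbert_space
begin

lemma H_zero [simp]: "0 \<in> H"
  and H_add: "\<lbrakk>u \<in> H; v \<in> H\<rbrakk> \<Longrightarrow> u + v \<in> H"
  and H_smul: "u \<in> H \<Longrightarrow> smul c u \<in> H"
  and H_diff: "\<lbrakk>u \<in> H; v \<in> H\<rbrakk> \<Longrightarrow> u - v \<in> H"
  using subspace_H subspace_diff[OF subspace_H] by (auto simp: subspace_def)

lemma ip_diff_left: "\<lbrakk>u \<in> H; v \<in> H; w \<in> H\<rbrakk> \<Longrightarrow> ip (u - v) w = ip u w - ip v w"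
  using ip_add_left[of "u - v" v w] by (simp add: H_diff)

lemma ip_zero_left [simp]: "v \<in> H \<Longrightarrow> ip 0 v = 0"
  using ip_diff_left[of v v v] by simp

lemma ip_zero_right [simp]: "v \<in> H \<Longrightarrow> ip v 0 = 0"
  using ip_cnj[of v 0] by simp

lemma ip_add_right: "\<lbrakk>u \<in> H; v \<in> H; w \<in> H\<rbrakk> \<Longrightarrow> ip w (u + v) = ip w u + ip w v"
  using ip_cnj[of w "u + v"] ip_cnj[of w u] ip_cnj[of w v] by (simp add: ip_add_left H_add)

lemma ip_smul_right: "\<lbrakk>u \<in> H; v \<in> H\<rbrakk> \<Longrightarrow> ip v (smul c u) = cnj c * ip v u"
  using ip_cnj[of v "smul c u"] ip_cnj[of v u] by (simp add: ip_scale_left H_smul)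

lemma ip_diff_right: "\<lbrakk>u \<in> H; v \<in> H; w \<in> H\<rbrakk> \<Longrightarrow> ip w (u - v) = ip w u - ip w v"
  using ip_add_right[of "u - v" v w] by (simp add: H_diff)

lemma ip_self_real: "u \<in> H \<Longrightarrow> ip u u = of_real (Re (ip u u))"
  using ip_cnj[of u u] by (auto simp: complex_eq_iff)

lemma ip_self_nonneg: "u \<in> H \<Longrightarrow> 0 \<le> Re (ip u u)"
  using ip_pos[of u] by (cases "u = 0") auto

lemma hnorm_nonneg: "u \<in> H \<Longrightarrow> 0 \<le> hnorm ip u"
  by (simp add: hnorm_def ip_self_nonneg)

lemma hnorm_power2: "u \<in> H \<Longrightarrow> (hnorm ip u)\<^sup>2 = Re (ip u u)"
  by (simp add: hnorm_def ip_self_nonneg)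

lemma hnorm_eq_0_iff: "u \<in> H \<Longrightarrow> hnorm ip u = 0 \<longleftrightarrow> u = 0"
  using ip_pos[of u] by (cases "u = 0") (auto simp: hnorm_def)

lemma Cauchy_Schwarz:
  assumes "u \<in> H" "w \<in> H"
  shows "norm (ip u w) \<le> hnorm ip u * hnorm ip w"
proof (cases "w = 0")
  case True
  then show ?thesis using assms by (simp add: hnorm_def)
next
  case False
  define b where "b = Re (ip w w)"
  have b: "b > 0" "ip w w = of_real b"
    using ip_pos[OF assms(2) False] ip_self_real[OF assms(2)] by (auto simp: b_def)
  define c where "c = ip u w / of_real b"
  define z where "z = u - smul c w"
  have zH: "z \<in> H" "smul c w \<in> H" using assms by (auto simp: z_def H_diff H_smul)
  have cw: "ip (smul c w) z = 0"
  proof -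
    have "ip w z = ip w u - cnj c * ip w w"
      using assms zH by (simp add: z_def ip_diff_right ip_smul_right)
    also have "\<dots> = 0"
      using b ip_cnj[of w u] assms by (simp add: c_def)
    finally show ?thesis using assms zH by (simp add: ip_scale_left)
  qed
  have "ip z z = ip u z"
    using cw assms zH by (subst (1) z_def) (simp add: ip_diff_left)
  also have "\<dots> = ip u u - cnj c * ip u w"
    using assms zH by (simp add: z_def ip_diff_right ip_smul_right)
  also have "cnj c * ip u w = of_real ((norm (ip u w))\<^sup>2 / b)"
    by (simp add: c_def mult.commute complex_norm_square[symmetric] flip: of_real_power)
  finally have "Re (ip z z) = Re (ip u u) - (norm (ip u w))\<^sup>2 / b" by simp
  then have "(norm (ip u w))\<^sup>2 / b \<le> Re (ip u u)"
    using ip_self_nonneg[OF zH(1)] by simp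
  then have "(norm (ip u w))\<^sup>2 \<le> Re (ip u u) * b"
    using b(1) by (simp add: divide_le_eq)
  then have "(norm (ip u w))\<^sup>2 \<le> Re (ip u u) * Re (ip w w)"
    by (simp only: b_def)
  also have "\<dots> = (hnorm ip u * hnorm ip w)\<^sup>2"
    using assms by (simp add: power_mult_distrib hnorm_power2)
  finally show ?thesis
    by (rule power2_le_imp_le) (use assms in \<open>simp add: hnorm_nonneg\<close>)
qed

lemma hnorm_triangle:
  assumes "u \<in> H" "w \<in> H"
  shows "hnorm ip (u + w) \<le> hnorm ip u + hnorm ip w"
proof (rule power2_le_imp_le)
  have "Re (ip (u + w) (u + w)) = Re (ip u u) + Re (ip w w) + 2 * Re (ip u w)"
    using assms ip_cnj[of w u] by (simp add: ip_add_left ip_add_right H_add)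
  also have "Re (ip u w) \<le> hnorm ip u * hnorm ip w"
    using Cauchy_Schwarz[OF assms] complex_Re_le_cmod order_trans by blast
  finally show "(hnorm ip (u + w))\<^sup>2 \<le> (hnorm ip u + hnorm ip w)\<^sup>2"
    using assms by (simp add: hnorm_power2 H_add power2_sum)
qed (use assms in \<open>simp add: hnorm_nonneg\<close>)

lemma hnorm_minus_commute: "\<lbrakk>u \<in> H; w \<in> H\<rbrakk> \<Longrightarrow> hnorm ip (u - w) = hnorm ip (w - u)"
  by (simp add: hnorm_def ip_diff_left ip_diff_right H_diff)

lemma Metric_space_H: "Metric_space H (hdist H ip)"
proof
  fix x y z assume xyz: "x \<in> H" "y \<in> H" "z \<in> H"
  then show "hdist H ip x z \<le> hdist H ip x y + hdist H ip y z"
    using hnorm_triangle[of "x - y" "y - z"] by (simp add: hdist_def H_diff)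
qed (auto simp: hdist_def hnorm_nonneg H_diff hnorm_minus_commute hnorm_eq_0_iff)

sublocale Hilb: Metric_space H "hdist H ip"
  by (rule Metric_space_H)

lemma subspace_imp_hilbert:
  assumes "subspace K" "K \<subseteq> H"
    and closed: "\<And>\<sigma> x. \<lbrakk>range \<sigma> \<subseteq> K; limitin Hilb.mtopology \<sigma> x sequentially\<rbrakk> \<Longrightarrow> x \<in> K"
  shows "complex_hilbert_space smul K ip"
proof unfold_locales
  have eq: "hdist K ip x y = hdist H ip x y" if "x \<in> K" "y \<in> K" for x y
    using that assms(2) by (auto simp: hdist_def)
  interpret K: Metric_space K "hdist K ip"
    using assms(2) Hilb.triangle eq Hilb.commute Hilb.zero
    by unfold_locales
      (auto simp: hdist_def subset_iff hnorm_nonneg H_diff hnorm_minus_commute hnorm_eq_0_iff)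
  show "K.mcomplete"
    unfolding K.mcomplete_def
  proof (intro allI impI)
    fix \<sigma> assume \<sigma>: "K.MCauchy \<sigma>"
    then have K: "range \<sigma> \<subseteq> K" by (simp add: K.MCauchy_def)
    have "Hilb.MCauchy \<sigma>"
      using \<sigma> K assms(2) unfolding K.MCauchy_def Hilb.MCauchy_def
      by (metis (no_types, lifting) eq range_subsetD subset_trans)
    then obtain x where x: "limitin Hilb.mtopology \<sigma> x sequentially"
      using complete unfolding Hilb.mcomplete_def by blast
    have "x \<in> K" using closed[OF K x] .
    with x K have "limitin K.mtopology \<sigma> x sequentially"
      unfolding Hilb.limit_metric_sequentially K.limit_metric_sequentially
      by (metis eq range_subsetD)
    then show "\<exists>x. limitin K.mtopology \<sigma> x sequentially" ..
  qed
  show "ip u v = cnj (ip v u)" if "u \<in> K" "v \<in> K" for u v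
    using that assms(2) by (intro ip_cnj) auto
qed (use assms ip_add_left ip_scale_left ip_pos in \<open>auto simp: subset_iff\<close>)

lemma limitin_ip:
  assumes "limitin Hilb.mtopology \<sigma> x sequentially" "range \<sigma> \<subseteq> H" "w \<in> H"
  shows "(\<lambda>n. ip w (\<sigma> n)) \<longlonglongrightarrow> ip w x"
proof -
  have x: "x \<in> H" using assms(1) by (simp add: Hilb.limit_metric_sequentially)
  have "(\<lambda>n. hdist H ip (\<sigma> n) x) \<longlonglongrightarrow> 0"
    using assms(1) Hilb.limitin_metric_dist_null by blast
  then have lim: "(\<lambda>n. hnorm ip w * hdist H ip (\<sigma> n) x) \<longlonglongrightarrow> 0"
    by (rule tendsto_mult_right_zero)
  have bound: "norm (ip w (\<sigma> n) - ip w x) \<le> hnorm ip w * hdist H ip (\<sigma> n) x" for n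
    using Cauchy_Schwarz[of w "\<sigma> n - x"] assms x
    by (simp add: ip_diff_right[symmetric] hdist_def H_diff range_subsetD)
  have "(\<lambda>n. ip w (\<sigma> n) - ip w x) \<longlonglongrightarrow> 0"
    by (rule Lim_null_comparison[OF always_eventually[OF allI[OF bound]] lim])
  then show ?thesis by (simp add: LIM_zero_iff)
qed

text \<open>Orthogonal complements are closed.\<close>

lemma orthogonal_complement_hilbert:
  assumes "S \<subseteq> H"
  shows "complex_hilbert_space smul {w \<in> H. \<forall>v\<in>S. ip v w = 0} ip"
proof (rule subspace_imp_hilbert)
  show "subspace {w \<in> H. \<forall>v\<in>S. ip v w = 0}"
    using assms by (auto simp: subspace_def H_add H_smul ip_add_right ip_smul_right subset_iff)
  fix \<sigma> x
  assume \<sigma>: "range \<sigma> \<subseteq> {w \<in> H. \<forall>v\<in>S. ip v w = 0}"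
    and x: "limitin Hilb.mtopology \<sigma> x sequentially"
  have "ip v x = 0" if "v \<in> S" for v
  proof -
    have "(\<lambda>n. ip v (\<sigma> n)) \<longlonglongrightarrow> ip v x"
      using limitin_ip[OF x] \<sigma> that assms by blast
    moreover have "(\<lambda>n. ip v (\<sigma> n)) = (\<lambda>n. 0)" using \<sigma> that by auto
    ultimately show ?thesis by (simp add: LIMSEQ_const_iff)
  qed
  then show "x \<in> {w \<in> H. \<forall>v\<in>S. ip v w = 0}"
    using x by (simp add: Hilb.limit_metric_sequentially)
qed auto


lemma htopology_subspace:
  assumes "K \<subseteq> H" "complex_hilbert_space smul K ip"
  shows "htopology K ip = subtopology (htopology H ip) K"
proof -
  interpret K: complex_hilbert_space smul K ip by fact
  interpret S: Submetric H "hdist H ip" K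
    by unfold_locales fact
  have ball: "K.Hilb.mball x r = Metric_space.mball K (hdist H ip) x r" for x r
    using assms(1) by (auto simp: K.Hilb.mball_def S.sub.mball_def hdist_def)
  have "K.Hilb.mtopology = Metric_space.mtopology K (hdist H ip)"
    by (simp add: topology_eq K.Hilb.openin_mtopology S.sub.openin_mtopology ball)
  then show ?thesis
    by (simp add: htopology_def S.mtopology_submetric)
qed

context
  fixes smul' :: "complex \<Rightarrow> 'w::ab_group_add \<Rightarrow> 'w" and \<Phi> :: "'v \<Rightarrow> 'w"
  assumes vs': "vector_space smul'"
    and \<Phi>_inj: "inj_on \<Phi> H"
    and \<Phi>_add: "\<And>u v. \<lbrakk>u \<in> H; v \<in> H\<rbrakk> \<Longrightarrow> \<Phi> (u + v) = \<Phi> u + \<Phi> v"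
    and \<Phi>_smul: "\<And>c u. u \<in> H \<Longrightarrow> \<Phi> (smul c u) = smul' c (\<Phi> u)"
begin

lemma transport_diff: "\<lbrakk>u \<in> H; v \<in> H\<rbrakk> \<Longrightarrow> \<Phi> (u - v) = \<Phi> u - \<Phi> v"
  using \<Phi>_add[of "u - v" v] by (simp add: H_diff)

lemma transport_zero: "\<Phi> 0 = 0"
  using transport_diff[of 0 0] by simp

lemma transport_hdist:
  "\<lbrakk>u \<in> H; v \<in> H\<rbrakk> \<Longrightarrow>
    hdist (\<Phi> ` H) (\<lambda>x y. ip (inv_into H \<Phi> x) (inv_into H \<Phi> y)) (\<Phi> u) (\<Phi> v) = hdist H ip u v"
  using \<Phi>_inj by (simp add: hdist_def hnorm_def transport_diff[symmetric] H_diff)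

lemma transport_hilbert:
  "complex_hilbert_space smul' (\<Phi> ` H) (\<lambda>x y. ip (inv_into H \<Phi> x) (inv_into H \<Phi> y))"
    (is "complex_hilbert_space _ ?H ?ip")
proof -
  interpret V: vector_space smul' by (fact vs')
  have sub: "V.subspace ?H"
    unfolding V.subspace_def
  proof safe
    show "0 \<in> ?H" using transport_zero H_zero by (metis imageI)
    show "\<Phi> u + \<Phi> v \<in> ?H" if "u \<in> H" "v \<in> H" for u v
      using that H_add \<Phi>_add by (metis imageI)
    show "smul' c (\<Phi> u) \<in> ?H" if "u \<in> H" for c u
      using that H_smul \<Phi>_smul by (metis imageI)
  qed
  have d0: "hdist ?H ?ip x y = (if x \<in> ?H \<and> y \<in> ?H
      then hdist H ip (inv_into H \<Phi> x) (inv_into H \<Phi> y) else 0)" for x y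
    using transport_hdist \<Phi>_inj by (auto simp: hdist_def)
  interpret M: Metric_space ?H "hdist ?H ?ip"
    by unfold_locales
      (use \<Phi>_inj Hilb.triangle Hilb.commute in \<open>auto simp: d0 inj_on_eq_iff\<close>)
  have "M.mcomplete"
    unfolding M.mcomplete_def
  proof (intro allI impI)
    fix \<sigma> assume \<sigma>: "M.MCauchy \<sigma>"
    then have "range \<sigma> \<subseteq> ?H" by (simp add: M.MCauchy_def)
    then have "\<forall>n. \<exists>u\<in>H. \<sigma> n = \<Phi> u" by blast
    then obtain \<tau> where \<tau>: "\<And>n. \<tau> n \<in> H" "\<And>n. \<sigma> n = \<Phi> (\<tau> n)" by metis
    have "Hilb.MCauchy \<tau>"
      using \<sigma> \<tau> by (auto simp: Hilb.MCauchy_def M.MCauchy_def transport_hdist)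
    then obtain x where x: "limitin Hilb.mtopology \<tau> x sequentially"
      using complete unfolding Hilb.mcomplete_def by blast
    then have "limitin M.mtopology \<sigma> (\<Phi> x) sequentially"
      using \<tau> by (auto simp: Hilb.limit_metric_sequentially M.limit_metric_sequentially transport_hdist)
    then show "\<exists>x. limitin M.mtopology \<sigma> x sequentially" ..
  qed
  then show ?thesis
  proof unfold_locales
    show "?ip x y = cnj (?ip y x)" if "x \<in> ?H" "y \<in> ?H" for x y
      using that by (intro ip_cnj inv_into_into)
    show "Re (?ip x x) > 0" if x: "x \<in> ?H" "x \<noteq> 0" for x
    proof -
      obtain u where u: "u \<in> H" "x = \<Phi> u" using x by blast
      with x have "u \<noteq> 0" using transport_zero by auto
      with u show ?thesis using ip_pos \<Phi>_inj by simp
    qed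
  qed (use sub \<Phi>_inj ip_add_left ip_scale_left transport_zero in
      \<open>auto simp: \<Phi>_add[symmetric] \<Phi>_smul[symmetric] H_add H_smul\<close>)
qed

lemma transport_continuous:
  "continuous_map (htopology H ip)
     (htopology (\<Phi> ` H) (\<lambda>x y. ip (inv_into H \<Phi> x) (inv_into H \<Phi> y))) \<Phi>"
    (is "continuous_map _ (htopology ?H ?ip) _")
proof -
  interpret T: complex_hilbert_space smul' ?H ?ip by (rule transport_hilbert)
  show ?thesis
    unfolding htopology_def
    by (subst Metric_space.metric_continuous_map[OF Hilb.Metric_space_axioms T.Hilb.Metric_space_axioms])
      (auto simp: transport_hdist)
qed

end

end


section \<open>Property (T) does not depend on the type of the representation spaces\<close>

context unitary_module
begin

lemma action_closed: "\<lbrakk>g \<in> carrier G; v \<in> H\<rbrakk> \<Longrightarrow> \<pi> g v \<in> H"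
  and action_add: "\<lbrakk>g \<in> carrier G; u \<in> H; v \<in> H\<rbrakk> \<Longrightarrow> \<pi> g (u + v) = \<pi> g u + \<pi> g v"
  and action_smul: "\<lbrakk>g \<in> carrier G; v \<in> H\<rbrakk> \<Longrightarrow> \<pi> g (smul c v) = smul c (\<pi> g v)"
  and action_ip: "\<lbrakk>g \<in> carrier G; u \<in> H; v \<in> H\<rbrakk> \<Longrightarrow> ip (\<pi> g u) (\<pi> g v) = ip u v"
  and action_bij: "g \<in> carrier G \<Longrightarrow> bij_betw (\<pi> g) H H"
  using unitary[of g] by (auto simp: unitary_operator_def linear_on_space_def)

lemma action_one:
  assumes "group G" "v \<in> H"
  shows "\<pi> \<one> v = v"
proof -
  interpret group G by fact
  have "\<pi> \<one> (\<pi> \<one> v) = \<pi> \<one> v"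
    using action_mult[of \<one> \<one> v] assms by simp
  then show ?thesis
    using action_bij[of \<one>] assms action_closed[of \<one> v]
    by (metis bij_betw_imp_inj_on inj_on_eq_iff one_closed)
qed

lemma action_inv:
  assumes "group G" "g \<in> carrier G" "v \<in> H"
  shows "\<pi> g (\<pi> (inv g) v) = v" "\<pi> (inv g) (\<pi> g v) = v"
proof -
  interpret group G by fact
  show "\<pi> g (\<pi> (inv g) v) = v" "\<pi> (inv g) (\<pi> g v) = v"
    using assms action_mult[of g "inv g" v] action_mult[of "inv g" g v] by (simp_all add: action_one)
qed

lemma submodule:
  assumes "group G" "topspace T = carrier G" "K \<subseteq> H" "complex_hilbert_space smul K ip"
    and inv: "\<And>g v. \<lbrakk>g \<in> carrier G; v \<in> K\<rbrakk> \<Longrightarrow> \<pi> g v \<in> K"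
  shows "unitary_module G T smul K ip \<pi>"
proof -
  interpret G: group G by fact
  interpret K: complex_hilbert_space smul K ip by fact
  show ?thesis
  proof unfold_locales
    fix g assume g: "g \<in> carrier G"
    have "bij_betw (\<pi> g) K K"
      by (rule bij_betw_byWitness[where f' = "\<pi> (inv g)"])
        (use g assms in \<open>auto simp: action_inv subset_iff\<close>)
    then show "unitary_operator smul K ip (\<pi> g)"
      using g assms(3) inv action_add action_smul action_ip
      by (auto simp: unitary_operator_def linear_on_space_def subset_iff)
  next
    fix v assume "v \<in> K"
    then show "continuous_map T (htopology K ip) (\<lambda>g. \<pi> g v)"
      using assms strongly_continuous[of v] inv
      by (auto simp: htopology_subspace continuous_map_in_subtopology)
  qed (use action_mult assms(3) in auto)
qed

lemma transport_module:
  assumes "topspace T = carrier G" "vector_space smul'" "inj_on \<Phi> H"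
    and add: "\<And>u v. \<lbrakk>u \<in> H; v \<in> H\<rbrakk> \<Longrightarrow> \<Phi> (u + v) = \<Phi> u + \<Phi> v"
    and smul: "\<And>c u. u \<in> H \<Longrightarrow> \<Phi> (smul c u) = smul' c (\<Phi> u)"
  shows "unitary_module G T smul' (\<Phi> ` H)
    (\<lambda>x y. ip (inv_into H \<Phi> x) (inv_into H \<Phi> y)) (\<lambda>g x. \<Phi> (\<pi> g (inv_into H \<Phi> x)))"
    (is "unitary_module _ _ _ ?H ?ip ?\<pi>")
proof -
  note tr = assms(2-3) add smul
  interpret T: complex_hilbert_space smul' ?H ?ip by (rule transport_hilbert[OF tr])
  show ?thesis
  proof unfold_locales
    fix g assume g: "g \<in> carrier G"
    have "bij_betw (\<lambda>v. \<Phi> (\<pi> g (inv_into H \<Phi> v))) ?H ?H"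
    proof -
      have 1: "bij_betw \<Phi> H ?H" using assms(3) by (simp add: bij_betw_def)
      from bij_betw_trans[OF bij_betw_trans[OF bij_betw_inv_into[OF 1] action_bij[OF g]] 1]
      show ?thesis by (simp add: o_def)
    qed
    then show "unitary_operator smul' ?H ?ip (?\<pi> g)"
      using g assms(3)
      by (auto simp: unitary_operator_def linear_on_space_def add[symmetric] smul[symmetric]
          H_add H_smul action_closed action_add action_smul action_ip)
  next
    fix x assume x: "x \<in> ?H"
    then have "continuous_map T (htopology H ip) (\<lambda>g. \<pi> g (inv_into H \<Phi> x))"
      using strongly_continuous[of "inv_into H \<Phi> x"] by (simp add: inv_into_into)
    from continuous_map_compose[OF this transport_continuous[OF tr]]
    show "continuous_map T (htopology ?H ?ip) (\<lambda>g. ?\<pi> g x)" by (simp add: o_def)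
  qed (use assms(3) in \<open>auto simp: action_mult action_closed\<close>)
qed

end

text \<open>
  The closed linear span of an orbit embeds into the functions on the group
  by taking matrix coefficients.
\<close>

theorem kazhdan_pair_universal:
  fixes G :: "('g, 'b) monoid_scheme" (structure)
  assumes "topological_group G T" "Q \<subseteq> carrier G" "kazhdan_pair G T Q \<epsilon> TYPE('g \<Rightarrow> complex)"
  shows "kazhdan_pair G T Q \<epsilon> TYPE('v::ab_group_add)"
  unfolding kazhdan_pair_def
proof (intro allI impI)
  fix smul :: "complex \<Rightarrow> 'v \<Rightarrow> 'v" and H ip \<pi>
  assume M: "unitary_module G T smul H ip \<pi>" and ex: "\<exists>v\<in>H. almost_invariant Q \<epsilon> ip \<pi> v"
  interpret topological_group G T by fact
  interpret unitary_module G T smul H ip \<pi> by fact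
  have grp: "group G" by unfold_locales
  obtain \<xi> where \<xi>: "\<xi> \<in> H" "almost_invariant Q \<epsilon> ip \<pi> \<xi>" using ex by blast
  define N where "N = {v \<in> H. \<forall>g\<in>carrier G. ip v (\<pi> g \<xi>) = 0}"
  define K where "K = {w \<in> H. \<forall>v\<in>N. ip v w = 0}"
  have NH: "N \<subseteq> H" and KH: "K \<subseteq> H" by (auto simp: N_def K_def)
  have hK: "complex_hilbert_space smul K ip"
    unfolding K_def using NH by (rule orthogonal_complement_hilbert)
  have N_inv: "\<pi> g v \<in> N" if "g \<in> carrier G" "v \<in> N" for g v
  proof -
    have "ip (\<pi> g v) (\<pi> h \<xi>) = 0" if h: "h \<in> carrier G" for h
    proof -
      have "ip (\<pi> g v) (\<pi> h \<xi>) = ip (\<pi> g v) (\<pi> g (\<pi> (inv g \<otimes> h) \<xi>))"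
        using \<open>g \<in> carrier G\<close> h \<xi> by (simp add: action_mult action_inv[OF grp] action_closed)
      also have "\<dots> = ip v (\<pi> (inv g \<otimes> h) \<xi>)"
        using \<open>g \<in> carrier G\<close> h \<xi> \<open>v \<in> N\<close> NH by (intro action_ip) (auto intro: action_closed)
      also have "\<dots> = 0"
        using \<open>g \<in> carrier G\<close> h \<open>v \<in> N\<close> by (simp add: N_def)
      finally show ?thesis .
    qed
    then show ?thesis using that by (simp add: N_def action_closed)
  qed
  have K_inv: "\<pi> g w \<in> K" if "g \<in> carrier G" "w \<in> K" for g w
  proof -
    have "ip v (\<pi> g w) = 0" if v: "v \<in> N" for v
    proof -
      have "ip v (\<pi> g w) = ip (\<pi> g (\<pi> (inv g) v)) (\<pi> g w)"
        using \<open>g \<in> carrier G\<close> v NH by (simp add: action_inv[OF grp] subset_iff)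
      also have "\<dots> = ip (\<pi> (inv g) v) w"
        using \<open>g \<in> carrier G\<close> \<open>w \<in> K\<close> v NH KH
        by (intro action_ip) (auto intro: action_closed)
      also have "\<dots> = 0"
        using N_inv[of "inv g" v] \<open>g \<in> carrier G\<close> \<open>w \<in> K\<close> v by (simp add: K_def)
      finally show ?thesis .
    qed
    then show ?thesis using that by (simp add: K_def action_closed)
  qed
  have orbit_K: "\<pi> g \<xi> \<in> K" if "g \<in> carrier G" for g
    using that \<xi> by (auto simp: K_def N_def action_closed)
  have \<xi>K: "\<xi> \<in> K"
    using orbit_K[of \<one>] \<xi> by (simp add: action_one[OF grp])
  interpret K: unitary_module G T smul K ip \<pi>
    using submodule[OF grp topspace_eq KH hK K_inv] .

  define \<Phi> where "\<Phi> = (\<lambda>v g. if g \<in> carrier G then ip v (\<pi> g \<xi>) else 0)"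
  define sm where "sm = (\<lambda>(c::complex) (f::'g \<Rightarrow> complex) g. c * f g)"
  have vs: "vector_space sm"
    by unfold_locales (auto simp: sm_def algebra_simps fun_eq_iff)
  have add: "\<Phi> (u + v) = \<Phi> u + \<Phi> v" if "u \<in> K" "v \<in> K" for u v
    using that KH \<xi> by (auto simp: \<Phi>_def fun_eq_iff subset_iff ip_add_left action_closed)
  have smul: "\<Phi> (smul c u) = sm c (\<Phi> u)" if "u \<in> K" for c u
    using that KH \<xi> by (auto simp: \<Phi>_def sm_def fun_eq_iff subset_iff ip_scale_left action_closed)
  have inj: "inj_on \<Phi> K"
  proof (rule inj_onI)
    fix u v assume uv: "u \<in> K" "v \<in> K" "\<Phi> u = \<Phi> v"
    then have "ip u (\<pi> g \<xi>) = ip v (\<pi> g \<xi>)" if "g \<in> carrier G" for g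
      using that by (auto simp: \<Phi>_def dest: fun_cong[of _ _ g])
    then have "u - v \<in> N"
      using uv KH \<xi> by (auto simp: N_def subset_iff ip_diff_left H_diff action_closed)
    moreover have "u - v \<in> K" using uv by (rule_tac K.H_diff)
    ultimately have "ip (u - v) (u - v) = 0" by (simp add: K_def)
    with \<open>u - v \<in> K\<close> show "u = v" using K.ip_pos[of "u - v"] by fastforce
  qed
  define ip' where "ip' = (\<lambda>x y. ip (inv_into K \<Phi> x) (inv_into K \<Phi> y))"
  define \<pi>' where "\<pi>' = (\<lambda>g x. \<Phi> (\<pi> g (inv_into K \<Phi> x)))"
  note tr = vs inj add smul
  have M': "unitary_module G T sm (\<Phi> ` K) ip' \<pi>'"
    unfolding ip'_def \<pi>'_def by (rule K.transport_module[OF topspace_eq tr])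
  have "almost_invariant Q \<epsilon> ip' \<pi>' (\<Phi> \<xi>)"
    unfolding almost_invariant_def
  proof (intro conjI ballI)
    show "\<Phi> \<xi> \<noteq> 0"
    proof
      assume "\<Phi> \<xi> = 0"
      then have "\<Phi> \<xi> = \<Phi> 0" using K.transport_zero[OF tr] by simp
      with inj \<xi>K have "\<xi> = 0" by (simp add: inj_on_eq_iff)
      with \<xi> show False by (simp add: almost_invariant_def)
    qed
    fix g assume g: "g \<in> Q"
    then have gG: "g \<in> carrier G" using assms by blast
    have "\<pi>' g (\<Phi> \<xi>) - \<Phi> \<xi> = \<Phi> (\<pi> g \<xi> - \<xi>)"
      using inj \<xi>K gG by (simp add: \<pi>'_def K.transport_diff[OF tr] orbit_K)
    then show "hnorm ip' (\<pi>' g (\<Phi> \<xi>) - \<Phi> \<xi>) < \<epsilon> * hnorm ip' (\<Phi> \<xi>)"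
      using inj \<xi>K gG g \<xi> by (simp add: ip'_def hnorm_def K.H_diff orbit_K almost_invariant_def)
  qed
  then have "\<exists>f\<in>fixed_vectors (carrier G) (\<Phi> ` K) \<pi>'. f \<noteq> 0"
    using assms(3) M' \<xi>K unfolding kazhdan_pair_def by blast
  then obtain v where v: "v \<in> K" "\<Phi> v \<noteq> 0" "\<forall>g\<in>carrier G. \<Phi> (\<pi> g v) = \<Phi> v"
    using inj by (auto simp: fixed_vectors_def \<pi>'_def)
  then have "v \<in> fixed_vectors (carrier G) H \<pi>"
    using inj KH by (auto simp: fixed_vectors_def inj_on_eq_iff K_inv)
  moreover have "v \<noteq> 0" using v K.transport_zero[OF tr] by auto
  ultimately show "\<exists>v\<in>fixed_vectors (carrier G) H \<pi>. v \<noteq> 0" by blast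
qed


section \<open>The semidirect product\<close>

lemma topological_auto_in_AutoGroup: "\<theta> \<in> topological_auto \<Gamma> T \<Longrightarrow> \<theta> \<in> carrier (AutoGroup \<Gamma>)"
  by (simp add: topological_auto_def AutoGroup_def)

lemma carrier_AutoGroup_hom: "f \<in> carrier (AutoGroup \<Gamma>) \<Longrightarrow> f \<in> hom \<Gamma> \<Gamma>"
  by (simp add: AutoGroup_def auto_def)

lemma AutoGroup_mult_apply:
  "\<lbrakk>f \<in> carrier (AutoGroup \<Gamma>); f' \<in> carrier (AutoGroup \<Gamma>); x \<in> carrier \<Gamma>\<rbrakk>
    \<Longrightarrow> (f \<otimes>\<^bsub>AutoGroup \<Gamma>\<^esub> f') x = f (f' x)"
  by (simp add: AutoGroup_def BijGroup_def auto_def compose_def)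

lemma AutoGroup_one_apply: "x \<in> carrier \<Gamma> \<Longrightarrow> \<one>\<^bsub>AutoGroup \<Gamma>\<^esub> x = x"
  by (simp add: AutoGroup_def BijGroup_def)

lemma group_semidirect_int:
  assumes "group \<Gamma>" "\<theta> \<in> carrier (AutoGroup \<Gamma>)"
  shows "group (semidirect_int \<Gamma> \<theta>)"
proof -
  interpret group \<Gamma> by fact
  interpret A: group "AutoGroup \<Gamma>" by (rule AutoGroup)
  let ?p = "\<lambda>m::int. \<theta> [^]\<^bsub>AutoGroup \<Gamma>\<^esub> m"
  have p: "?p m \<in> carrier (AutoGroup \<Gamma>)" for m
    using assms(2) by simp
  have p_closed: "?p m x \<in> carrier \<Gamma>" if "x \<in> carrier \<Gamma>" for m x
    using carrier_AutoGroup_hom[OF p] that by (auto simp: hom_def)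
  have p_mult: "?p m (x \<otimes>\<^bsub>\<Gamma>\<^esub> y) = ?p m x \<otimes>\<^bsub>\<Gamma>\<^esub> ?p m y" if "x \<in> carrier \<Gamma>" "y \<in> carrier \<Gamma>" for m x y
    using carrier_AutoGroup_hom[OF p] that by (auto simp: hom_def)
  have p_add: "?p (m + n) x = ?p m (?p n x)" if "x \<in> carrier \<Gamma>" for m n x
    using that assms(2) by (simp add: A.int_pow_mult AutoGroup_mult_apply)
  have p_0: "?p 0 x = x" if "x \<in> carrier \<Gamma>" for x
    using that by (simp add: AutoGroup_one_apply)
  have p_one: "?p m \<one>\<^bsub>\<Gamma>\<^esub> = \<one>\<^bsub>\<Gamma>\<^esub>" for m
    using p_mult[of "\<one>\<^bsub>\<Gamma>\<^esub>" "\<one>\<^bsub>\<Gamma>\<^esub>" m] p_closed[of "\<one>\<^bsub>\<Gamma>\<^esub>" m] by simp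
  show ?thesis
  proof (rule groupI)
    fix x assume "x \<in> carrier (semidirect_int \<Gamma> \<theta>)"
    then obtain h m where x: "x = (h, m)" "h \<in> carrier \<Gamma>" by (auto simp: semidirect_int_def)
    have "(?p (- m) (inv\<^bsub>\<Gamma>\<^esub> h), - m) \<otimes>\<^bsub>semidirect_int \<Gamma> \<theta>\<^esub> x = \<one>\<^bsub>semidirect_int \<Gamma> \<theta>\<^esub>"
      using x p_mult[of "inv\<^bsub>\<Gamma>\<^esub> h" h "- m"] by (simp add: semidirect_int_def p_one)
    moreover have "(?p (- m) (inv\<^bsub>\<Gamma>\<^esub> h), - m) \<in> carrier (semidirect_int \<Gamma> \<theta>)"
      using x by (simp add: semidirect_int_def p_closed)
    ultimately show "\<exists>y\<in>carrier (semidirect_int \<Gamma> \<theta>). y \<otimes>\<^bsub>semidirect_int \<Gamma> \<theta>\<^esub> x = \<one>\<^bsub>semidirect_int \<Gamma> \<theta>\<^esub>"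
      by (rule bexI)
  qed (auto simp: semidirect_int_def p_closed p_mult p_add p_one AutoGroup_one_apply m_assoc)
qed

lemma int_generator_conj:
  assumes "group \<Gamma>" "\<theta> \<in> carrier (AutoGroup \<Gamma>)" "h \<in> carrier \<Gamma>"
  defines "G \<equiv> semidirect_int \<Gamma> \<theta>" and "t \<equiv> int_generator \<Gamma>"
  shows "t \<otimes>\<^bsub>G\<^esub> (h, 0) \<otimes>\<^bsub>G\<^esub> inv\<^bsub>G\<^esub> t = (\<theta> h, 0)"
proof -
  interpret group \<Gamma> by fact
  interpret A: group "AutoGroup \<Gamma>" by (rule AutoGroup)
  interpret S: group G unfolding G_def by (rule group_semidirect_int) fact+
  have \<theta>h: "\<theta> h \<in> carrier \<Gamma>"
    using carrier_AutoGroup_hom[OF assms(2)] assms(3) by (auto simp: hom_def)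
  have t: "t \<in> carrier G" and \<theta>: "(\<theta> h, 0) \<in> carrier G" and h: "(h, 0) \<in> carrier G"
    using assms(3) \<theta>h by (auto simp: t_def G_def int_generator_def semidirect_int_def)
  have "t \<otimes>\<^bsub>G\<^esub> (h, 0) = (\<theta> h, 0) \<otimes>\<^bsub>G\<^esub> t"
    using \<theta>h assms(2,3) by (simp add: t_def G_def int_generator_def semidirect_int_def AutoGroup_one_apply)
  then show ?thesis using t \<theta> h by (simp add: S.m_assoc)
qed


section \<open>The topology on cocycles\<close>

lemma openin_cocycle_topology:
  "openin (cocycle_topology G T H ip \<pi>) U \<longleftrightarrow> U \<subseteq> cocycles G T H ip \<pi> \<and>
     (\<forall>b\<in>U. \<exists>K \<epsilon>. compactin T K \<and> \<epsilon> > 0 \<and>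
        {c \<in> cocycles G T H ip \<pi>. \<forall>g\<in>K. hnorm ip (c g - b g) < \<epsilon>} \<subseteq> U)"
proof -
  let ?B = "\<lambda>b K \<epsilon>. {c \<in> cocycles G T H ip \<pi>. \<forall>g\<in>K. hnorm ip (c g - b g) < \<epsilon>}"
  let ?P = "\<lambda>U. U \<subseteq> cocycles G T H ip \<pi> \<and>
     (\<forall>b\<in>U. \<exists>K \<epsilon>. compactin T K \<and> \<epsilon> > 0 \<and> ?B b K \<epsilon> \<subseteq> U)"
  have "istopology ?P"
    unfolding istopology_def
  proof (intro conjI allI impI)
    fix U V assume U: "?P U" and V: "?P V"
    show "U \<inter> V \<subseteq> cocycles G T H ip \<pi>" using U by blast
    show "\<forall>b\<in>U \<inter> V. \<exists>K \<epsilon>. compactin T K \<and> \<epsilon> > 0 \<and> ?B b K \<epsilon> \<subseteq> U \<inter> V"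
    proof
      fix b assume "b \<in> U \<inter> V"
      then have "b \<in> U" "b \<in> V" by auto
      obtain K \<epsilon> where 1: "compactin T K" "\<epsilon> > 0" "?B b K \<epsilon> \<subseteq> U"
        using bspec[OF conjunct2[OF U] \<open>b \<in> U\<close>] by blast
      obtain K' \<epsilon>' where 2: "compactin T K'" "\<epsilon>' > 0" "?B b K' \<epsilon>' \<subseteq> V"
        using bspec[OF conjunct2[OF V] \<open>b \<in> V\<close>] by blast
      have "?B b (K \<union> K') (min \<epsilon> \<epsilon>') \<subseteq> ?B b K \<epsilon> \<inter> ?B b K' \<epsilon>'" by auto
      with 1 2 have "?B b (K \<union> K') (min \<epsilon> \<epsilon>') \<subseteq> U \<inter> V" by blast
      with 1 2 show "\<exists>K \<epsilon>. compactin T K \<and> \<epsilon> > 0 \<and> ?B b K \<epsilon> \<subseteq> U \<inter> V"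
        by (intro exI[of _ "K \<union> K'"] exI[of _ "min \<epsilon> \<epsilon>'"] conjI compactin_Un) auto
    qed
  next
    fix \<U> assume *: "\<forall>U\<in>\<U>. ?P U"
    then show "\<Union>\<U> \<subseteq> cocycles G T H ip \<pi>" by blast
    show "\<forall>b\<in>\<Union>\<U>. \<exists>K \<epsilon>. compactin T K \<and> \<epsilon> > 0 \<and> ?B b K \<epsilon> \<subseteq> \<Union>\<U>"
    proof
      fix b assume "b \<in> \<Union>\<U>"
      then obtain U where "U \<in> \<U>" "b \<in> U" by blast
      then have "?P U" using * by blast
      from bspec[OF conjunct2[OF this] \<open>b \<in> U\<close>]
      obtain K \<epsilon> where "compactin T K" "\<epsilon> > 0" "?B b K \<epsilon> \<subseteq> U" by blast
      moreover have "U \<subseteq> \<Union>\<U>" using \<open>U \<in> \<U>\<close> by blast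
      ultimately show "\<exists>K \<epsilon>. compactin T K \<and> \<epsilon> > 0 \<and> ?B b K \<epsilon> \<subseteq> \<Union>\<U>"
        by (meson order_trans)
    qed
  qed
  then show ?thesis
    by (simp add: cocycle_topology_def topology_inverse')
qed

end

theory Submission
  imports Defs
begin

text \<open>
  By Delorme's theorem every cocycle \<open>b\<close> of \<open>G\<close> restricts to a coboundary on \<open>\<Gamma>\<close>:
  the kernels \<open>exp (- s * \<parallel>b x - b y\<parallel>\<^sup>2)\<close> are invariant and of positive type (Schoenberg); for small
  \<open>s\<close> the associated cyclic vector is almost invariant, hence close to an invariant vector, so
  \<open>b\<close> is bounded on \<open>\<Gamma>\<close>, and the circumcentre of \<open>b \<Gamma>\<close> is a fixed point of the affine action.
  After subtracting a coboundary \<open>b\<close> vanishes on \<open>\<Gamma>\<close>; such cocycles correspond to their value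
  at \<open>t\<close>, an arbitrary vector of \<open>M\<^sup>\<Gamma>\<close>, and the coboundaries among them to the range of
  \<open>t - 1\<close> on \<open>M\<^sup>\<Gamma>\<close>. So \<open>H\<^sup>1\<close> vanishes iff \<open>t - 1\<close> is onto and its reduced version vanishes iff
  the range of \<open>t - 1\<close> is dense. As \<open>t\<close> is unitary, the orthogonal complement of this range
  is the kernel of \<open>t - 1\<close>, so density means that \<open>1\<close> is not an eigenvalue, and a surjective
  \<open>t - 1\<close> is bijective; its inverse has an everywhere defined adjoint and is therefore bounded.
\<close>

section \<open>Approximation in Hilbert spaces\<close>

text \<open>Property (T) speaks only of representations living in \<open>'g => complex\<close>,
  whereas the GNS space is built in a type of functionals on sequences;
  \<open>kazhdan_pair_universal\<close> bridges the two. The construction therefore has to end in a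
  genuine \<open>unitary_module\<close>: finitely supported functions are completed by Cauchy
  sequences while null vectors are still present, and vectors are identified only afterwards, so
  that one quotient suffices. Gaussian kernels are real, so positivity is tested with real
  coefficients. A Kazhdan pair only promises some nonzero fixed vector; closeness to the cyclic
  vector comes from applying it to the orthogonal complement of the fixed vectors. In the reduced
  case, closeness at \<open>t\<close> has to become uniform closeness on compact sets: these meet
  only finitely many cosets of \<Gamma>, and a cocycle vanishing on \<Gamma> grows at most linearly
  in the exponent of \<open>t\<close>.\<close>

context complex_hilbert_space
begin

lemma hnorm_zero [simp]: "hnorm ip 0 = 0"
  by (simp add: hnorm_def)

lemma hnorm_smul:
  assumes "u \<in> H"
  shows "hnorm ip (smul c u) = cmod c * hnorm ip u"
proof (rule power2_eq_imp_eq)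
  have "ip (smul c u) (smul c u) = (c * cnj c) * ip u u"
    using assms by (simp add: ip_scale_left ip_smul_right H_smul)
  also have "c * cnj c = of_real ((cmod c)\<^sup>2)"
    by (rule complex_norm_square[symmetric])
  finally show "(hnorm ip (smul c u))\<^sup>2 = (cmod c * hnorm ip u)\<^sup>2"
    using assms by (simp add: hnorm_power2 H_smul power_mult_distrib)
qed (use assms in \<open>auto simp: hnorm_nonneg H_smul\<close>)

lemma hnorm_diff_power2:
  assumes "u \<in> H" "v \<in> H"
  shows "(hnorm ip (u - v))\<^sup>2 = (hnorm ip u)\<^sup>2 + (hnorm ip v)\<^sup>2 - 2 * Re (ip u v)"
  using assms ip_cnj[of v u] by (simp add: hnorm_power2 H_diff ip_diff_left ip_diff_right)

lemma hnorm_triangle_diff: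
  assumes "u \<in> H" "v \<in> H" "w \<in> H"
  shows "hnorm ip (u - w) \<le> hnorm ip (u - v) + hnorm ip (v - w)"
  using hnorm_triangle[of "u - v" "v - w"] assms by (simp add: H_diff)

lemma hnorm_triangle_sub:
  assumes "u \<in> H" "v \<in> H"
  shows "\<bar>hnorm ip u - hnorm ip v\<bar> \<le> hnorm ip (u - v)"
  using hnorm_triangle_diff[of u v 0] hnorm_triangle_diff[of v u 0] hnorm_minus_commute[of u v] assms
  by auto

lemma tendsto_hnorm:
  assumes "\<And>n. \<sigma> n \<in> H" "x \<in> H" "w \<in> H" and lim: "(\<lambda>n. hnorm ip (\<sigma> n - x)) \<longlonglongrightarrow> 0"
  shows "(\<lambda>n. hnorm ip (\<sigma> n - w)) \<longlonglongrightarrow> hnorm ip (x - w)"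
proof -
  have "norm (hnorm ip (\<sigma> n - w) - hnorm ip (x - w)) \<le> hnorm ip (\<sigma> n - x)" for n
    using hnorm_triangle_sub[of "\<sigma> n - w" "x - w"] assms by (simp add: H_diff)
  then have "(\<lambda>n. hnorm ip (\<sigma> n - w) - hnorm ip (x - w)) \<longlonglongrightarrow> 0"
    by (intro Lim_null_comparison[OF _ lim] always_eventually) auto
  then show ?thesis by (simp add: LIM_zero_iff)
qed

text \<open>The form of completeness used by the limit constructions below: norms of differences as
  real sequences, instead of the metric topology.\<close>

lemma Cauchy_convergent:
  assumes \<sigma>: "\<And>n. \<sigma> n \<in> H"
    and Cauchy: "\<And>e. e > 0 \<Longrightarrow> \<exists>N. \<forall>m\<ge>N. \<forall>n\<ge>N. hnorm ip (\<sigma> m - \<sigma> n) < e"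
  shows "\<exists>x\<in>H. (\<lambda>n. hnorm ip (\<sigma> n - x)) \<longlonglongrightarrow> 0"
proof -
  have "Hilb.MCauchy \<sigma>"
    using assms by (auto simp: Hilb.MCauchy_def hdist_def)
  then obtain x where x: "limitin Hilb.mtopology \<sigma> x sequentially"
    using complete unfolding Hilb.mcomplete_def by blast
  then have "x \<in> H" "(\<lambda>n. hdist H ip (\<sigma> n) x) \<longlonglongrightarrow> 0"
    using Hilb.limitin_metric_dist_null by blast+
  then show ?thesis using \<sigma> by (auto simp: hdist_def)
qed

section \<open>Minimising sequences, orthogonal approximation and circumcentres\<close>

lemma apollonius:
  assumes "u \<in> H" "v \<in> H" "x \<in> H"
  shows "(hnorm ip (smul (1/2) (u + v) - x))\<^sup>2 =
    ((hnorm ip (u - x))\<^sup>2 + (hnorm ip (v - x))\<^sup>2) / 2 - (hnorm ip (u - v))\<^sup>2 / 4"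
proof -
  define a b where "a = u - x" and "b = v - x"
  have "smul (1/2) x + smul (1/2) x = x"
    using scale_left_distrib[of "1/2" "1/2" x] by simp
  then have "smul (1/2) (u + v) - x = smul (1/2) ((u - x) + (v - x))"
    by (simp add: scale_right_distrib scale_right_diff_distrib algebra_simps)
  moreover have "u - v = (u - x) - (v - x)" by simp
  ultimately have *: "smul (1/2) (u + v) - x = smul (1/2) (a + b)" "u - x = a" "v - x = b" "u - v = a - b"
    by (simp_all add: a_def b_def)
  have ab: "a \<in> H" "b \<in> H" using assms by (simp_all add: a_def b_def H_diff)
  have "(hnorm ip (smul (1/2) (a + b)))\<^sup>2 = (hnorm ip (a + b))\<^sup>2 / 4"
    using ab by (simp add: hnorm_smul H_add power_divide norm_divide)
  also have "(hnorm ip (a + b))\<^sup>2 = (hnorm ip a)\<^sup>2 + (hnorm ip b)\<^sup>2 + 2 * Re (ip a b)"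
    using ab ip_cnj[of b a] by (simp add: hnorm_power2 H_add ip_add_left ip_add_right)
  finally show ?thesis
    unfolding * using hnorm_diff_power2[OF ab] by argo
qed

text \<open>The common core of orthogonal approximation and of the circumcentre: the term in
  \<open>hnorm ip (u - v)\<close> is the gain in the parallelogram law and forces a minimising
  sequence to be Cauchy. As \<open>C\<close> need not be closed, the limit may lie outside it, so
  the sequence is returned as well.\<close>

lemma midpoint_convex_minimizer:
  assumes C: "C \<subseteq> H" "C \<noteq> {}" and mid: "\<And>u v. \<lbrakk>u \<in> C; v \<in> C\<rbrakk> \<Longrightarrow> smul (1/2) (u + v) \<in> C"
    and F0: "\<And>u. u \<in> C \<Longrightarrow> (0::real) \<le> F u"
    and F: "\<And>u v. \<lbrakk>u \<in> C; v \<in> C\<rbrakk> \<Longrightarrow>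
      F (smul (1/2) (u + v)) \<le> (F u + F v) / 2 - (hnorm ip (u - v))\<^sup>2 / 4"
  shows "\<exists>\<sigma> x. (\<forall>n. \<sigma> n \<in> C) \<and> x \<in> H \<and> (\<lambda>n. hnorm ip (\<sigma> n - x)) \<longlonglongrightarrow> 0 \<and>
    (\<lambda>n. F (\<sigma> n)) \<longlonglongrightarrow> Inf (F ` C)"
proof -
  define d where "d = Inf (F ` C)"
  have bdd: "bdd_below (F ` C)" using F0 by (auto intro: bdd_belowI[of _ 0])
  have d_le: "d \<le> F u" if "u \<in> C" for u
    unfolding d_def using bdd that by (simp add: cInf_lower)
  have "\<exists>u\<in>C. F u < d + 1 / Suc n" for n
    using cInf_lessD[of "F ` C" "d + 1 / Suc n"] C(2) by (auto simp: d_def)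
  then obtain \<sigma> where \<sigma>: "\<And>n. \<sigma> n \<in> C" "\<And>n. F (\<sigma> n) < d + 1 / Suc n" by metis
  have inv: "(\<lambda>n. 1 / Suc n) \<longlonglongrightarrow> 0"
    using LIMSEQ_inverse_real_of_nat by (simp add: inverse_eq_divide)
  have lim: "(\<lambda>n. F (\<sigma> n)) \<longlonglongrightarrow> d"
    by (rule tendsto_sandwich[OF _ _ tendsto_const, where h = "\<lambda>n. d + 1 / Suc n"])
      (use d_le \<sigma> tendsto_add[OF tendsto_const inv, of d] in \<open>auto intro!: always_eventually intro: less_imp_le\<close>)
  have "\<exists>x\<in>H. (\<lambda>n. hnorm ip (\<sigma> n - x)) \<longlonglongrightarrow> 0"
  proof (rule Cauchy_convergent)
    show "\<sigma> n \<in> H" for n using \<sigma>(1) C by blast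
    fix e :: real assume "e > 0"
    \<comment> \<open>Two values of \<open>F\<close> below \<open>d + e\<^sup>2 / 4\<close>, with
      the midpoint still at least \<open>d\<close>, leave less than \<open>e\<^sup>2 / 4\<close> for
      a quarter of the squared distance.\<close>
    obtain N where N: "1 / Suc n < e\<^sup>2 / 4" if "n \<ge> N" for n
      using order_tendstoD(2)[OF inv, of "e\<^sup>2 / 4"] \<open>e > 0\<close> by (auto simp: eventually_sequentially)
    have "hnorm ip (\<sigma> m - \<sigma> n) < e" if "m \<ge> N" "n \<ge> N" for m n
    proof (rule power2_less_imp_less)
      have "d \<le> (F (\<sigma> m) + F (\<sigma> n)) / 2 - (hnorm ip (\<sigma> m - \<sigma> n))\<^sup>2 / 4"
        using d_le[OF mid[OF \<sigma>(1) \<sigma>(1)]] F[OF \<sigma>(1) \<sigma>(1)] order_trans by blast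
      moreover have "F (\<sigma> m) < d + e\<^sup>2 / 4" "F (\<sigma> n) < d + e\<^sup>2 / 4"
        using order_less_trans[OF \<sigma>(2) add_strict_left_mono[OF N]] that by blast+
      ultimately show "(hnorm ip (\<sigma> m - \<sigma> n))\<^sup>2 < e\<^sup>2" by argo
    qed (use \<open>e > 0\<close> in simp)
    then show "\<exists>N. \<forall>m\<ge>N. \<forall>n\<ge>N. hnorm ip (\<sigma> m - \<sigma> n) < e" by blast
  qed
  then show ?thesis using \<sigma>(1) lim unfolding d_def by blast
qed

text \<open>Subtracting the projection of \<open>z\<close> onto \<open>p\<close>, with coefficient
  \<open>ip z p / ip p p\<close>, lowers the squared norm by the squared modulus of
  \<open>ip z p\<close> divided by \<open>ip p p\<close>; minimality forbids any such loss.\<close>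

lemma orthogonal_if_minimal:
  assumes "z \<in> H" "p \<in> H" and min: "\<And>c. hnorm ip z \<le> hnorm ip (z - smul c p)"
  shows "ip z p = 0"
proof (cases "p = 0")
  case True
  then show ?thesis using assms by simp
next
  case False
  define b where "b = Re (ip p p)"
  have b: "b > 0" "ip p p = of_real b"
    using ip_pos[OF assms(2) False] ip_self_real[OF assms(2)] by (auto simp: b_def)
  define c where "c = ip z p / of_real b"
  have "Re (ip z (smul c p)) = (cmod (ip z p))\<^sup>2 / b"
    using assms b
    by (simp add: ip_smul_right c_def mult.commute complex_norm_square[symmetric] flip: of_real_power)
  moreover have "(hnorm ip (smul c p))\<^sup>2 = (cmod (ip z p))\<^sup>2 / b"
  proof -
    have "(hnorm ip p)\<^sup>2 = b" using assms by (simp add: hnorm_power2 b_def)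
    then show ?thesis
      using assms b(1) by (simp add: hnorm_smul c_def norm_divide power_mult_distrib power_divide)
        (simp add: power2_eq_square)
  qed
  ultimately have "(hnorm ip (z - smul c p))\<^sup>2 = (hnorm ip z)\<^sup>2 - (cmod (ip z p))\<^sup>2 / b"
    using assms by (simp add: hnorm_diff_power2 H_smul)
  moreover have "(hnorm ip z)\<^sup>2 \<le> (hnorm ip (z - smul c p))\<^sup>2"
    using min assms by (simp add: power_mono hnorm_nonneg)
  ultimately have "(cmod (ip z p))\<^sup>2 / b \<le> 0" by simp
  then show ?thesis using b(1) by (simp add: divide_le_0_iff)
qed

text \<open>The decomposition \<open>x = (x - z) + z\<close> along a subspace that need not be
  closed: \<open>x - z\<close> lies in the closure of \<open>P\<close> and is therefore described by
  a sequence in \<open>P\<close>. It will be applied to fixed vectors and to the range of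
  \<open>t - 1\<close>.\<close>

lemma orthogonal_approximation:
  assumes P: "subspace P" "P \<subseteq> H" and x: "x \<in> H"
  shows "\<exists>\<sigma> z. (\<forall>n. \<sigma> n \<in> P) \<and> z \<in> H \<and> (\<lambda>n. hnorm ip (\<sigma> n - (x - z))) \<longlonglongrightarrow> 0 \<and> (\<forall>p\<in>P. ip z p = 0)"
proof -
  let ?F = "\<lambda>u. (hnorm ip (u - x))\<^sup>2"
  have "\<exists>\<sigma> y. (\<forall>n. \<sigma> n \<in> P) \<and> y \<in> H \<and> (\<lambda>n. hnorm ip (\<sigma> n - y)) \<longlonglongrightarrow> 0 \<and>
    (\<lambda>n. ?F (\<sigma> n)) \<longlonglongrightarrow> Inf (?F ` P)"
  proof (rule midpoint_convex_minimizer)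
    show "P \<noteq> {}" using subspace_0[OF P(1)] by blast
    show "?F (smul (1/2) (u + v)) \<le> (?F u + ?F v) / 2 - (hnorm ip (u - v))\<^sup>2 / 4"
      if "u \<in> P" "v \<in> P" for u v
      using apollonius[of u v x] that P(2) x by (auto simp: subset_iff)
  qed (use P in \<open>auto simp: subspace_add subspace_scale\<close>)
  then obtain \<sigma> y where \<sigma>: "\<And>n. \<sigma> n \<in> P" and y: "y \<in> H"
    and lim: "(\<lambda>n. hnorm ip (\<sigma> n - y)) \<longlonglongrightarrow> 0" and min: "(\<lambda>n. ?F (\<sigma> n)) \<longlonglongrightarrow> Inf (?F ` P)"
    by blast
  have \<sigma>H: "\<sigma> n \<in> H" for n using \<sigma> P(2) by blast
  define z where "z = x - y"
  have z: "z \<in> H" using x y by (simp add: z_def H_diff)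
  have limF: "(\<lambda>n. (hnorm ip (\<sigma> n - w))\<^sup>2) \<longlonglongrightarrow> (hnorm ip (y - w))\<^sup>2" if "w \<in> H" for w
    by (intro tendsto_power tendsto_hnorm \<sigma>H y that lim)
  have "ip z p = 0" if p: "p \<in> P" for p
  proof (rule orthogonal_if_minimal[OF z])
    show pH: "p \<in> H" using p P(2) by blast
    fix c
    \<comment> \<open>Shifting the approximating point by \<open>smul c p\<close> stays in
      \<open>P\<close>. Read as a bound on the distance from \<open>\<sigma> n\<close> to
      \<open>x - smul c p\<close>, this passes to the limit \<open>y\<close>.\<close>
    have "Inf (?F ` P) \<le> (hnorm ip (\<sigma> n - (x - smul c p)))\<^sup>2" for n
    proof -
      have "\<sigma> n + smul c p \<in> P" using \<sigma> p P(1) by (simp add: subspace_add subspace_scale)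
      then have "Inf (?F ` P) \<le> ?F (\<sigma> n + smul c p)"
        by (intro cInf_lower bdd_belowI[of _ 0]) auto
      then show ?thesis by (simp add: algebra_simps)
    qed
    then have "Inf (?F ` P) \<le> (hnorm ip (y - (x - smul c p)))\<^sup>2"
      using limF[of "x - smul c p"] x pH by (intro Lim_bounded2) (auto simp: H_diff H_smul)
    moreover have "Inf (?F ` P) = (hnorm ip (y - x))\<^sup>2"
      using limF[OF x] min by (rule LIMSEQ_unique[symmetric])
    ultimately have "hnorm ip (y - x) \<le> hnorm ip (y - (x - smul c p))"
      by (rule_tac power2_le_imp_le) (use x y pH in \<open>auto simp: hnorm_nonneg H_diff H_smul\<close>)
    then show "hnorm ip z \<le> hnorm ip (z - smul c p)"
      using hnorm_minus_commute[of y x] hnorm_minus_commute[of y "x - smul c p"] x y pH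
      by (simp add: z_def H_diff H_smul algebra_simps)
  qed
  then show ?thesis
    using \<sigma> z lim by (intro exI[of _ \<sigma>] exI[of _ z]) (simp add: z_def)
qed

text \<open>
  The centre \<open>c\<close> of the smallest ball containing \<open>X\<close>, characterised without naming its
  radius. Isometries preserving \<open>X\<close> visibly preserve the condition and so fix \<open>c\<close>.
\<close>

lemma circumcentre:
  assumes X: "X \<subseteq> H" "X \<noteq> {}" and bounded: "\<And>x. x \<in> X \<Longrightarrow> hnorm ip x \<le> R"
  shows "\<exists>c\<in>H. \<forall>c'\<in>H. (\<forall>r. (\<forall>x\<in>X. hnorm ip (c - x) \<le> r) \<longrightarrow> (\<forall>x\<in>X. hnorm ip (c' - x) \<le> r)) \<longrightarrow> c' = c"
proof -
  define F where "F = (\<lambda>u. SUP x\<in>X. (hnorm ip (u - x))\<^sup>2)"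
  have le_F: "(hnorm ip (u - x))\<^sup>2 \<le> F u" if "u \<in> H" "x \<in> X" for u x
  proof -
    have "(hnorm ip (u - y))\<^sup>2 \<le> (hnorm ip u + R)\<^sup>2" if "y \<in> X" for y
      using hnorm_triangle_diff[of u 0 y] hnorm_minus_commute[of 0 y] bounded[OF that] X(1) that \<open>u \<in> H\<close>
      by (intro power_mono) (auto simp: hnorm_nonneg H_diff subset_iff)
    then show ?thesis
      unfolding F_def using that by (intro cSUP_upper bdd_aboveI2) auto
  qed
  have F_le: "F u \<le> r" if "\<And>x. x \<in> X \<Longrightarrow> (hnorm ip (u - x))\<^sup>2 \<le> r" for u r
    unfolding F_def using X(2) that by (rule cSUP_least)
  have F0: "0 \<le> F u" if "u \<in> H" for u
    using le_F[OF that] X(2) by (meson ex_in_conv order_trans zero_le_power2)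
  have mid: "F (smul (1/2) (u + v)) \<le> (F u + F v) / 2 - (hnorm ip (u - v))\<^sup>2 / 4"
    if "u \<in> H" "v \<in> H" for u v
  proof (rule F_le)
    fix x assume "x \<in> X"
    then show "(hnorm ip (smul (1/2) (u + v) - x))\<^sup>2 \<le> (F u + F v) / 2 - (hnorm ip (u - v))\<^sup>2 / 4"
      using apollonius[of u v x] le_F[of u x] le_F[of v x] that X(1) by (auto simp: subset_iff)
  qed
  obtain \<sigma> c where \<sigma>: "\<And>n. \<sigma> n \<in> H" and c: "c \<in> H"
    and lim: "(\<lambda>n. hnorm ip (\<sigma> n - c)) \<longlonglongrightarrow> 0" and min: "(\<lambda>n. F (\<sigma> n)) \<longlonglongrightarrow> Inf (F ` H)"
    using midpoint_convex_minimizer[of H F, OF _ _ _ F0 mid] H_zero H_smul H_add by blast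
  \<comment> \<open>As a supremum of continuous functions \<open>F\<close> is lower semicontinuous:
    each distance to a point of \<open>X\<close> passes to the limit separately, and only then is
    the supremum taken.\<close>
  have "F c \<le> Inf (F ` H)"
  proof (rule F_le)
    fix x assume "x \<in> X"
    then have x: "x \<in> H" using X(1) by blast
    show "(hnorm ip (c - x))\<^sup>2 \<le> Inf (F ` H)"
      by (rule LIMSEQ_le[OF tendsto_power[OF tendsto_hnorm[OF \<sigma> c x lim]] min])
        (use \<open>x \<in> X\<close> le_F \<sigma> in auto)
  qed
  have Inf_le: "Inf (F ` H) \<le> F u" if "u \<in> H" for u
    using that F0 by (intro cInf_lower bdd_belowI[of _ 0]) auto
  have "c' = c" if c': "c' \<in> H"
    and le: "\<forall>r. (\<forall>x\<in>X. hnorm ip (c - x) \<le> r) \<longrightarrow> (\<forall>x\<in>X. hnorm ip (c' - x) \<le> r)" for c'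
  proof -
    \<comment> \<open>The condition over all radii is used at the single radius
      \<open>sqrt (F c)\<close>. It makes \<open>c'\<close> a minimiser as well, and the midpoint of
      two distinct minimisers would do better.\<close>
    have "hnorm ip (c - x) \<le> sqrt (F c)" if "x \<in> X" for x
      using le_F[OF c that] by (rule real_le_rsqrt)
    then have "hnorm ip (c' - x) \<le> sqrt (F c)" if "x \<in> X" for x using le that by blast
    then have "(hnorm ip (c' - x))\<^sup>2 \<le> F c" if "x \<in> X" for x
      using power_mono[of "hnorm ip (c' - x)" "sqrt (F c)" 2] that c' X(1) F0[OF c]
      by (auto simp: hnorm_nonneg H_diff subset_iff)
    then have "F c' \<le> F c" by (rule F_le)
    then have "(hnorm ip (c - c'))\<^sup>2 \<le> 0"
      using mid[OF c c'] \<open>F c \<le> Inf (F ` H)\<close> Inf_le[OF H_smul[OF H_add[OF c c']], of "1/2"]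
      by argo
    then show ?thesis using c c' hnorm_eq_0_iff[of "c - c'"] by (simp add: H_diff)
  qed
  then show ?thesis using c by blast
qed

text \<open>Sokal's gliding-hump proof of the uniform boundedness principle.\<close>

lemma uniform_boundedness:
  assumes Y: "Y \<subseteq> H" and pointwise: "\<And>v. v \<in> H \<Longrightarrow> \<exists>K. \<forall>y\<in>Y. cmod (ip v y) \<le> K"
  shows "\<exists>K. \<forall>y\<in>Y. hnorm ip y \<le> K"
proof (rule ccontr)
  assume "\<nexists>K. \<forall>y\<in>Y. hnorm ip y \<le> K"
  \<comment> \<open>Norms beyond \<open>8 ^ n\<close> will be tested against increments of norm
    \<open>(1/4) ^ n\<close>, so that the pairings grow at least like a multiple of
    \<open>2 ^ n\<close>.\<close>
  then have "\<exists>y\<in>Y. 8 ^ n < hnorm ip y" for n :: nat by (meson not_le)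
  then obtain y where y: "\<And>n. y n \<in> Y" "\<And>n::nat. 8 ^ n < hnorm ip (y n)" by metis
  have yH: "y n \<in> H" and y0: "hnorm ip (y n) > 0" for n
    using y[of n] Y by (auto intro: order_less_trans[of 0 "8 ^ n"])
  define e where "e = (\<lambda>n. smul (of_real ((1/4) ^ n / hnorm ip (y n))) (y n))"
  have eH: "e n \<in> H" for n by (simp add: e_def H_smul yH)
  have norm_e: "hnorm ip (e n) = (1/4) ^ n" for n
    using y0[of n] by (simp add: e_def hnorm_smul yH norm_divide norm_power)
  have ip_e: "cmod (ip (e n) (y n)) = (1/4) ^ n * hnorm ip (y n)" for n
  proof -
    have "ip (y n) (y n) = of_real ((hnorm ip (y n))\<^sup>2)"
      using ip_self_real yH by (simp add: hnorm_power2)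
    then show ?thesis
      using y0[of n] by (simp add: e_def ip_scale_left yH power2_eq_square norm_mult norm_divide norm_power)
  qed
  \<comment> \<open>The pairings of \<open>u\<close> and of \<open>u + e n\<close> with
    \<open>y n\<close> differ by \<open>ip (e n) (y n)\<close>, so at least one of them has at least
    half its modulus. The hump is added only when \<open>u\<close> alone fails.\<close>
  define x where "x = rec_nat 0 (\<lambda>n u. if cmod (ip u (y n)) \<ge> (1/4) ^ n * hnorm ip (y n) / 2 then u else u + e n)"
  have x_Suc: "x (Suc n) = (if cmod (ip (x n) (y n)) \<ge> (1/4) ^ n * hnorm ip (y n) / 2 then x n else x n + e n)" for n
    by (simp add: x_def)
  have xH: "x n \<in> H" for n
    by (induction n) (simp add: x_def, simp add: x_Suc H_add eH)
  have large: "cmod (ip (x (Suc n)) (y n)) \<ge> (1/4) ^ n * hnorm ip (y n) / 2" for n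
  proof (cases "cmod (ip (x n) (y n)) \<ge> (1/4) ^ n * hnorm ip (y n) / 2")
    case False
    then have "ip (x (Suc n)) (y n) = ip (x n) (y n) + ip (e n) (y n)"
      by (simp add: x_Suc ip_add_left xH eH yH)
    then show ?thesis
      using False norm_triangle_ineq2[of "ip (e n) (y n)" "- ip (x n) (y n)"] ip_e[of n]
      by (simp add: add.commute)
  qed (simp add: x_Suc)
  have step: "hnorm ip (x (Suc n) - x n) \<le> (1/4) ^ n" for n
    by (simp add: x_Suc norm_e)
  \<comment> \<open>Keeping the subtracted term of the geometric sum is what lets the induction
    close.\<close>
  have tail: "hnorm ip (x (n + k) - x n) \<le> 4/3 * ((1/4) ^ n - (1/4) ^ (n + k))" for n k
  proof (induction k)
    case (Suc k)
    show ?case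
      using hnorm_triangle_diff[of "x (Suc (n + k))" "x (n + k)" "x n"] step[of "n + k"] Suc
      by (simp add: xH)
  qed simp
  have tail': "hnorm ip (x m - x n) \<le> 4/3 * (1/4) ^ n" if "m \<ge> n" for m n
    using tail[of n "m - n"] that by (simp add: order_trans)
  have "\<exists>z\<in>H. (\<lambda>n. hnorm ip (x n - z)) \<longlonglongrightarrow> 0"
  proof (rule Cauchy_convergent[OF xH])
    fix \<epsilon> :: real assume "\<epsilon> > 0"
    obtain N where N: "(1/4::real) ^ N < \<epsilon> / 4" using real_arch_pow_inv[of "\<epsilon> / 4" "1/4"] \<open>\<epsilon> > 0\<close> by auto
    have "hnorm ip (x m - x n) < \<epsilon>" if "m \<ge> N" "n \<ge> N" for m n
      using hnorm_triangle_diff[of "x m" "x N" "x n"] hnorm_minus_commute[of "x N" "x n"]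
        tail'[OF that(1)] tail'[OF that(2)] N \<open>\<epsilon> > 0\<close> by (simp add: xH)
    then show "\<exists>N. \<forall>m\<ge>N. \<forall>n\<ge>N. hnorm ip (x m - x n) < \<epsilon>" by blast
  qed
  then obtain z where z: "z \<in> H" "(\<lambda>n. hnorm ip (x n - z)) \<longlonglongrightarrow> 0" by blast
  \<comment> \<open>All later increments together have norm at most
    \<open>4/3 * (1/4) ^ Suc n\<close>, a third of \<open>(1/4) ^ n\<close>; of the half secured in
    \<open>large\<close>, a sixth remains.\<close>
  have close: "hnorm ip (z - x (Suc n)) \<le> (1/4) ^ n / 3" for n
    by (rule LIMSEQ_le[OF tendsto_hnorm[OF xH z(1) xH z(2)] tendsto_const])
      (use tail'[of "Suc n"] in auto)
  have grow: "cmod (ip z (y n)) \<ge> 2 ^ n / 6" for n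
  proof -
    have "cmod (ip (x (Suc n)) (y n)) - cmod (ip z (y n)) \<le> cmod (ip (z - x (Suc n)) (y n))"
      using norm_triangle_ineq2[of "ip (x (Suc n)) (y n)" "ip z (y n)"]
      by (simp add: ip_diff_left z xH yH norm_minus_commute)
    also have "\<dots> \<le> hnorm ip (z - x (Suc n)) * hnorm ip (y n)"
      by (rule Cauchy_Schwarz) (simp_all add: H_diff z xH yH)
    also have "\<dots> \<le> (1/4) ^ n / 3 * hnorm ip (y n)"
      using close y0[of n] by (intro mult_right_mono) auto
    finally have "cmod (ip z (y n)) \<ge> (1/4) ^ n * hnorm ip (y n) / 6"
      using large[of n] by linarith
    moreover have "(1/4) ^ n * hnorm ip (y n) \<ge> (1/4) ^ n * 8 ^ n"
      using y(2)[of n] by (intro mult_left_mono) auto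
    moreover have "(1/4) ^ n * 8 ^ n = (2::real) ^ n"
      by (simp flip: power_mult_distrib)
    ultimately show ?thesis by linarith
  qed
  obtain K where K: "\<And>n. cmod (ip z (y n)) \<le> K" using pointwise[OF z(1)] y(1) by blast
  obtain n where "6 * K < 2 ^ n" using real_arch_pow[of 2 "6 * K"] by auto
  then show False using grow[of n] K[of n] by linarith
qed

text \<open>For fixed \<open>v\<close>, moving \<open>B\<close> across the inner product bounds
  \<open>ip v (B u)\<close> over the unit ball by the norm of \<open>B' v\<close>. Uniform
  boundedness then bounds the image of the unit ball, and scaling gives the operator bound.\<close>

lemma Hellinger_Toeplitz:
  assumes B: "B \<in> H \<rightarrow> H" "B' \<in> H \<rightarrow> H" and scale: "\<And>c u. u \<in> H \<Longrightarrow> B (smul c u) = smul c (B u)"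
    and adj: "\<And>u v. \<lbrakk>u \<in> H; v \<in> H\<rbrakk> \<Longrightarrow> ip (B' v) u = ip v (B u)"
  shows "\<exists>C. \<forall>u\<in>H. hnorm ip (B u) \<le> C * hnorm ip u"
proof -
  have "\<exists>C. \<forall>y\<in>B ` {u \<in> H. hnorm ip u \<le> 1}. hnorm ip y \<le> C"
  proof (rule uniform_boundedness)
    fix v assume v: "v \<in> H"
    have "cmod (ip v (B u)) \<le> hnorm ip (B' v)" if "u \<in> H" "hnorm ip u \<le> 1" for u
    proof -
      have "cmod (ip v (B u)) \<le> hnorm ip (B' v) * hnorm ip u"
        using Cauchy_Schwarz[of "B' v" u] adj[of u v] v that B by auto
      also have "\<dots> \<le> hnorm ip (B' v)"
        using that v B by (intro mult_left_le) (auto intro: hnorm_nonneg)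
      finally show ?thesis .
    qed
    then show "\<exists>K. \<forall>y\<in>B ` {u \<in> H. hnorm ip u \<le> 1}. cmod (ip v y) \<le> K" by blast
  qed (use B in auto)
  then obtain C where C: "\<And>u. \<lbrakk>u \<in> H; hnorm ip u \<le> 1\<rbrakk> \<Longrightarrow> hnorm ip (B u) \<le> C" by blast
  have "hnorm ip (B u) \<le> C * hnorm ip u" if u: "u \<in> H" for u
  proof (cases "u = 0")
    case True
    then show ?thesis using scale[OF u, of 0] by simp
  next
    case False
    then have n: "hnorm ip u > 0" using u hnorm_eq_0_iff hnorm_nonneg by (metis less_eq_real_def)
    define c where "c = complex_of_real (1 / hnorm ip u)"
    have c: "cmod c = 1 / hnorm ip u" using n by (simp add: c_def norm_divide)
    have "hnorm ip (B (smul c u)) \<le> C"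
      using n u c by (intro C) (auto simp: H_smul hnorm_smul)
    moreover have "hnorm ip (B (smul c u)) = hnorm ip (B u) / hnorm ip u"
      using u c B by (simp add: scale hnorm_smul Pi_iff)
    ultimately show ?thesis using n by (simp add: divide_le_eq)
  qed
  then show ?thesis by blast
qed

end

section \<open>Completing semi-inner product spaces with an isometric group action\<close>

text \<open>Null vectors are allowed because the form defined by a kernel of positive type need not
  be definite; \<open>hnorm\<close> is then only a seminorm.\<close>

locale semi_inner_product_space = vector_space smul
  for smul :: "complex \<Rightarrow> 'v::ab_group_add \<Rightarrow> 'v" +
  fixes V :: "'v set" and ip :: "'v \<Rightarrow> 'v \<Rightarrow> complex"
  assumes subspace_V: "subspace V"
    and add_left: "\<lbrakk>u \<in> V; v \<in> V; w \<in> V\<rbrakk> \<Longrightarrow> ip (u + v) w = ip u w + ip v w"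
    and scale_left: "\<lbrakk>u \<in> V; v \<in> V\<rbrakk> \<Longrightarrow> ip (smul c u) v = c * ip u v"
    and cnj_sym: "\<lbrakk>u \<in> V; v \<in> V\<rbrakk> \<Longrightarrow> ip u v = cnj (ip v u)"
    and nonneg: "u \<in> V \<Longrightarrow> Re (ip u u) \<ge> 0"
begin

lemma V_zero [simp]: "0 \<in> V"
  and V_add: "\<lbrakk>u \<in> V; v \<in> V\<rbrakk> \<Longrightarrow> u + v \<in> V"
  and V_smul: "u \<in> V \<Longrightarrow> smul c u \<in> V"
  and V_diff: "\<lbrakk>u \<in> V; v \<in> V\<rbrakk> \<Longrightarrow> u - v \<in> V"
  using subspace_V subspace_diff[OF subspace_V] by (auto simp: subspace_def)

lemma diff_left: "\<lbrakk>u \<in> V; v \<in> V; w \<in> V\<rbrakk> \<Longrightarrow> ip (u - v) w = ip u w - ip v w"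
  using add_left[of "u - v" v w] by (simp add: V_diff)

lemma zero_left [simp]: "v \<in> V \<Longrightarrow> ip 0 v = 0"
  using diff_left[of v v v] by simp

lemma add_right: "\<lbrakk>u \<in> V; v \<in> V; w \<in> V\<rbrakk> \<Longrightarrow> ip w (u + v) = ip w u + ip w v"
  using cnj_sym[of w "u + v"] cnj_sym[of w u] cnj_sym[of w v] by (simp add: add_left V_add)

lemma scale_right: "\<lbrakk>u \<in> V; v \<in> V\<rbrakk> \<Longrightarrow> ip v (smul c u) = cnj c * ip v u"
  using cnj_sym[of v "smul c u"] cnj_sym[of v u] by (simp add: scale_left V_smul)

lemma diff_right: "\<lbrakk>u \<in> V; v \<in> V; w \<in> V\<rbrakk> \<Longrightarrow> ip w (u - v) = ip w u - ip w v"
  using add_right[of "u - v" v w] by (simp add: V_diff)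

lemma zero_right [simp]: "v \<in> V \<Longrightarrow> ip v 0 = 0"
  using diff_right[of v v v] by simp

lemma seminorm_nonneg: "u \<in> V \<Longrightarrow> 0 \<le> hnorm ip u"
  by (simp add: hnorm_def nonneg)

lemma seminorm_power2: "u \<in> V \<Longrightarrow> (hnorm ip u)\<^sup>2 = Re (ip u u)"
  by (simp add: hnorm_def nonneg)

lemma seminorm_zero [simp]: "hnorm ip 0 = 0"
  by (simp add: hnorm_def)

lemma seminorm_diff_power2:
  assumes "u \<in> V" "v \<in> V"
  shows "(hnorm ip (u - v))\<^sup>2 = (hnorm ip u)\<^sup>2 + (hnorm ip v)\<^sup>2 - 2 * Re (ip u v)"
  using assms cnj_sym[of v u] by (simp add: seminorm_power2 V_diff diff_left diff_right)

lemma semi_Cauchy_Schwarz: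
  assumes u: "u \<in> V" and w: "w \<in> V"
  shows "cmod (ip u w) \<le> hnorm ip u * hnorm ip w"
proof -
  define l where "l = cmod (ip u w)"
  \<comment> \<open>Positivity of the form on \<open>u - smul c w\<close> with
    \<open>c = s * ip u w\<close>. Dividing by \<open>ip w w\<close> at once would fail for a
    nonzero null vector \<open>w\<close>.\<close>
  have quad: "0 \<le> (hnorm ip u)\<^sup>2 + s\<^sup>2 * (l\<^sup>2 * (hnorm ip w)\<^sup>2) - 2 * (s * l\<^sup>2)" for s :: real
  proof -
    define c where "c = of_real s * ip u w"
    have c: "c * cnj c = of_real (s\<^sup>2 * l\<^sup>2)"
      using complex_norm_square[of "ip u w"]
      by (simp add: c_def l_def power2_eq_square[of "complex_of_real s"])
    have "ip (smul c w) (smul c w) = (c * cnj c) * ip w w"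
      using w by (simp add: scale_left scale_right V_smul mult.assoc)
    then have "(hnorm ip (smul c w))\<^sup>2 = s\<^sup>2 * l\<^sup>2 * (hnorm ip w)\<^sup>2"
      using w by (simp add: seminorm_power2 V_smul c)
    moreover have "ip u (smul c w) = of_real (s * l\<^sup>2)"
      using u w complex_norm_square[of "ip u w"] by (simp add: scale_right c_def l_def mult.commute)
    then have "Re (ip u (smul c w)) = s * l\<^sup>2" by simp
    ultimately have "(hnorm ip (u - smul c w))\<^sup>2 = (hnorm ip u)\<^sup>2 + s\<^sup>2 * l\<^sup>2 * (hnorm ip w)\<^sup>2 - 2 * (s * l\<^sup>2)"
      using u w by (simp add: seminorm_diff_power2 V_smul)
    then show ?thesis by (metis zero_le_power2 mult.assoc)
  qed
  have "l\<^sup>2 \<le> (hnorm ip u)\<^sup>2 * (hnorm ip w)\<^sup>2"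
  proof (cases "hnorm ip w = 0")
    case True
    have "l\<^sup>2 = 0"
    proof (rule ccontr)
      assume "l\<^sup>2 \<noteq> 0"
      \<comment> \<open>With \<open>hnorm ip w = 0\<close> the bound is affine in \<open>s\<close>,
        and this value of \<open>s\<close> turns its right-hand side into
        \<open>- 1\<close>.\<close>
      then show False
        using quad[of "((hnorm ip u)\<^sup>2 + 1) / (2 * l\<^sup>2)"] True by simp
    qed
    then show ?thesis by simp
  next
    case False
    define q where "q = (hnorm ip w)\<^sup>2"
    have q: "q > 0" using False by (simp add: q_def)
    have "0 \<le> (hnorm ip u)\<^sup>2 - l\<^sup>2 / q"
    proof -
      have "(1 / q)\<^sup>2 * (l\<^sup>2 * q) = l\<^sup>2 / q" using q by (simp add: power2_eq_square)
      then show ?thesis using quad[of "1 / q"] by (simp add: q_def[symmetric])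
    qed
    then show ?thesis using q by (simp add: q_def[symmetric] divide_le_eq)
  qed
  then show ?thesis
    by (rule_tac power2_le_imp_le)
      (use u w in \<open>auto simp: l_def seminorm_nonneg power_mult_distrib\<close>)
qed

lemma seminorm_triangle:
  assumes "u \<in> V" "w \<in> V"
  shows "hnorm ip (u + w) \<le> hnorm ip u + hnorm ip w"
proof (rule power2_le_imp_le)
  have "Re (ip (u + w) (u + w)) = Re (ip u u) + Re (ip w w) + 2 * Re (ip u w)"
    using assms cnj_sym[of w u] by (simp add: add_left add_right V_add)
  also have "Re (ip u w) \<le> hnorm ip u * hnorm ip w"
    using semi_Cauchy_Schwarz[OF assms] complex_Re_le_cmod order_trans by blast
  finally show "(hnorm ip (u + w))\<^sup>2 \<le> (hnorm ip u + hnorm ip w)\<^sup>2"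
    using assms by (simp add: seminorm_power2 V_add power2_sum)
qed (use assms in \<open>simp add: seminorm_nonneg\<close>)

lemma seminorm_triangle_diff:
  assumes "u \<in> V" "v \<in> V" "w \<in> V"
  shows "hnorm ip (u - w) \<le> hnorm ip (u - v) + hnorm ip (v - w)"
  using seminorm_triangle[of "u - v" "v - w"] assms by (simp add: V_diff)

lemma seminorm_minus_commute: "\<lbrakk>u \<in> V; w \<in> V\<rbrakk> \<Longrightarrow> hnorm ip (u - w) = hnorm ip (w - u)"
  by (simp add: hnorm_def diff_left diff_right V_diff)

lemma seminorm_triangle_sub:
  assumes "u \<in> V" "v \<in> V"
  shows "\<bar>hnorm ip u - hnorm ip v\<bar> \<le> hnorm ip (u - v)"
  using seminorm_triangle_diff[of u v 0] seminorm_triangle_diff[of v u 0]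
    seminorm_minus_commute[of u v] assms by auto

lemma seminorm_smul: "u \<in> V \<Longrightarrow> hnorm ip (smul c u) = cmod c * hnorm ip u"
proof (rule power2_eq_imp_eq)
  assume u: "u \<in> V"
  have "ip (smul c u) (smul c u) = (c * cnj c) * ip u u"
    using u by (simp add: scale_left scale_right V_smul)
  also have "c * cnj c = of_real ((cmod c)\<^sup>2)"
    by (rule complex_norm_square[symmetric])
  finally show "(hnorm ip (smul c u))\<^sup>2 = (cmod c * hnorm ip u)\<^sup>2"
    using u by (simp add: seminorm_power2 V_smul power_mult_distrib)
qed (auto simp: seminorm_nonneg V_smul)

section \<open>Completion by Cauchy sequences\<close>

definition cauchy_seq :: "(nat \<Rightarrow> 'v) \<Rightarrow> bool"
  where "cauchy_seq x \<longleftrightarrow> (\<forall>n. x n \<in> V) \<and> (\<forall>e>0. \<exists>N. \<forall>m\<ge>N. \<forall>n\<ge>N. hnorm ip (x m - x n) < e)"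

definition seq_smul :: "complex \<Rightarrow> (nat \<Rightarrow> 'v) \<Rightarrow> nat \<Rightarrow> 'v"
  where "seq_smul c x = (\<lambda>n. smul c (x n))"

definition seq_ip :: "(nat \<Rightarrow> 'v) \<Rightarrow> (nat \<Rightarrow> 'v) \<Rightarrow> complex"
  where "seq_ip x y = lim (\<lambda>n. ip (x n) (y n))"

lemma cauchy_seqD: "cauchy_seq x \<Longrightarrow> x n \<in> V"
  by (simp add: cauchy_seq_def)

lemma cauchy_seq_const: "v \<in> V \<Longrightarrow> cauchy_seq (\<lambda>n. v)"
  by (simp add: cauchy_seq_def)

lemma cauchy_seq_bounded:
  assumes "cauchy_seq x"
  shows "\<exists>K>0. \<forall>n. hnorm ip (x n) \<le> K"
proof -
  have "Cauchy (\<lambda>n. hnorm ip (x n))"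
    unfolding Cauchy_def dist_real_def
  proof (intro allI impI)
    fix e :: real assume "e > 0"
    then obtain N where "\<forall>m\<ge>N. \<forall>n\<ge>N. hnorm ip (x m - x n) < e"
      using assms by (auto simp: cauchy_seq_def)
    then show "\<exists>M. \<forall>m\<ge>M. \<forall>n\<ge>M. \<bar>hnorm ip (x m) - hnorm ip (x n)\<bar> < e"
      using seminorm_triangle_sub cauchy_seqD[OF assms] by (meson order_le_less_trans)
  qed
  then have "Bseq (\<lambda>n. hnorm ip (x n))" by (rule Cauchy_Bseq)
  then show ?thesis using cauchy_seqD[OF assms] by (auto simp: Bseq_def seminorm_nonneg)
qed

lemma ip_tendsto:
  assumes x: "cauchy_seq x" and y: "cauchy_seq y"
  shows "(\<lambda>n. ip (x n) (y n)) \<longlonglongrightarrow> seq_ip x y"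
proof -
  obtain K where K: "K > 0" "\<And>n. hnorm ip (x n) \<le> K" using cauchy_seq_bounded[OF x] by blast
  obtain L where L: "L > 0" "\<And>n. hnorm ip (y n) \<le> L" using cauchy_seq_bounded[OF y] by blast
  note V = cauchy_seqD[OF x] cauchy_seqD[OF y]
  have "Cauchy (\<lambda>n. ip (x n) (y n))"
    unfolding Cauchy_def dist_norm
  proof (intro allI impI)
    fix e :: real assume "e > 0"
    obtain N where N: "\<And>m n. \<lbrakk>m \<ge> N; n \<ge> N\<rbrakk> \<Longrightarrow> hnorm ip (x m - x n) < e / (2 * L)"
      using x \<open>e > 0\<close> L(1) unfolding cauchy_seq_def by (meson divide_pos_pos mult_pos_pos zero_less_numeral)
    obtain N' where N': "\<And>m n. \<lbrakk>m \<ge> N'; n \<ge> N'\<rbrakk> \<Longrightarrow> hnorm ip (y m - y n) < e / (2 * K)"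
      using y \<open>e > 0\<close> K(1) unfolding cauchy_seq_def by (meson divide_pos_pos mult_pos_pos zero_less_numeral)
    have "cmod (ip (x m) (y m) - ip (x n) (y n)) < e" if "m \<ge> max N N'" "n \<ge> max N N'" for m n
    proof -
      have "ip (x m) (y m) - ip (x n) (y n) = ip (x m - x n) (y m) + ip (x n) (y m - y n)"
        using V by (simp add: diff_left diff_right)
      then have "cmod (ip (x m) (y m) - ip (x n) (y n))
        \<le> hnorm ip (x m - x n) * hnorm ip (y m) + hnorm ip (x n) * hnorm ip (y m - y n)"
        using semi_Cauchy_Schwarz[of "x m - x n" "y m"] semi_Cauchy_Schwarz[of "x n" "y m - y n"]
          norm_triangle_ineq[of "ip (x m - x n) (y m)" "ip (x n) (y m - y n)"] V
        by (simp add: V_diff)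
      also have "\<dots> \<le> hnorm ip (x m - x n) * L + K * hnorm ip (y m - y n)"
        using K L V by (intro add_mono mult_left_mono mult_right_mono) (auto simp: seminorm_nonneg V_diff)
      also have "\<dots> < e / (2 * L) * L + K * (e / (2 * K))"
        using N N' that K(1) L(1) by (intro add_strict_mono mult_strict_left_mono mult_strict_right_mono) auto
      finally show ?thesis using K(1) L(1) by simp
    qed
    then show "\<exists>M. \<forall>m\<ge>M. \<forall>n\<ge>M. cmod (ip (x m) (y m) - ip (x n) (y n)) < e" by blast
  qed
  then show ?thesis
    unfolding seq_ip_def by (simp add: Cauchy_convergent_iff convergent_LIMSEQ_iff)
qed

lemma cauchy_seq_add:
  assumes x: "cauchy_seq x" and y: "cauchy_seq y"
  shows "cauchy_seq (x + y)"
  unfolding cauchy_seq_def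
proof (intro conjI allI impI)
  note V = cauchy_seqD[OF x] cauchy_seqD[OF y]
  show "(x + y) n \<in> V" for n using V by (simp add: V_add)
  fix e :: real assume "e > 0"
  then have "e / 2 > 0" by simp
  then obtain N where N: "\<And>m n. \<lbrakk>m \<ge> N; n \<ge> N\<rbrakk> \<Longrightarrow> hnorm ip (x m - x n) < e / 2"
    using x unfolding cauchy_seq_def by meson
  obtain N' where N': "\<And>m n. \<lbrakk>m \<ge> N'; n \<ge> N'\<rbrakk> \<Longrightarrow> hnorm ip (y m - y n) < e / 2"
    using y \<open>e / 2 > 0\<close> unfolding cauchy_seq_def by meson
  have "hnorm ip ((x + y) m - (x + y) n) < e" if "m \<ge> max N N'" "n \<ge> max N N'" for m n
  proof -
    have "(x + y) m - (x + y) n = (x m - x n) + (y m - y n)" by simp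
    then have "hnorm ip ((x + y) m - (x + y) n) \<le> hnorm ip (x m - x n) + hnorm ip (y m - y n)"
      using seminorm_triangle V V_diff by metis
    also have "\<dots> < e / 2 + e / 2"
      using N N' that by (intro add_strict_mono) auto
    finally show ?thesis by simp
  qed
  then show "\<exists>N. \<forall>m\<ge>N. \<forall>n\<ge>N. hnorm ip ((x + y) m - (x + y) n) < e" by blast
qed

lemma cauchy_seq_smul:
  assumes x: "cauchy_seq x"
  shows "cauchy_seq (seq_smul c x)"
  unfolding cauchy_seq_def
proof (intro conjI allI impI)
  note V = cauchy_seqD[OF x]
  show "seq_smul c x n \<in> V" for n using V by (simp add: seq_smul_def V_smul)
  fix e :: real assume "e > 0"
  then have "e / (cmod c + 1) > 0" by (simp add: add_nonneg_pos)
  then obtain N where N: "\<And>m n. \<lbrakk>m \<ge> N; n \<ge> N\<rbrakk> \<Longrightarrow> hnorm ip (x m - x n) < e / (cmod c + 1)"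
    using x unfolding cauchy_seq_def by meson
  have "hnorm ip (seq_smul c x m - seq_smul c x n) < e" if "m \<ge> N" "n \<ge> N" for m n
  proof -
    have "seq_smul c x m - seq_smul c x n = smul c (x m - x n)"
      by (simp add: seq_smul_def scale_right_diff_distrib)
    then have "hnorm ip (seq_smul c x m - seq_smul c x n) = cmod c * hnorm ip (x m - x n)"
      using V by (simp add: seminorm_smul V_diff)
    also have "\<dots> \<le> (cmod c + 1) * hnorm ip (x m - x n)"
      using V by (intro mult_right_mono) (auto simp: seminorm_nonneg V_diff)
    also have "\<dots> < e"
      using N[OF that] by (simp add: less_divide_eq add_nonneg_pos mult.commute)
    finally show ?thesis .
  qed
  then show "\<exists>N. \<forall>m\<ge>N. \<forall>n\<ge>N. hnorm ip (seq_smul c x m - seq_smul c x n) < e" by blast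
qed

text \<open>Cauchy sequences with the same limit are not identified, so the form is again only
  semidefinite. The later quotient by null vectors removes this redundancy together with the one
  already present in \<open>V\<close>.\<close>

lemma semi_inner_product_cauchy_seqs:
  "semi_inner_product_space seq_smul {x. cauchy_seq x} seq_ip"
proof -
  interpret S: vector_space seq_smul
    by unfold_locales (auto simp: seq_smul_def algebra_simps fun_eq_iff)
  show ?thesis
  proof unfold_locales
    show "S.subspace {x. cauchy_seq x}"
      using cauchy_seq_const[OF V_zero]
      by (auto simp: S.subspace_def cauchy_seq_add cauchy_seq_smul zero_fun_def)
  next
    fix x y z assume "x \<in> {x. cauchy_seq x}" "y \<in> {x. cauchy_seq x}" "z \<in> {x. cauchy_seq x}"
    then have c: "cauchy_seq x" "cauchy_seq y" "cauchy_seq z" by auto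
    have "(\<lambda>n. ip ((x + y) n) (z n)) \<longlonglongrightarrow> seq_ip x z + seq_ip y z"
      using tendsto_add[OF ip_tendsto[OF c(1,3)] ip_tendsto[OF c(2,3)]] c by (simp add: add_left cauchy_seqD)
    then show "seq_ip (x + y) z = seq_ip x z + seq_ip y z"
      using LIMSEQ_unique ip_tendsto[OF cauchy_seq_add[OF c(1,2)] c(3)] by blast
  next
    fix x y c assume "x \<in> {x. cauchy_seq x}" "y \<in> {x. cauchy_seq x}"
    then have c: "cauchy_seq x" "cauchy_seq y" by auto
    have "(\<lambda>n. ip (seq_smul c x n) (y n)) \<longlonglongrightarrow> c * seq_ip x y"
      using tendsto_mult_left[OF ip_tendsto[OF c], of c] c by (simp add: scale_left cauchy_seqD seq_smul_def)
    then show "seq_ip (seq_smul c x) y = c * seq_ip x y"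
      using LIMSEQ_unique ip_tendsto[OF cauchy_seq_smul[OF c(1)] c(2)] by blast
  next
    fix x y assume "x \<in> {x. cauchy_seq x}" "y \<in> {x. cauchy_seq x}"
    then have c: "cauchy_seq x" "cauchy_seq y" by auto
    have "ip (x n) (y n) = cnj (ip (y n) (x n))" for n
      using cnj_sym cauchy_seqD c by blast
    then have "(\<lambda>n. ip (x n) (y n)) \<longlonglongrightarrow> cnj (seq_ip y x)"
      using tendsto_cnj[OF ip_tendsto[OF c(2,1)]] by presburger
    then show "seq_ip x y = cnj (seq_ip y x)"
      using LIMSEQ_unique ip_tendsto[OF c] by blast
  next
    fix x assume "x \<in> {x. cauchy_seq x}"
    then have c: "cauchy_seq x" by auto
    show "0 \<le> Re (seq_ip x x)"
      by (rule LIMSEQ_le_const[OF tendsto_Re[OF ip_tendsto[OF c c]]])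
        (use c in \<open>auto simp: nonneg cauchy_seqD\<close>)
  qed
qed

lemma seminorm_tendsto:
  assumes "cauchy_seq x"
  shows "(\<lambda>n. hnorm ip (x n)) \<longlonglongrightarrow> hnorm seq_ip x"
  unfolding hnorm_def by (intro tendsto_real_sqrt tendsto_Re ip_tendsto assms)

lemma seq_ip_const: "seq_ip (\<lambda>n. u) (\<lambda>n. v) = ip u v"
  by (simp add: seq_ip_def)

end

text \<open>Limits exist here but are unique only up to null vectors.\<close>

locale complete_semi_inner_product_space = semi_inner_product_space +
  assumes semi_complete: "\<lbrakk>\<And>n. x n \<in> V; \<And>e. e > 0 \<Longrightarrow> \<exists>N. \<forall>m\<ge>N. \<forall>n\<ge>N. hnorm ip (x m - x n) < e\<rbrakk>
    \<Longrightarrow> \<exists>y\<in>V. (\<lambda>n. hnorm ip (x n - y)) \<longlonglongrightarrow> 0"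

context semi_inner_product_space
begin

text \<open>Density of the constant sequences, that is, of \<open>V\<close> in its completion. Both
  completeness and strong continuity of the extended action rest on it.\<close>

lemma cauchy_seq_approx:
  assumes x: "cauchy_seq x" and "e > 0"
  shows "\<exists>N. \<forall>n\<ge>N. hnorm seq_ip (x - (\<lambda>_. x n)) < e"
proof -
  interpret S: semi_inner_product_space seq_smul "{x. cauchy_seq x}" seq_ip
    by (rule semi_inner_product_cauchy_seqs)
  obtain N where N: "\<And>m n. \<lbrakk>m \<ge> N; n \<ge> N\<rbrakk> \<Longrightarrow> hnorm ip (x m - x n) < e / 2"
    using x \<open>e > 0\<close> unfolding cauchy_seq_def by (meson half_gt_zero)
  have "hnorm seq_ip (x - (\<lambda>_. x n)) < e" if n: "n \<ge> N" for n
  proof -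
    have "cauchy_seq (x - (\<lambda>_. x n))"
      using S.V_diff[of x "\<lambda>_. x n"] x cauchy_seq_const cauchy_seqD[OF x] by blast
    from seminorm_tendsto[OF this]
    have "hnorm seq_ip (x - (\<lambda>_. x n)) \<le> e / 2"
      by (rule LIMSEQ_le[OF _ tendsto_const])
        (use N n in \<open>auto intro!: exI[of _ N] less_imp_le\<close>)
    then show ?thesis using \<open>e > 0\<close> by simp
  qed
  then show ?thesis by blast
qed

lemma complete_cauchy_seqs:
  "complete_semi_inner_product_space seq_smul {x. cauchy_seq x} seq_ip"
proof -
  interpret S: semi_inner_product_space seq_smul "{x. cauchy_seq x}" seq_ip
    by (rule semi_inner_product_cauchy_seqs)
  show ?thesis
  proof unfold_locales
    fix X :: "nat \<Rightarrow> nat \<Rightarrow> 'v"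
    assume X: "\<And>k. X k \<in> {x. cauchy_seq x}"
      and Cauchy: "\<And>e. e > 0 \<Longrightarrow> \<exists>N. \<forall>k\<ge>N. \<forall>l\<ge>N. hnorm seq_ip (X k - X l) < e"
    have "\<exists>n. hnorm seq_ip (X k - (\<lambda>_. X k n)) < 1 / Suc k" for k
      using cauchy_seq_approx[of "X k" "1 / Suc k"] X by auto
    then obtain f where f: "\<And>k. hnorm seq_ip (X k - (\<lambda>_. X k (f k))) < 1 / Suc k" by metis
    \<comment> \<open>A diagonal choice: the constant sequence at \<open>y k\<close> lies within
      \<open>1 / Suc k\<close> of \<open>X k\<close>, so \<open>y\<close> is itself Cauchy and is a
      limit of \<open>X\<close>.\<close>
    define y where "y = (\<lambda>k. X k (f k))"
    have yV: "y k \<in> V" for k using X cauchy_seqD by (auto simp: y_def)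
    have c: "(\<lambda>_. y k) \<in> {x. cauchy_seq x}" for k using cauchy_seq_const[OF yV] by simp
    have close: "hnorm seq_ip (X k - (\<lambda>_. y k)) < 1 / Suc k" for k using f by (simp add: y_def)
    have small: "\<exists>N. \<forall>k\<ge>N. 1 / Suc k < e" if "e > 0" for e :: real
      using order_tendstoD(2)[OF LIMSEQ_inverse_real_of_nat that]
      by (simp add: eventually_sequentially inverse_eq_divide)
    have y: "cauchy_seq y"
      unfolding cauchy_seq_def
    proof (intro conjI allI impI yV)
      fix e :: real assume "e > 0"
      then obtain N where N: "\<And>k l. \<lbrakk>k \<ge> N; l \<ge> N\<rbrakk> \<Longrightarrow> hnorm seq_ip (X k - X l) < e / 3"
        using Cauchy[of "e / 3"] by auto
      obtain N' where N': "\<And>k. k \<ge> N' \<Longrightarrow> 1 / Suc k < e / 3"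
        using small[of "e / 3"] \<open>e > 0\<close> by auto
      have "hnorm ip (y k - y l) < e" if k: "k \<ge> max N N'" and l: "l \<ge> max N N'" for k l
      proof -
        have "hnorm ip (y k - y l) = hnorm seq_ip ((\<lambda>_. y k) - (\<lambda>_. y l))"
          by (simp add: hnorm_def fun_diff_def seq_ip_const)
        also have "\<dots> \<le> hnorm seq_ip (X k - (\<lambda>_. y k)) + (hnorm seq_ip (X k - X l) + hnorm seq_ip (X l - (\<lambda>_. y l)))"
          using S.seminorm_triangle_diff[OF c[of k] X[of k] c[of l]]
            S.seminorm_triangle_diff[OF X[of k] X[of l] c[of l]]
            S.seminorm_minus_commute[OF c[of k] X[of k]] by linarith
        also have "\<dots> < e / 3 + (e / 3 + e / 3)"
          using close[of k] close[of l] N[of k l] N'[of k] N'[of l] k l by linarith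
        finally show ?thesis by simp
      qed
      then show "\<exists>N. \<forall>m\<ge>N. \<forall>n\<ge>N. hnorm ip (y m - y n) < e" by blast
    qed
    have "(\<lambda>k. hnorm seq_ip (X k - y)) \<longlonglongrightarrow> 0"
    proof (rule LIMSEQ_I)
      fix e :: real assume "e > 0"
      obtain N where N: "\<And>k. k \<ge> N \<Longrightarrow> 1 / Suc k < e / 2"
        using small[of "e / 2"] \<open>e > 0\<close> by auto
      obtain N' where N': "\<And>k. k \<ge> N' \<Longrightarrow> hnorm seq_ip (y - (\<lambda>_. y k)) < e / 2"
        using cauchy_seq_approx[OF y, of "e / 2"] \<open>e > 0\<close> by auto
      have "hnorm seq_ip (X k - y) < e" if "k \<ge> max N N'" for k
        using S.seminorm_triangle_diff[OF X[of k] c[of k], of y] S.seminorm_minus_commute[OF c[of k], of y] y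
          close[of k] N[of k] N'[of k] that by simp
      then show "\<exists>no. \<forall>n\<ge>no. norm (hnorm seq_ip (X n - y) - 0) < e"
        using S.seminorm_nonneg[OF S.V_diff[OF X]] y by (intro exI[of _ "max N N'"]) auto
    qed
    then show "\<exists>y\<in>{x. cauchy_seq x}. (\<lambda>k. hnorm seq_ip (X k - y)) \<longlonglongrightarrow> 0"
      using y by blast
  qed
qed

end

text \<open>Strong continuity is stated with neighbourhoods and the seminorm, since
  \<open>hdist\<close> is no metric as long as nonzero null vectors may exist.\<close>

locale isometric_action = semi_inner_product_space smul V ip + topological_group G T
  for G :: "('g, 'b) monoid_scheme" (structure) and T :: "'g topology"
    and smul :: "complex \<Rightarrow> 'v::ab_group_add \<Rightarrow> 'v" and V :: "'v set"
    and ip :: "'v \<Rightarrow> 'v \<Rightarrow> complex" +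
  fixes \<pi> :: "'g \<Rightarrow> 'v \<Rightarrow> 'v"
  assumes act_closed: "\<lbrakk>g \<in> carrier G; v \<in> V\<rbrakk> \<Longrightarrow> \<pi> g v \<in> V"
    and act_add: "\<lbrakk>g \<in> carrier G; u \<in> V; v \<in> V\<rbrakk> \<Longrightarrow> \<pi> g (u + v) = \<pi> g u + \<pi> g v"
    and act_smul: "\<lbrakk>g \<in> carrier G; v \<in> V\<rbrakk> \<Longrightarrow> \<pi> g (smul c v) = smul c (\<pi> g v)"
    and act_ip: "\<lbrakk>g \<in> carrier G; u \<in> V; v \<in> V\<rbrakk> \<Longrightarrow> ip (\<pi> g u) (\<pi> g v) = ip u v"
    and act_mult: "\<lbrakk>g \<in> carrier G; h \<in> carrier G; v \<in> V\<rbrakk> \<Longrightarrow> \<pi> (g \<otimes> h) v = \<pi> g (\<pi> h v)"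
    and act_one: "v \<in> V \<Longrightarrow> \<pi> \<one> v = v"
    and act_continuous: "\<lbrakk>v \<in> V; g \<in> carrier G; e > 0\<rbrakk> \<Longrightarrow>
      \<exists>U. openin T U \<and> g \<in> U \<and> (\<forall>h\<in>U. hnorm ip (\<pi> h v - \<pi> g v) < e)"
begin

lemma act_diff: "\<lbrakk>g \<in> carrier G; u \<in> V; v \<in> V\<rbrakk> \<Longrightarrow> \<pi> g (u - v) = \<pi> g u - \<pi> g v"
  using act_add[of g "u - v" v] by (simp add: V_diff)

lemma act_seminorm: "\<lbrakk>g \<in> carrier G; v \<in> V\<rbrakk> \<Longrightarrow> hnorm ip (\<pi> g v) = hnorm ip v"
  by (simp add: hnorm_def act_ip)

lemma isometric_action_cauchy_seqs:
  "isometric_action G T seq_smul {x. cauchy_seq x} seq_ip (\<lambda>g x n. \<pi> g (x n))"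
proof -
  interpret S: semi_inner_product_space seq_smul "{x. cauchy_seq x}" seq_ip
    by (rule semi_inner_product_cauchy_seqs)
  have closed: "cauchy_seq (\<lambda>n. \<pi> g (x n))" if "g \<in> carrier G" "cauchy_seq x" for g x
    using that by (auto simp: cauchy_seq_def act_closed act_seminorm V_diff simp flip: act_diff)
  have isom: "seq_ip (\<lambda>n. \<pi> g (x n)) (\<lambda>n. \<pi> g (y n)) = seq_ip x y"
    if "g \<in> carrier G" "cauchy_seq x" "cauchy_seq y" for g x y
    using that by (simp add: seq_ip_def act_ip cauchy_seqD)
  show ?thesis
  proof unfold_locales
    fix x g and e :: real
    assume x: "x \<in> {x. cauchy_seq x}" and g: "g \<in> carrier G" and e: "e > 0"
    then obtain n where n: "hnorm seq_ip (x - (\<lambda>_. x n)) < e / 3"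
      using cauchy_seq_approx[of x "e / 3"] by auto
    have xn: "x n \<in> V" using x cauchy_seqD by simp
    then obtain U where U: "openin T U" "g \<in> U" "\<And>h. h \<in> U \<Longrightarrow> hnorm ip (\<pi> h (x n) - \<pi> g (x n)) < e / 3"
      using act_continuous[of "x n" g "e / 3"] g e by auto
    have "hnorm seq_ip ((\<lambda>n. \<pi> h (x n)) - (\<lambda>n. \<pi> g (x n))) < e" if h: "h \<in> U" for h
    proof -
      have hG: "h \<in> carrier G" using U(1) h openin_subset topspace_eq by blast
      let ?c = "\<lambda>k. \<lambda>_::nat. \<pi> k (x n)" and ?x = "\<lambda>k n. \<pi> k (x n)"
      have cl: "?c k \<in> {x. cauchy_seq x}" "?x k \<in> {x. cauchy_seq x}" if "k \<in> carrier G" for k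
        using that x xn closed cauchy_seq_const act_closed by auto
      \<comment> \<open>Isometry makes the approximation by a constant sequence equally good after
        applying any group element, so continuity is only needed at the single vector
        \<open>x n\<close>.\<close>
      have d: "hnorm seq_ip (?x k - ?c k) < e / 3" if k: "k \<in> carrier G" for k
      proof -
        have "?x k - ?c k = (\<lambda>m. \<pi> k ((x - (\<lambda>_. x n)) m))"
          using k x xn cauchy_seqD by (auto simp: act_diff fun_eq_iff)
        moreover have "cauchy_seq (x - (\<lambda>_. x n))"
          using S.V_diff[of x "\<lambda>_. x n"] x cauchy_seq_const[OF xn] by blast
        moreover from this have "hnorm seq_ip (\<lambda>m. \<pi> k ((x - (\<lambda>_. x n)) m)) = hnorm seq_ip (x - (\<lambda>_. x n))"
          unfolding hnorm_def by (simp only: isom[OF k])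
        ultimately show ?thesis using n by simp
      qed
      have "hnorm seq_ip (?c h - ?c g) < e / 3"
        using U(3)[OF h] by (simp add: hnorm_def fun_diff_def seq_ip_const)
      then show ?thesis
        using S.seminorm_triangle_diff[OF cl(2)[OF hG] cl(1)[OF hG] cl(2)[OF g]]
          S.seminorm_triangle_diff[OF cl(1)[OF hG] cl(1)[OF g] cl(2)[OF g]]
          S.seminorm_minus_commute[OF cl(1)[OF g] cl(2)[OF g]] d[OF hG] d[OF g] by linarith
    qed
    then show "\<exists>U. openin T U \<and> g \<in> U \<and>
      (\<forall>h\<in>U. hnorm seq_ip ((\<lambda>n. \<pi> h (x n)) - (\<lambda>n. \<pi> g (x n))) < e)"
      using U(1,2) by blast
  qed (auto simp: closed isom fun_eq_iff act_add act_smul act_mult act_one seq_smul_def cauchy_seqD)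
qed

end

section \<open>The quotient by null vectors\<close>

locale complete_isometric_action =
  isometric_action G T smul V ip \<pi> + complete_semi_inner_product_space smul V ip
  for G :: "('g, 'b) monoid_scheme" (structure) and T
    and smul :: "complex \<Rightarrow> 'v::ab_group_add \<Rightarrow> 'v" and V ip \<pi>
begin

text \<open>
  Vectors with the same inner products are identified, so the functional
  \<open>ip v\<close> stands for the class of \<open>v\<close> modulo null vectors.
\<close>

definition separated :: "'v \<Rightarrow> 'v \<Rightarrow> complex"
  where "separated v = (\<lambda>w. if w \<in> V then ip v w else 0)"

definition representative :: "('v \<Rightarrow> complex) \<Rightarrow> 'v"
  where "representative = inv_into V separated"

lemma separated_representative:
  "v \<in> V \<Longrightarrow> representative (separated v) \<in> V"
  "v \<in> V \<Longrightarrow> separated (representative (separated v)) = separated v"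
  by (simp_all add: representative_def inv_into_into f_inv_into_f)

lemma separated_eqD: "\<lbrakk>separated u = separated v; w \<in> V\<rbrakk> \<Longrightarrow> ip u w = ip v w"
  by (drule fun_cong[of _ _ w]) (simp add: separated_def)

lemma ip_representative:
  assumes "u \<in> V" "v \<in> V"
  shows "ip (representative (separated u)) (representative (separated v)) = ip u v"
proof -
  note rep = separated_representative[OF assms(1)] separated_representative[OF assms(2)]
  have "ip (representative (separated u)) (representative (separated v)) = ip u (representative (separated v))"
    using rep by (intro separated_eqD) auto
  also have "\<dots> = cnj (ip (representative (separated v)) u)" using assms rep by (intro cnj_sym)
  also have "\<dots> = cnj (ip v u)" using separated_eqD[OF rep(4) assms(1)] by simp
  finally show ?thesis using cnj_sym[OF assms] by simp
qed

text \<open>The action descends to classes because \<open>\<pi> g\<close> has the adjoint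
  \<open>\<pi> (inv g)\<close>: pairing a translate with \<open>w\<close> amounts to pairing the
  original vector with \<open>\<pi> (inv g) w\<close>, which sees only its class.\<close>

lemma separated_act_representative:
  assumes "g \<in> carrier G" "v \<in> V"
  shows "separated (\<pi> g (representative (separated v))) = separated (\<pi> g v)"
proof
  note rep = separated_representative[OF assms(2)]
  fix w
  show "separated (\<pi> g (representative (separated v))) w = separated (\<pi> g v) w"
  proof (cases "w \<in> V")
    case True
    have inv: "inv g \<in> carrier G" using assms by simp
    have w: "w = \<pi> g (\<pi> (inv g) w)" using True assms by (simp add: act_mult[symmetric] act_one)
    have w': "\<pi> (inv g) w \<in> V" using True inv act_closed by blast
    have "ip (\<pi> g u) w = ip u (\<pi> (inv g) w)" if "u \<in> V" for u
      by (subst w) (rule act_ip[OF assms(1) that w'])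
    then show ?thesis using True rep assms separated_eqD[OF rep(2) w'] by (simp add: separated_def)
  qed (simp add: separated_def)
qed

lemma separated_unitary_module:
  "unitary_module G T (\<lambda>c f w. c * f w) (separated ` V)
    (\<lambda>f f'. ip (representative f) (representative f')) (\<lambda>g f. separated (\<pi> g (representative f)))"
proof -
  let ?sm = "\<lambda>(c::complex) (f::'v \<Rightarrow> complex) w. c * f w"
  let ?H = "separated ` V" and ?ip = "\<lambda>f f'. ip (representative f) (representative f')"
    and ?\<pi> = "\<lambda>g f. separated (\<pi> g (representative f))"
  interpret F: vector_space ?sm
    by unfold_locales (auto simp: algebra_simps fun_eq_iff)
  have add: "separated u + separated v = separated (u + v)" if "u \<in> V" "v \<in> V" for u v
    using that by (auto simp: separated_def fun_eq_iff add_left)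
  have diff: "separated u - separated v = separated (u - v)" if "u \<in> V" "v \<in> V" for u v
    using that by (auto simp: separated_def fun_eq_iff diff_left)
  have smul: "?sm c (separated u) = separated (smul c u)" if "u \<in> V" for c u
    using that by (auto simp: separated_def fun_eq_iff scale_left)
  have zero: "separated 0 = 0" by (auto simp: separated_def fun_eq_iff)
  \<comment> \<open>By Cauchy-Schwarz a vector of seminorm zero pairs to zero with all of
    \<open>V\<close>; this makes the form on classes definite.\<close>
  have null: "separated u = 0" if "u \<in> V" "Re (ip u u) = 0" for u
  proof
    fix w show "separated u w = 0 w"
      using that semi_Cauchy_Schwarz[of u w] by (auto simp: separated_def hnorm_def)
  qed
  have dist: "hdist ?H ?ip (separated u) (separated v) = hnorm ip (u - v)" if "u \<in> V" "v \<in> V" for u v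
    using that by (simp add: hdist_def diff hnorm_def ip_representative V_diff)
  have hilb: "Metric_space ?H (hdist ?H ?ip)"
  proof
    show "hdist ?H ?ip x y = hdist ?H ?ip y x" for x y
    proof (cases "x \<in> ?H \<and> y \<in> ?H")
      case True
      then obtain u v where "x = separated u" "y = separated v" "u \<in> V" "v \<in> V" by blast
      then show ?thesis by (simp add: dist seminorm_minus_commute[of u v])
    qed (auto simp: hdist_def)
    show "0 \<le> hdist ?H ?ip x y" for x y
    proof (cases "x \<in> ?H \<and> y \<in> ?H")
      case True
      then obtain u v where "x = separated u" "y = separated v" "u \<in> V" "v \<in> V" by blast
      then show ?thesis by (simp add: dist seminorm_nonneg V_diff)
    qed (auto simp: hdist_def)
    show "hdist ?H ?ip x y = 0 \<longleftrightarrow> x = y" if "x \<in> ?H" "y \<in> ?H" for x y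
    proof -
      obtain u v where uv: "x = separated u" "y = separated v" "u \<in> V" "v \<in> V" using \<open>x \<in> ?H\<close> \<open>y \<in> ?H\<close> by blast
      show ?thesis
      proof
        assume "hdist ?H ?ip x y = 0"
        then have "separated (u - v) = 0"
          using uv by (intro null) (auto simp: dist hnorm_def V_diff)
        then show "x = y" using uv diff by (metis eq_iff_diff_eq_0)
      next
        assume "x = y"
        then show "hdist ?H ?ip x y = 0" using uv dist[of u u] by simp
      qed
    qed
    show "hdist ?H ?ip x z \<le> hdist ?H ?ip x y + hdist ?H ?ip y z"
      if "x \<in> ?H" "y \<in> ?H" "z \<in> ?H" for x y z
      using that seminorm_triangle_diff by (auto simp: dist)
  qed
  interpret M: Metric_space ?H "hdist ?H ?ip" by (rule hilb)
  have hilbert: "complex_hilbert_space ?sm ?H ?ip"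
  proof unfold_locales
    show "F.subspace ?H"
      unfolding F.subspace_def
    proof (intro conjI ballI allI)
      show "0 \<in> ?H" using zero by (metis V_zero imageI)
    qed (auto simp: add smul V_add V_smul)
    show "?ip (u + v) w = ?ip u w + ?ip v w" if "u \<in> ?H" "v \<in> ?H" "w \<in> ?H" for u v w
      using that by (auto simp: add ip_representative V_add add_left)
    show "?ip (?sm c u) v = c * ?ip u v" if "u \<in> ?H" "v \<in> ?H" for c u v
      using that by (auto simp: smul ip_representative V_smul scale_left)
    show "?ip u v = cnj (?ip v u)" if "u \<in> ?H" "v \<in> ?H" for u v
      using that by (auto simp: ip_representative intro: cnj_sym)
    show "Re (?ip u u) > 0" if "u \<in> ?H" "u \<noteq> 0" for u
      using that null nonneg by (auto simp: ip_representative order_less_le)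
    show "M.mcomplete"
      unfolding M.mcomplete_def
    proof (intro allI impI)
      fix \<sigma> assume \<sigma>: "M.MCauchy \<sigma>"
      then have "range \<sigma> \<subseteq> ?H" by (simp add: M.MCauchy_def)
      then have "\<forall>n. \<exists>v\<in>V. \<sigma> n = separated v" by blast
      then obtain x where x: "\<And>n. x n \<in> V" "\<And>n. \<sigma> n = separated (x n)" by metis
      have "\<exists>N. \<forall>m\<ge>N. \<forall>n\<ge>N. hnorm ip (x m - x n) < e" if "e > 0" for e
        using \<sigma> that unfolding M.MCauchy_def x(2) by (auto simp: dist x(1))
      then obtain y where y: "y \<in> V" "(\<lambda>n. hnorm ip (x n - y)) \<longlonglongrightarrow> 0"
        using semi_complete[of x] x(1) by blast
      then have "limitin M.mtopology \<sigma> (separated y) sequentially"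
        unfolding M.limitin_metric_dist_null x(2) by (auto simp: dist x(1))
      then show "\<exists>x. limitin M.mtopology \<sigma> x sequentially" by blast
    qed
  qed
  then interpret H: complex_hilbert_space ?sm ?H ?ip .
  have act: "?\<pi> g (separated v) = separated (\<pi> g v)" if "g \<in> carrier G" "v \<in> V" for g v
    using that by (rule separated_act_representative)
  show ?thesis
  proof unfold_locales
    fix g assume g: "g \<in> carrier G"
    then have g': "inv g \<in> carrier G" by simp
    have inv: "\<pi> (inv g) (\<pi> g v) = v" "\<pi> g (\<pi> (inv g) v) = v" if "v \<in> V" for v
      using that g by (simp_all add: act_mult[symmetric] act_one)
    have "bij_betw (?\<pi> g) ?H ?H"
      by (rule bij_betw_byWitness[where f' = "?\<pi> (inv g)"])
        (use g g' in \<open>auto simp: act act_closed inv\<close>)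
    then show "unitary_operator ?sm ?H ?ip (?\<pi> g)"
      using g by (auto simp: unitary_operator_def linear_on_space_def act act_closed act_ip
          ip_representative add smul act_add act_smul V_add V_smul)
  next
    fix g h v assume "g \<in> carrier G" "h \<in> carrier G" "v \<in> ?H"
    then show "?\<pi> (g \<otimes> h) v = ?\<pi> g (?\<pi> h v)" by (auto simp: act act_mult act_closed)
  next
    fix f assume "f \<in> ?H"
    then obtain v where v: "v \<in> V" "f = separated v" by blast
    show "continuous_map T (htopology ?H ?ip) (\<lambda>g. ?\<pi> g f)"
      unfolding htopology_def M.continuous_map_to_metric
    proof (intro ballI allI impI)
      fix g and e :: real assume "g \<in> topspace T" "e > 0"
      then have g: "g \<in> carrier G" by (simp add: topspace_eq)
      obtain U where U: "openin T U" "g \<in> U" "\<And>h. h \<in> U \<Longrightarrow> hnorm ip (\<pi> h v - \<pi> g v) < e"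
        using act_continuous[OF v(1) g \<open>e > 0\<close>] by blast
      have "?\<pi> h f \<in> M.mball (?\<pi> g f) e" if h: "h \<in> U" for h
      proof -
        have hG: "h \<in> carrier G" using U(1) h openin_subset topspace_eq by blast
        then show ?thesis
          using U(3)[OF h] g v act_closed seminorm_minus_commute[of "\<pi> h v" "\<pi> g v"]
          by (auto simp: M.mball_def act dist)
      qed
      then show "\<exists>U. openin T U \<and> g \<in> U \<and> (\<forall>h\<in>U. ?\<pi> h f \<in> M.mball (?\<pi> g f) e)"
        using U by blast
    qed
  qed
qed

end

context isometric_action
begin

text \<open>\<open>\<Phi>\<close> may identify vectors; for matrix coefficients only its
  compatibility with inner products and with the action matters. The Hilbert space consists of
  functionals on sequences, whence the type in the statement.\<close>

lemma unitary_completion: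
  obtains smul' and H' :: "((nat \<Rightarrow> 'v) \<Rightarrow> complex) set" and ip' \<pi>' \<Phi>
  where "unitary_module G T smul' H' ip' \<pi>'" and "\<And>v. v \<in> V \<Longrightarrow> \<Phi> v \<in> H'"
    and "\<And>u v. \<lbrakk>u \<in> V; v \<in> V\<rbrakk> \<Longrightarrow> ip' (\<Phi> u) (\<Phi> v) = ip u v"
    and "\<And>g v. \<lbrakk>g \<in> carrier G; v \<in> V\<rbrakk> \<Longrightarrow> \<pi>' g (\<Phi> v) = \<Phi> (\<pi> g v)"
proof -
  interpret A: isometric_action G T seq_smul "{x. cauchy_seq x}" seq_ip "\<lambda>g x n. \<pi> g (x n)"
    by (rule isometric_action_cauchy_seqs)
  interpret C: complete_semi_inner_product_space seq_smul "{x. cauchy_seq x}" seq_ip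
    by (rule complete_cauchy_seqs)
  interpret C: complete_isometric_action G T seq_smul "{x. cauchy_seq x}" seq_ip "\<lambda>g x n. \<pi> g (x n)"
    by unfold_locales
  show thesis
  proof (rule that[OF C.separated_unitary_module, where \<Phi> = "\<lambda>v. C.separated (\<lambda>_. v)"])
    fix u v assume uv: "u \<in> V" "v \<in> V"
    show "C.separated (\<lambda>_. v) \<in> C.separated ` {x. cauchy_seq x}"
      using cauchy_seq_const[OF uv(2)] by blast
    show "seq_ip (C.representative (C.separated (\<lambda>_. u))) (C.representative (C.separated (\<lambda>_. v))) = ip u v"
      using uv by (simp add: C.ip_representative cauchy_seq_const seq_ip_const)
  next
    fix g v assume "g \<in> carrier G" "v \<in> V"
    then show "C.separated (\<lambda>n. \<pi> g (C.representative (C.separated (\<lambda>_. v)) n)) = C.separated (\<lambda>_. \<pi> g v)"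
      using C.separated_act_representative[of g "\<lambda>_. v"] by (simp add: cauchy_seq_const)
  qed
qed

end

section \<open>Kernels of positive type\<close>

text \<open>Symmetry is a separate clause because a real quadratic form determines only the
  symmetric part of \<open>K\<close>. Complex coefficients are later reduced to real ones by taking
  real and imaginary parts.\<close>

definition positive_kernel :: "'i set \<Rightarrow> ('i \<Rightarrow> 'i \<Rightarrow> real) \<Rightarrow> bool"
  where "positive_kernel A K \<longleftrightarrow> (\<forall>x\<in>A. \<forall>y\<in>A. K x y = K y x) \<and>
    (\<forall>F c. finite F \<longrightarrow> F \<subseteq> A \<longrightarrow> 0 \<le> (\<Sum>x\<in>F. \<Sum>y\<in>F. c x * c y * K x y))"

lemma positive_kernel_sym: "\<lbrakk>positive_kernel A K; x \<in> A; y \<in> A\<rbrakk> \<Longrightarrow> K x y = K y x"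
  by (simp add: positive_kernel_def)

lemma positive_kernel_nonneg:
  "\<lbrakk>positive_kernel A K; finite F; F \<subseteq> A\<rbrakk> \<Longrightarrow> 0 \<le> (\<Sum>x\<in>F. \<Sum>y\<in>F. c x * c y * K x y)"
  by (simp add: positive_kernel_def)

lemma positive_kernelI:
  assumes "\<And>x y. \<lbrakk>x \<in> A; y \<in> A\<rbrakk> \<Longrightarrow> K x y = K y x"
    and "\<And>F c. \<lbrakk>finite F; F \<subseteq> A\<rbrakk> \<Longrightarrow> 0 \<le> (\<Sum>x\<in>F. \<Sum>y\<in>F. c x * c y * K x y)"
  shows "positive_kernel A K"
  using assms by (simp add: positive_kernel_def)

lemma positive_kernel_cong:
  assumes K: "positive_kernel A K" and eq: "\<And>x y. \<lbrakk>x \<in> A; y \<in> A\<rbrakk> \<Longrightarrow> K' x y = K x y"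
  shows "positive_kernel A K'"
proof (rule positive_kernelI)
  fix F c assume F: "finite F" "F \<subseteq> A"
  have "(\<Sum>x\<in>F. \<Sum>y\<in>F. c x * c y * K' x y) = (\<Sum>x\<in>F. \<Sum>y\<in>F. c x * c y * K x y)"
    using F by (intro sum.cong refl) (simp add: eq subset_iff)
  then show "0 \<le> (\<Sum>x\<in>F. \<Sum>y\<in>F. c x * c y * K' x y)"
    using positive_kernel_nonneg[OF K F] by simp
qed (use eq positive_kernel_sym[OF K] in simp)

lemma positive_kernel_weighted:
  assumes K: "positive_kernel A K"
  shows "positive_kernel A (\<lambda>x y. f x * f y * K x y)"
proof (rule positive_kernelI)
  fix F c assume "finite F" "F \<subseteq> A"
  then have "0 \<le> (\<Sum>x\<in>F. \<Sum>y\<in>F. (c x * f x) * (c y * f y) * K x y)"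
    by (rule positive_kernel_nonneg[OF K, where c = "\<lambda>x. c x * f x"])
  then show "0 \<le> (\<Sum>x\<in>F. \<Sum>y\<in>F. c x * c y * (f x * f y * K x y))"
    by (simp add: mult_ac)
next
  fix x y assume "x \<in> A" "y \<in> A"
  then show "f x * f y * K x y = f y * f x * K y x"
    using positive_kernel_sym[OF K, of x y] by simp
qed

text \<open>The exponential series has nonnegative coefficients, and positivity survives sums and
  limits. Positivity of all powers is a premise because it is obtained separately, one Gram factor
  at a time.\<close>

lemma positive_kernel_exp:
  assumes "\<And>n. positive_kernel A (\<lambda>x y. K x y ^ n)"
  shows "positive_kernel A (\<lambda>x y. exp (K x y))"
proof (rule positive_kernelI)
  show "exp (K x y) = exp (K y x)" if "x \<in> A" "y \<in> A" for x y
    using positive_kernel_sym[OF assms[of 1] that] by simp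
  fix F c assume F: "finite F" "F \<subseteq> A"
  have "(\<lambda>n. K x y ^ n / fact n) sums exp (K x y)" for x y
    using exp_converges[of "K x y"] by (simp add: divide_inverse mult.commute)
  then have series: "(\<lambda>n. \<Sum>x\<in>F. \<Sum>y\<in>F. c x * c y * (K x y ^ n / fact n)) sums
      (\<Sum>x\<in>F. \<Sum>y\<in>F. c x * c y * exp (K x y))"
    by (intro sums_sum sums_mult)
  have "0 \<le> (\<Sum>x\<in>F. \<Sum>y\<in>F. c x * c y * (K x y ^ n / fact n))" for n
  proof -
    have "(\<Sum>x\<in>F. \<Sum>y\<in>F. c x * c y * (K x y ^ n / fact n)) =
        (\<Sum>x\<in>F. \<Sum>y\<in>F. c x * c y * K x y ^ n) / fact n"
      by (simp add: sum_divide_distrib)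
    then show ?thesis using positive_kernel_nonneg[OF assms[of n] F, of c] by simp
  qed
  then show "0 \<le> (\<Sum>x\<in>F. \<Sum>y\<in>F. c x * c y * exp (K x y))"
    by (rule sums_le[OF _ sums_zero series])
qed

context complex_hilbert_space
begin

text \<open>
  A case of the Schur product theorem, by Gram--Schmidt: projecting away from a nonzero
  \<open>u z\<close> splits off a term of rank one and makes \<open>u z\<close> vanish.
\<close>

lemma Gram_Schur_nonneg:
  assumes "finite F" "F \<subseteq> A" "positive_kernel A K" "u \<in> F \<rightarrow> H"
  shows "0 \<le> (\<Sum>x\<in>F. \<Sum>y\<in>F. c x * c y * (Re (ip (u x) (u y)) * K x y))"
  using assms(4)
proof (induction "card {x \<in> F. u x \<noteq> 0}" arbitrary: u rule: less_induct)
  case less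
  show ?case
  proof (cases "\<exists>z\<in>F. u z \<noteq> 0")
    case False
    then have "(\<Sum>x\<in>F. \<Sum>y\<in>F. c x * c y * (Re (ip (u x) (u y)) * K x y)) = 0"
      by (intro sum.neutral) simp
    then show ?thesis by simp
  next
    case True
    then obtain z where z: "z \<in> F" "u z \<noteq> 0" by blast
    have uH: "u x \<in> H" if "x \<in> F" for x using less.prems that by blast
    define q where "q = Re (ip (u z) (u z))"
    have q: "q > 0" using ip_pos[OF uH[OF z(1)] z(2)] by (simp add: q_def)
    \<comment> \<open>Only the real part of the inner product enters the kernel, so the projection
      is taken with respect to \<open>Re (ip u v)\<close> and its coefficients \<open>a x\<close>
      are real.\<close>
    define a where "a = (\<lambda>x. Re (ip (u x) (u z)) / q)"
    define u' where "u' = (\<lambda>x. u x - smul (of_real (a x)) (u z))"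
    have u'H: "u' \<in> F \<rightarrow> H" using uH z(1) by (auto simp: u'_def H_diff H_smul)
    have "a z = 1" using q by (simp add: a_def q_def)
    then have "u' z = 0" by (simp add: u'_def)
    moreover have "u' x = 0" if "u x = 0" for x
      using that uH[OF z(1)] by (simp add: u'_def a_def)
    ultimately have "{x \<in> F. u' x \<noteq> 0} \<subset> {x \<in> F. u x \<noteq> 0}" using z by blast
    then have "card {x \<in> F. u' x \<noteq> 0} < card {x \<in> F. u x \<noteq> 0}"
      by (intro psubset_card_mono) (use assms(1) in auto)
    from less.hyps[OF this u'H]
    have IH: "0 \<le> (\<Sum>x\<in>F. \<Sum>y\<in>F. c x * c y * (Re (ip (u' x) (u' y)) * K x y))" .
    have split: "Re (ip (u x) (u y)) = Re (ip (u' x) (u' y)) + q * (a x * a y)"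
      if "x \<in> F" "y \<in> F" for x y
    proof -
      note H = uH[OF that(1)] uH[OF that(2)] uH[OF z(1)]
      have zy: "Re (ip (u z) (u y)) = q * a y" "Re (ip (u x) (u z)) = q * a x"
        using q ip_cnj[OF H(3,2)] by (simp_all add: a_def)
      have "Re (ip (u' x) (u' y)) = Re (ip (u x) (u y)) - a y * Re (ip (u x) (u z))
          - a x * Re (ip (u z) (u y)) + a x * a y * q"
        using H by (simp add: u'_def ip_diff_left ip_diff_right ip_scale_left ip_smul_right
            H_diff H_smul q_def algebra_simps)
      then show ?thesis by (simp add: zy)
    qed
    \<comment> \<open>The rank-one part \<open>q * (a x * a y)\<close> merely rescales the
      coefficients, so positivity of \<open>K\<close> itself takes care of it.\<close>
    have "(\<Sum>x\<in>F. \<Sum>y\<in>F. c x * c y * (Re (ip (u x) (u y)) * K x y)) =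
      (\<Sum>x\<in>F. \<Sum>y\<in>F. c x * c y * (Re (ip (u' x) (u' y)) * K x y)) +
      q * (\<Sum>x\<in>F. \<Sum>y\<in>F. (c x * a x) * (c y * a y) * K x y)"
      unfolding sum_distrib_left sum.distrib[symmetric]
      by (intro sum.cong refl) (simp add: split algebra_simps)
    moreover have "0 \<le> q * (\<Sum>x\<in>F. \<Sum>y\<in>F. (c x * a x) * (c y * a y) * K x y)"
      using q positive_kernel_nonneg[OF assms(3,1,2), of "\<lambda>x. c x * a x"] by simp
    ultimately show ?thesis using IH by simp
  qed
qed

text \<open>Expanding the squared distance writes the Gaussian as
  \<open>?f x * ?f y * exp (2 * s * ?r x y)\<close>: two weights and the exponential of a Gram
  kernel. Each further power of the Gram kernel is one more Schur product.\<close>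

lemma positive_kernel_gaussian:
  assumes b: "b \<in> A \<rightarrow> H" and "s \<ge> 0"
  shows "positive_kernel A (\<lambda>x y. exp (- s * (hnorm ip (b x - b y))\<^sup>2))"
proof -
  let ?r = "\<lambda>x y. Re (ip (b x) (b y))"
  have sym: "?r x y = ?r y x" if "x \<in> A" "y \<in> A" for x y
    using ip_cnj[of "b x" "b y"] b that by (simp add: Pi_iff)
  have power: "positive_kernel A (\<lambda>x y. (2 * s * ?r x y) ^ n)" for n
  proof (induction n)
    case 0
    show ?case
    proof (rule positive_kernelI)
      fix F and c :: "_ \<Rightarrow> real"
      have "(\<Sum>x\<in>F. \<Sum>y\<in>F. c x * c y * (2 * s * ?r x y) ^ 0) = (\<Sum>x\<in>F. c x)\<^sup>2"
        by (simp add: power2_eq_square sum_product)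
      then show "0 \<le> (\<Sum>x\<in>F. \<Sum>y\<in>F. c x * c y * (2 * s * ?r x y) ^ 0)" by simp
    qed simp
  next
    case (Suc n)
    show ?case
    proof (rule positive_kernelI)
      fix F c assume F: "finite F" "F \<subseteq> A"
      have "0 \<le> (2 * s) * (\<Sum>x\<in>F. \<Sum>y\<in>F. c x * c y * (?r x y * (2 * s * ?r x y) ^ n))"
      proof (rule mult_nonneg_nonneg)
        show "0 \<le> (\<Sum>x\<in>F. \<Sum>y\<in>F. c x * c y * (?r x y * (2 * s * ?r x y) ^ n))"
          by (rule Gram_Schur_nonneg[OF F Suc, where u = b]) (use F b in auto)
      qed (use \<open>s \<ge> 0\<close> in simp)
      then show "0 \<le> (\<Sum>x\<in>F. \<Sum>y\<in>F. c x * c y * (2 * s * ?r x y) ^ Suc n)"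
        by (simp add: sum_distrib_left mult_ac)
    qed (simp add: sym)
  qed
  let ?f = "\<lambda>x. exp (- s * (hnorm ip (b x))\<^sup>2)"
  have eq: "exp (- s * (hnorm ip (b x - b y))\<^sup>2) = ?f x * ?f y * exp (2 * s * ?r x y)"
    if "x \<in> A" "y \<in> A" for x y
    using b that by (simp add: hnorm_diff_power2 Pi_iff algebra_simps flip: exp_add)
  have "positive_kernel A (\<lambda>x y. ?f x * ?f y * exp (2 * s * ?r x y))"
    by (intro positive_kernel_weighted positive_kernel_exp power)
  then show ?thesis
    by (rule positive_kernel_cong) (simp only: eq)
qed

end


section \<open>Property (T) and bounded cocycles\<close>

text \<open>
  The GNS construction: an invariant kernel of positive type is an invariant semi-inner
  product on the finitely supported functions on the group, the points being a spanning set.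
\<close>

definition fin_supp :: "'a set \<Rightarrow> ('a \<Rightarrow> complex) set"
  where "fin_supp A = {c. finite {x. c x \<noteq> 0} \<and> {x. c x \<noteq> 0} \<subseteq> A}"

definition pointwise_smul :: "complex \<Rightarrow> ('a \<Rightarrow> complex) \<Rightarrow> 'a \<Rightarrow> complex"
  where "pointwise_smul c f = (\<lambda>x. c * f x)"

definition kernel_ip :: "('a \<Rightarrow> 'a \<Rightarrow> real) \<Rightarrow> ('a \<Rightarrow> complex) \<Rightarrow> ('a \<Rightarrow> complex) \<Rightarrow> complex"
  where "kernel_ip K c d = (\<Sum>x\<in>{x. c x \<noteq> 0}. \<Sum>y\<in>{y. d y \<noteq> 0}. c x * cnj (d y) * of_real (K x y))"

text \<open>The left regular representation, moving the point mass at \<open>x\<close> to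
  \<open>g x\<close>. The value 0 off the carrier keeps supports inside the group.\<close>

definition translate :: "('a, 'b) monoid_scheme \<Rightarrow> 'a \<Rightarrow> ('a \<Rightarrow> complex) \<Rightarrow> 'a \<Rightarrow> complex"
  where "translate G g c = (\<lambda>x. if x \<in> carrier G then c (inv\<^bsub>G\<^esub> g \<otimes>\<^bsub>G\<^esub> x) else 0)"

text \<open>Supports change under addition and scaling; a common index set reduces linearity to
  identities between finite sums.\<close>

lemma kernel_ip_superset:
  assumes "finite S" "{x. c x \<noteq> 0} \<subseteq> S" "finite S'" "{x. d x \<noteq> 0} \<subseteq> S'"
  shows "kernel_ip K c d = (\<Sum>x\<in>S. \<Sum>y\<in>S'. c x * cnj (d y) * of_real (K x y))"
proof -
  have "kernel_ip K c d = (\<Sum>x\<in>{x. c x \<noteq> 0}. \<Sum>y\<in>S'. c x * cnj (d y) * of_real (K x y))"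
    unfolding kernel_ip_def by (intro sum.cong refl sum.mono_neutral_left) (use assms in auto)
  also have "\<dots> = (\<Sum>x\<in>S. \<Sum>y\<in>S'. c x * cnj (d y) * of_real (K x y))"
    by (intro sum.mono_neutral_left) (use assms in auto)
  finally show ?thesis .
qed

lemma fin_supp_add_support: "{x. (c + d) x \<noteq> (0::complex)} \<subseteq> {x. c x \<noteq> 0} \<union> {x. d x \<noteq> 0}"
  by auto

lemma semi_inner_product_kernel:
  assumes K: "positive_kernel A K"
  shows "semi_inner_product_space pointwise_smul (fin_supp A) (kernel_ip K)"
proof -
  interpret F: vector_space "pointwise_smul :: complex \<Rightarrow> ('a \<Rightarrow> complex) \<Rightarrow> _"
    by unfold_locales (auto simp: pointwise_smul_def algebra_simps fun_eq_iff)
  show ?thesis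
  proof unfold_locales
    show "F.subspace (fin_supp A)"
      unfolding F.subspace_def
    proof (intro conjI ballI allI)
      show "f + g \<in> fin_supp A" if "f \<in> fin_supp A" "g \<in> fin_supp A" for f g
        using that finite_subset[OF fin_supp_add_support[of f g]] fin_supp_add_support[of f g]
        unfolding fin_supp_def by blast
      show "pointwise_smul c f \<in> fin_supp A" if "f \<in> fin_supp A" for c f
        using that by (cases "c = 0") (auto simp: fin_supp_def pointwise_smul_def)
    qed (auto simp: fin_supp_def)
  next
    fix f g h assume fgh: "f \<in> fin_supp A" "g \<in> fin_supp A" "h \<in> fin_supp A"
    let ?S = "{x. f x \<noteq> 0} \<union> {x. g x \<noteq> 0}" and ?S' = "{x. h x \<noteq> 0}"
    have fin: "finite ?S" "finite ?S'" using fgh by (auto simp: fin_supp_def)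
    have "kernel_ip K k h = (\<Sum>x\<in>?S. \<Sum>y\<in>?S'. k x * cnj (h y) * of_real (K x y))"
      if "k \<in> {f, g, f + g}" for k
      using that fin by (intro kernel_ip_superset) auto
    then show "kernel_ip K (f + g) h = kernel_ip K f h + kernel_ip K g h"
      by (simp add: sum.distrib distrib_right)
  next
    fix f g c assume fg: "f \<in> fin_supp A" "g \<in> fin_supp A"
    then have fin: "finite {x. f x \<noteq> 0}" "finite {x. g x \<noteq> 0}" by (auto simp: fin_supp_def)
    have "kernel_ip K k g = (\<Sum>x\<in>{x. f x \<noteq> 0}. \<Sum>y\<in>{x. g x \<noteq> 0}. k x * cnj (g y) * of_real (K x y))"
      if "k \<in> {f, pointwise_smul c f}" for k
      using that fin by (intro kernel_ip_superset) (auto simp: pointwise_smul_def)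
    then show "kernel_ip K (pointwise_smul c f) g = c * kernel_ip K f g"
      by (simp add: sum_distrib_left mult.assoc pointwise_smul_def)
  next
    fix f g assume fg: "f \<in> fin_supp A" "g \<in> fin_supp A"
    have "kernel_ip K f g =
        (\<Sum>y\<in>{y. g y \<noteq> 0}. \<Sum>x\<in>{x. f x \<noteq> 0}. f x * cnj (g y) * of_real (K x y))"
      unfolding kernel_ip_def by (rule sum.swap)
    also have "\<dots> = cnj (kernel_ip K g f)"
      unfolding kernel_ip_def cnj_sum
    proof (intro sum.cong refl)
      fix x y assume "y \<in> {y. g y \<noteq> 0}" "x \<in> {x. f x \<noteq> 0}"
      then have "K x y = K y x" using fg positive_kernel_sym[OF K] by (auto simp: fin_supp_def)
      then show "f x * cnj (g y) * of_real (K x y) = cnj (g y * cnj (f x) * of_real (K y x))" by simp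
    qed
    finally show "kernel_ip K f g = cnj (kernel_ip K g f)" .
  next
    fix f assume f: "f \<in> fin_supp A"
    let ?S = "{x. f x \<noteq> 0}"
    \<comment> \<open>As \<open>K\<close> is real, the real part of \<open>f x * cnj (f y)\<close>
      separates into products of real parts and of imaginary parts, each a real quadratic
      form.\<close>
    have "Re (kernel_ip K f f) = (\<Sum>x\<in>?S. \<Sum>y\<in>?S. Re (f x) * Re (f y) * K x y)
        + (\<Sum>x\<in>?S. \<Sum>y\<in>?S. Im (f x) * Im (f y) * K x y)"
      unfolding kernel_ip_def Re_sum sum.distrib[symmetric]
      by (intro sum.cong refl) (simp add: algebra_simps)
    moreover have "finite ?S" "?S \<subseteq> A" using f by (auto simp: fin_supp_def)
    ultimately show "0 \<le> Re (kernel_ip K f f)"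
      using positive_kernel_nonneg[OF K, of ?S "\<lambda>x. Re (f x)"] positive_kernel_nonneg[OF K, of ?S "\<lambda>x. Im (f x)"]
      by simp
  qed
qed

lemma (in group) translate_support:
  assumes "g \<in> carrier G" "c \<in> fin_supp (carrier G)"
  shows "{x. translate G g c x \<noteq> 0} = (\<lambda>x. g \<otimes> x) ` {x. c x \<noteq> 0}"
proof (intro equalityI subsetI)
  fix x assume "x \<in> {x. translate G g c x \<noteq> 0}"
  then have "x \<in> carrier G" "c (inv g \<otimes> x) \<noteq> 0" by (auto simp: translate_def split: if_splits)
  moreover then have "x = g \<otimes> (inv g \<otimes> x)" using assms(1) by (simp add: m_assoc[symmetric])
  ultimately show "x \<in> (\<lambda>x. g \<otimes> x) ` {x. c x \<noteq> 0}" by blast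
next
  fix x assume "x \<in> (\<lambda>x. g \<otimes> x) ` {x. c x \<noteq> 0}"
  then obtain y where y: "x = g \<otimes> y" "c y \<noteq> 0" "y \<in> carrier G" using assms(2) by (auto simp: fin_supp_def)
  then have "inv g \<otimes> x = y" using assms(1) by (simp add: m_assoc[symmetric])
  then show "x \<in> {x. translate G g c x \<noteq> 0}" using y assms(1) by (simp add: translate_def)
qed

lemma (in group) translate_mult:
  "\<lbrakk>g \<in> carrier G; x \<in> carrier G\<rbrakk> \<Longrightarrow> translate G g c (g \<otimes> x) = c x"
  by (simp add: translate_def m_assoc[symmetric])

text \<open>Reindexing by left multiplication moves both translations into the kernel. Two different
  elements are allowed so that matrix coefficients are covered as well as isometry.\<close>

lemma (in group) kernel_ip_translate:
  assumes "g \<in> carrier G" "h \<in> carrier G" "c \<in> fin_supp (carrier G)" "d \<in> fin_supp (carrier G)"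
  shows "kernel_ip K (translate G g c) (translate G h d) = kernel_ip (\<lambda>x y. K (g \<otimes> x) (h \<otimes> y)) c d"
proof -
  have inj: "inj_on (\<lambda>x. k \<otimes> x) {x. c x \<noteq> 0}" if "k \<in> carrier G" "c \<in> fin_supp (carrier G)" for k c
    by (rule inj_on_subset[OF inj_on_cmult[OF that(1)]]) (use that(2) in \<open>simp add: fin_supp_def\<close>)
  have "c x \<noteq> 0 \<Longrightarrow> x \<in> carrier G" "d x \<noteq> 0 \<Longrightarrow> x \<in> carrier G" for x
    using assms by (auto simp: fin_supp_def)
  then show ?thesis
    unfolding kernel_ip_def translate_support[OF assms(1,3)] translate_support[OF assms(2,4)]
      sum.reindex[OF inj[OF assms(1,3)]] sum.reindex[OF inj[OF assms(2,4)]] o_def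
    by (intro sum.cong refl) (use assms in \<open>simp add: translate_mult\<close>)
qed

lemma isometric_action_kernel:
  fixes G :: "('a, 'b) monoid_scheme" (structure)
  assumes "topological_group G T" and K: "positive_kernel (carrier G) K"
    and inv: "\<And>g x y. \<lbrakk>g \<in> carrier G; x \<in> carrier G; y \<in> carrier G\<rbrakk> \<Longrightarrow> K (g \<otimes> x) (g \<otimes> y) = K x y"
    and cont: "\<And>x y. \<lbrakk>x \<in> carrier G; y \<in> carrier G\<rbrakk> \<Longrightarrow> continuous_map T euclideanreal (\<lambda>g. K (g \<otimes> x) y)"
  shows "isometric_action G T pointwise_smul (fin_supp (carrier G)) (kernel_ip K) (translate G)"
proof -
  interpret topological_group G T by fact
  interpret semi_inner_product_space pointwise_smul "fin_supp (carrier G)" "kernel_ip K"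
    by (rule semi_inner_product_kernel[OF K])
  have closed: "translate G g c \<in> fin_supp (carrier G)"
    if "g \<in> carrier G" "c \<in> fin_supp (carrier G)" for g c
  proof -
    have "finite {x. c x \<noteq> 0}" "{x. c x \<noteq> 0} \<subseteq> carrier G" using that(2) by (auto simp: fin_supp_def)
    then show ?thesis
      unfolding fin_supp_def mem_Collect_eq translate_support[OF that]
      using that(1) by (intro conjI finite_imageI image_subsetI m_closed) auto
  qed
  have isom: "kernel_ip K (translate G g c) (translate G g d) = kernel_ip K c d"
    if "g \<in> carrier G" "c \<in> fin_supp (carrier G)" "d \<in> fin_supp (carrier G)" for g c d
    unfolding kernel_ip_translate[OF that(1,1,2,3)] unfolding kernel_ip_def using that
    by (intro sum.cong refl) (auto simp: inv fin_supp_def subset_iff)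
  show ?thesis
  proof unfold_locales
    fix c g and e :: real
    assume c: "c \<in> fin_supp (carrier G)" and g: "g \<in> carrier G" and e: "e > 0"
    \<comment> \<open>By isometry the squared displacement between the translates by
      \<open>h\<close> and \<open>g\<close> is \<open>2 * f g - 2 * f h\<close>. Continuity of this
      single coefficient thus suffices, and a drop below \<open>e\<^sup>2 / 2\<close> is what
      \<open>U\<close> has to ensure.\<close>
    define f where "f = (\<lambda>h. Re (kernel_ip K (translate G h c) (translate G g c)))"
    have supp: "finite {x. c x \<noteq> 0}" "c x \<noteq> 0 \<Longrightarrow> x \<in> carrier G" for x
      using c by (auto simp: fin_supp_def)
    have f_eq: "f h = (\<Sum>x\<in>{x. c x \<noteq> 0}. \<Sum>y\<in>{y. c y \<noteq> 0}. Re (c x * cnj (c y)) * K (h \<otimes> x) (g \<otimes> y))"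
      if "h \<in> topspace T" for h
      using that g c by (simp add: f_def topspace_eq kernel_ip_translate) (simp add: kernel_ip_def Re_complex_of_real)
    have "continuous_map T euclideanreal
        (\<lambda>h. \<Sum>x\<in>{x. c x \<noteq> 0}. \<Sum>y\<in>{y. c y \<noteq> 0}. Re (c x * cnj (c y)) * K (h \<otimes> x) (g \<otimes> y))"
      by (intro continuous_map_sum continuous_map_real_mult_left cont) (use supp g in auto)
    then have contf: "continuous_map T euclideanreal f"
      by (rule continuous_map_eq) (simp add: f_eq)
    define U where "U = {h \<in> topspace T. f h \<in> {f g - e\<^sup>2 / 2 <..}}"
    have "openin T U"
      unfolding U_def by (rule openin_continuous_map_preimage[OF contf]) simp
    moreover have "g \<in> U" using g e by (simp add: U_def topspace_eq)
    moreover have "hnorm (kernel_ip K) (translate G h c - translate G g c) < e" if "h \<in> U" for h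
    proof -
      have h: "h \<in> carrier G" "f h > f g - e\<^sup>2 / 2" using that by (auto simp: U_def topspace_eq)
      have "(hnorm (kernel_ip K) (translate G h c - translate G g c))\<^sup>2 = 2 * f g - 2 * f h"
        using h(1) g c by (simp add: seminorm_diff_power2 closed seminorm_power2 isom f_def)
      then have "(hnorm (kernel_ip K) (translate G h c - translate G g c))\<^sup>2 < e\<^sup>2"
        using h(2) by argo
      then show ?thesis using e by (simp add: power2_less_imp_less)
    qed
    ultimately show "\<exists>U. openin T U \<and> g \<in> U \<and>
        (\<forall>h\<in>U. hnorm (kernel_ip K) (translate G h c - translate G g c) < e)" by blast
  next
    fix g h c assume "g \<in> carrier G" "h \<in> carrier G" "c \<in> fin_supp (carrier G)"
    then show "translate G (g \<otimes> h) c = translate G g (translate G h c)"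
      by (auto simp: translate_def fun_eq_iff inv_mult_group m_assoc)
  next
    fix c assume "c \<in> fin_supp (carrier G)"
    then show "translate G \<one> c = c"
      by (auto simp: translate_def fun_eq_iff fin_supp_def)
  qed (use closed isom in \<open>auto simp: translate_def pointwise_smul_def fun_eq_iff\<close>)
qed

section \<open>Fixed vectors near almost invariant ones\<close>

lemma (in unitary_module) action_diff:
  "\<lbrakk>g \<in> carrier G; u \<in> H; v \<in> H\<rbrakk> \<Longrightarrow> \<pi> g (u - v) = \<pi> g u - \<pi> g v"
  using action_add[of g "u - v" v] by (simp add: H_diff)

lemma (in unitary_module) action_hnorm: "\<lbrakk>g \<in> carrier G; v \<in> H\<rbrakk> \<Longrightarrow> hnorm ip (\<pi> g v) = hnorm ip v"
  by (simp add: hnorm_def action_ip)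

lemma (in unitary_module) subspace_fixed_vectors:
  assumes "S \<subseteq> carrier G"
  shows "subspace (fixed_vectors S H \<pi>)"
  using assms action_smul[of _ 0 0]
  by (auto simp: subspace_def fixed_vectors_def H_add H_smul action_add action_smul subset_iff)

text \<open>Since \<open>\<pi> g\<close> is isometric, it moves \<open>x\<close> by at most twice
  the distance from \<open>x\<close> to any vector it fixes.\<close>

lemma (in unitary_module) fixed_vectors_closed:
  assumes "S \<subseteq> carrier G" and \<sigma>: "\<And>n. \<sigma> n \<in> fixed_vectors S H \<pi>"
    and x: "x \<in> H" and lim: "(\<lambda>n. hnorm ip (\<sigma> n - x)) \<longlonglongrightarrow> 0"
  shows "x \<in> fixed_vectors S H \<pi>"
proof -
  have "\<pi> g x = x" if "g \<in> S" for g
  proof -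
    have g: "g \<in> carrier G" using that assms(1) by blast
    have \<sigma>H: "\<sigma> n \<in> H" "\<pi> g (\<sigma> n) = \<sigma> n" for n using \<sigma> that by (auto simp: fixed_vectors_def)
    have \<pi>x: "\<pi> g x \<in> H" using g x by (rule action_closed)
    have "hnorm ip (\<pi> g x - x) \<le> 2 * hnorm ip (\<sigma> n - x)" for n
    proof -
      have "hnorm ip (\<pi> g x - \<sigma> n) = hnorm ip (\<pi> g (x - \<sigma> n))"
        using g x \<sigma>H by (simp add: action_diff)
      also have "\<dots> = hnorm ip (\<sigma> n - x)"
        using g x \<sigma>H hnorm_minus_commute[of x "\<sigma> n"] by (simp add: action_hnorm H_diff)
      finally show ?thesis
        using hnorm_triangle_diff[OF \<pi>x \<sigma>H(1) x, of n] by simp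
    qed
    then have "hnorm ip (\<pi> g x - x) \<le> 2 * 0"
      by (intro LIMSEQ_le_const[OF tendsto_mult_left[OF lim]]) auto
    then show ?thesis
      using hnorm_eq_0_iff[of "\<pi> g x - x"] hnorm_nonneg[of "\<pi> g x - x"] x \<pi>x by (simp add: H_diff)
  qed
  then show ?thesis using x by (simp add: fixed_vectors_def)
qed

lemma (in complex_hilbert_space) orthogonal_sym: "\<lbrakk>u \<in> H; v \<in> H; ip u v = 0\<rbrakk> \<Longrightarrow> ip v u = 0"
  using ip_cnj[of v u] by simp

text \<open>Split off the component \<open>z\<close> of \<open>\<xi>\<close> orthogonal to the fixed
  vectors; it is displaced exactly as \<open>\<xi>\<close> is. If its norm exceeded
  \<open>r\<close>, it would be almost invariant in the complement \<open>W\<close>, and the Kazhdan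
  pair would give a nonzero fixed vector orthogonal to itself.\<close>

lemma (in unitary_module) kazhdan_pair_fixed_vector_near:
  assumes grp: "group G" and top: "topspace T = carrier G" and Q: "Q \<subseteq> carrier G"
    and K: "kazhdan_pair G T Q \<epsilon> TYPE('v)" and "\<epsilon> > 0"
    and \<xi>: "\<xi> \<in> H" and small: "\<And>g. g \<in> Q \<Longrightarrow> hnorm ip (\<pi> g \<xi> - \<xi>) \<le> \<epsilon> * r" and "r \<ge> 0"
  shows "\<exists>\<eta>\<in>fixed_vectors (carrier G) H \<pi>. hnorm ip (\<xi> - \<eta>) \<le> r"
proof -
  interpret grp: group G by fact
  let ?P = "fixed_vectors (carrier G) H \<pi>"
  define W where "W = {w \<in> H. \<forall>p\<in>?P. ip p w = 0}"
  have PH: "?P \<subseteq> H" and WH: "W \<subseteq> H" by (auto simp: fixed_vectors_def W_def)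
  obtain \<sigma> z where \<sigma>: "\<And>n. \<sigma> n \<in> ?P" and z: "z \<in> H" "\<And>p. p \<in> ?P \<Longrightarrow> ip z p = 0"
    and lim: "(\<lambda>n. hnorm ip (\<sigma> n - (\<xi> - z))) \<longlonglongrightarrow> 0"
    using orthogonal_approximation[OF subspace_fixed_vectors[OF order_refl] PH \<xi>] by blast
  have \<eta>: "\<xi> - z \<in> ?P"
    by (rule fixed_vectors_closed[OF order_refl \<sigma> _ lim]) (use \<xi> z in \<open>simp add: H_diff\<close>)
  have zW: "z \<in> W" using z PH orthogonal_sym by (auto simp: W_def)
  have hW: "complex_hilbert_space smul W ip"
    unfolding W_def using PH by (rule orthogonal_complement_hilbert)
  have W_inv: "\<pi> g w \<in> W" if g: "g \<in> carrier G" and w: "w \<in> W" for g w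
  proof -
    have "ip p (\<pi> g w) = 0" if p: "p \<in> ?P" for p
    proof -
      have "p \<in> H" "\<pi> g p = p" using p g by (auto simp: fixed_vectors_def)
      then have "ip p (\<pi> g w) = ip p w" using action_ip[OF g, of p w] w WH by auto
      then show ?thesis using p w by (simp add: W_def)
    qed
    then show ?thesis using g w WH by (auto simp: W_def action_closed)
  qed
  have MW: "unitary_module G T smul W ip \<pi>"
    by (rule submodule[OF grp top WH hW W_inv])
  have "hnorm ip z \<le> r"
  proof (rule ccontr)
    assume "\<not> hnorm ip z \<le> r"
    then have z_large: "r < hnorm ip z" by simp
    have "almost_invariant Q \<epsilon> ip \<pi> z"
      unfolding almost_invariant_def
    proof (intro conjI ballI)
      show "z \<noteq> 0" using z_large \<open>r \<ge> 0\<close> by auto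
      fix g assume "g \<in> Q"
      then have g: "g \<in> carrier G" using Q by blast
      have "\<pi> g (\<xi> - z) = \<xi> - z" using \<eta> g by (simp add: fixed_vectors_def)
      then have "\<pi> g z - z = \<pi> g \<xi> - \<xi>"
        using g \<xi> z by (simp add: action_diff algebra_simps)
      then show "hnorm ip (\<pi> g z - z) < \<epsilon> * hnorm ip z"
        using small[OF \<open>g \<in> Q\<close>] mult_strict_left_mono[OF z_large \<open>\<epsilon> > 0\<close>] by simp
    qed
    then obtain w where "w \<in> fixed_vectors (carrier G) W \<pi>" "w \<noteq> 0"
      using K MW zW unfolding kazhdan_pair_def by blast
    then have "w \<in> W" "w \<in> ?P" using WH by (auto simp: fixed_vectors_def)
    then have "ip w w = 0" by (simp add: W_def)
    then show False using ip_pos[of w] \<open>w \<in> W\<close> WH \<open>w \<noteq> 0\<close> by auto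
  qed
  then show ?thesis using \<eta> by (intro bexI[of _ "\<xi> - z"]) auto
qed

lemma cocyclesD:
  assumes "b \<in> cocycles G T H ip \<pi>"
  shows "b \<in> carrier G \<rightarrow>\<^sub>E H" "continuous_map T (htopology H ip) b"
    "\<lbrakk>g \<in> carrier G; h \<in> carrier G\<rbrakk> \<Longrightarrow> b (g \<otimes>\<^bsub>G\<^esub> h) = b g + \<pi> g (b h)"
    "g \<in> carrier G \<Longrightarrow> b g \<in> H"
  using assms by (auto simp: cocycles_def)

lemma (in unitary_module) cocycle_one:
  assumes "group G" "b \<in> cocycles G T H ip \<pi>"
  shows "b \<one> = 0"
proof -
  interpret group G by fact
  show ?thesis
    using cocyclesD(3)[OF assms(2), of \<one> \<one>] cocyclesD(4)[OF assms(2), of \<one>] action_one[OF assms(1)] by simp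
qed

lemma (in complex_hilbert_space) continuous_map_hnorm_diff:
  assumes f: "continuous_map X (htopology H ip) f" and w: "w \<in> H"
  shows "continuous_map X euclideanreal (\<lambda>x. hnorm ip (f x - w))"
proof -
  have fH: "f x \<in> H" if "x \<in> topspace X" for x
    using continuous_map_image_subset_topspace[OF f] that by (auto simp: htopology_def)
  have "continuous_map X euclideanreal (\<lambda>x. hdist H ip (f x) w)"
    using continuous_map_mdist[of X Hilb.Self f "\<lambda>_. w"] f w by (simp add: htopology_def mtopology_of_def)
  then show ?thesis
    by (rule continuous_map_eq) (use fH w in \<open>simp add: hdist_def\<close>)
qed

text \<open>
  Delorme's argument: for small \<open>s\<close> the cyclic vector of the representation with coefficient
  \<open>exp (- s * \<parallel>b g\<parallel>\<^sup>2)\<close> is almost invariant, hence uniformly close to an invariant vector.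
\<close>

lemma (in unitary_module) property_T_cocycle_bounded:
  assumes G: "topological_group G T" and T: "property_T G T" and b: "b \<in> cocycles G T H ip \<pi>"
  shows "\<exists>R. \<forall>g\<in>carrier G. hnorm ip (b g) \<le> R"
proof -
  interpret topological_group G T by fact
  have grp: "group G" by unfold_locales
  note bH = cocyclesD(4)[OF b]
  have b1: "b \<one> = 0" by (rule cocycle_one[OF grp b])
  obtain Q \<epsilon> where Q: "compactin T Q" "\<epsilon> > 0" "kazhdan_pair G T Q \<epsilon> TYPE('g \<Rightarrow> complex)"
    using T unfolding property_T_def by blast
  have QG: "Q \<subseteq> carrier G" using compactin_subset_topspace[OF Q(1)] topspace_eq by simp
  have "Hilb.mbounded (b ` Q)"
    by (rule Hilb.compactin_imp_mbounded)
      (use image_compactin[OF Q(1) cocyclesD(2)[OF b]] in \<open>simp add: htopology_def\<close>)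
  then obtain x B where "b ` Q \<subseteq> Hilb.mcball x B" by (auto simp: Hilb.mbounded_def)
  then have xB: "x \<in> H" "hnorm ip (x - b g) \<le> B" if "g \<in> Q" for g
    using that by (auto simp: hdist_def Hilb.mcball_def subset_iff split: if_splits)
  define C where "C = (hnorm ip x + \<bar>B\<bar>)\<^sup>2"
  have C: "(hnorm ip (b g))\<^sup>2 \<le> C" if "g \<in> Q" for g
    unfolding C_def
    using hnorm_triangle_sub[of "b g" x] hnorm_minus_commute[of "b g" x] xB[OF that] bH[of g] that QG
    by (intro power_mono) (auto simp: hnorm_nonneg subset_iff)
  have C0: "C \<ge> 0" by (simp add: C_def)
  \<comment> \<open>Chosen so that \<open>2 * s * (C + 1)\<close> is the square of
    \<open>\<epsilon> / 4\<close>, an upper bound for the squared displacement of the cyclic vector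
    on \<open>Q\<close>. The \<open>+ 1\<close> keeps the denominator positive.\<close>
  define s where "s = (\<epsilon> / 4)\<^sup>2 / (2 * (C + 1))"
  have s: "s > 0" using C0 \<open>\<epsilon> > 0\<close> by (simp add: s_def)
  define K where "K = (\<lambda>x y. exp (- s * (hnorm ip (b x - b y))\<^sup>2))"
  have K: "positive_kernel (carrier G) K"
    unfolding K_def by (rule positive_kernel_gaussian) (use bH s in auto)
  \<comment> \<open>Cocycle values at translated points differ by
    \<open>\<pi> g (b x - b y)\<close>, so the kernel sees an unchanged distance.\<close>
  have K_inv: "K (g \<otimes> x) (g \<otimes> y) = K x y" if "g \<in> carrier G" "x \<in> carrier G" "y \<in> carrier G" for g x y
  proof -
    have "b (g \<otimes> x) - b (g \<otimes> y) = \<pi> g (b x - b y)"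
      using that bH by (simp add: cocyclesD(3)[OF b] action_diff)
    then show ?thesis using that bH by (simp add: K_def action_hnorm H_diff)
  qed
  have K_cont: "continuous_map T euclideanreal (\<lambda>g. K (g \<otimes> x) y)" if "x \<in> carrier G" "y \<in> carrier G" for x y
  proof -
    have "continuous_map T T (\<lambda>g. g \<otimes> x)"
      using continuous_map_compose[OF _ continuous_mult, of T "\<lambda>g. (g, x)"] that topspace_eq
      by (simp add: o_def continuous_map_pairedI)
    then have "continuous_map T (htopology H ip) (\<lambda>g. b (g \<otimes> x))"
      using continuous_map_compose[OF _ cocyclesD(2)[OF b]] by (simp add: o_def)
    from continuous_map_hnorm_diff[OF this bH[OF that(2)]]
    have "continuous_map T euclideanreal (\<lambda>g. - s * (hnorm ip (b (g \<otimes> x) - b y))\<^sup>2)"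
      by (intro continuous_map_real_mult_left continuous_map_real_pow)
    from continuous_map_compose[OF this, of euclideanreal exp]
    show ?thesis by (simp add: K_def o_def continuous_on_exp)
  qed
  interpret A: isometric_action G T pointwise_smul "fin_supp (carrier G)" "kernel_ip K" "translate G"
    by (rule isometric_action_kernel[OF G K K_inv K_cont])
  obtain smul' and H' :: "((nat \<Rightarrow> 'g \<Rightarrow> complex) \<Rightarrow> complex) set" and ip' \<pi>' \<Phi>
    where M': "unitary_module G T smul' H' ip' \<pi>'"
      and \<Phi>H: "\<And>c. c \<in> fin_supp (carrier G) \<Longrightarrow> \<Phi> c \<in> H'"
      and \<Phi>_ip: "\<And>c d. \<lbrakk>c \<in> fin_supp (carrier G); d \<in> fin_supp (carrier G)\<rbrakk> \<Longrightarrow> ip' (\<Phi> c) (\<Phi> d) = kernel_ip K c d"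
      and \<Phi>_\<pi>: "\<And>g c. \<lbrakk>g \<in> carrier G; c \<in> fin_supp (carrier G)\<rbrakk> \<Longrightarrow> \<pi>' g (\<Phi> c) = \<Phi> (translate G g c)"
    using A.unitary_completion by blast
  interpret M': unitary_module G T smul' H' ip' \<pi>' by (rule M')
  define \<delta> :: "'g \<Rightarrow> complex" where "\<delta> = (\<lambda>x. if x = \<one> then 1 else 0)"
  define \<xi> where "\<xi> = \<Phi> \<delta>"
  have supp: "{x. \<delta> x \<noteq> 0} = {\<one>}" by (auto simp: \<delta>_def)
  then have \<delta>: "\<delta> \<in> fin_supp (carrier G)" by (simp add: fin_supp_def)
  have \<xi>: "\<xi> \<in> H'" unfolding \<xi>_def by (rule \<Phi>H[OF \<delta>])
  have tr: "translate G g \<delta> \<in> fin_supp (carrier G)" if "g \<in> carrier G" for g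
    by (rule A.act_closed[OF that \<delta>])
  have coeff: "ip' (\<pi>' g \<xi>) \<xi> = of_real (exp (- s * (hnorm ip (b g))\<^sup>2))" if g: "g \<in> carrier G" for g
  proof -
    \<comment> \<open>The second point mass is written as its translate by the unit so that
      \<open>kernel_ip_translate\<close> applies.\<close>
    have "ip' (\<pi>' g \<xi>) \<xi> = kernel_ip K (translate G g \<delta>) (translate G \<one> \<delta>)"
      by (simp add: \<xi>_def \<Phi>_\<pi>[OF g \<delta>] \<Phi>_ip[OF tr[OF g] \<delta>] A.act_one[OF \<delta>])
    also have "\<dots> = of_real (K g \<one>)"
      by (subst kernel_ip_translate) (use g \<delta> in \<open>simp_all add: kernel_ip_def supp\<close>, simp add: \<delta>_def)
    finally show ?thesis by (simp add: K_def b1)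
  qed
  have norm_\<xi>: "(hnorm ip' \<xi>)\<^sup>2 = 1"
    using coeff[of \<one>] \<xi> by (simp add: M'.action_one[OF grp] b1 M'.hnorm_power2)
  have displacement: "(hnorm ip' (\<pi>' g \<xi> - \<xi>))\<^sup>2 = 2 - 2 * exp (- s * (hnorm ip (b g))\<^sup>2)"
    if g: "g \<in> carrier G" for g
    using M'.hnorm_diff_power2[OF M'.action_closed[OF g \<xi>] \<xi>] g \<xi>
    by (simp add: coeff M'.action_hnorm norm_\<xi>)
  have "hnorm ip' (\<pi>' g \<xi> - \<xi>) \<le> \<epsilon> * (1/4)" if "g \<in> Q" for g
  proof (rule power2_le_imp_le)
    have g: "g \<in> carrier G" using that QG by blast
    have "1 - s * (hnorm ip (b g))\<^sup>2 \<le> exp (- s * (hnorm ip (b g))\<^sup>2)"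
      using exp_ge_add_one_self[of "- s * (hnorm ip (b g))\<^sup>2"] by simp
    moreover have "s * (hnorm ip (b g))\<^sup>2 \<le> s * (C + 1)"
      using C[OF that] s by (intro mult_left_mono) auto
    moreover have "s * (C + 1) = (\<epsilon> / 4)\<^sup>2 / 2" using C0 unfolding s_def by (simp add: divide_simps)
    ultimately have "2 - 2 * exp (- s * (hnorm ip (b g))\<^sup>2) \<le> (\<epsilon> / 4)\<^sup>2" by linarith
    then show "(hnorm ip' (\<pi>' g \<xi> - \<xi>))\<^sup>2 \<le> (\<epsilon> * (1/4))\<^sup>2" using displacement[OF g] by simp
  qed (use \<open>\<epsilon> > 0\<close> in simp)
  then obtain \<eta> where \<eta>: "\<eta> \<in> fixed_vectors (carrier G) H' \<pi>'" "hnorm ip' (\<xi> - \<eta>) \<le> 1/4"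
    using M'.kazhdan_pair_fixed_vector_near[OF grp topspace_eq QG
        kazhdan_pair_universal[OF G QG Q(3)] \<open>\<epsilon> > 0\<close> \<xi>, of "1/4"] by auto
  \<comment> \<open>A fixed vector within \<open>1/4\<close> of \<xi> bounds every displacement by
    \<open>1/2\<close>. The coefficient at \<open>g\<close> then stays above \<open>7/8\<close>,
    whereas it would tend to 0 if the cocycle were unbounded.\<close>
  have "(hnorm ip (b g))\<^sup>2 \<le> 1 / s" if g: "g \<in> carrier G" for g
  proof -
    have \<eta>H: "\<eta> \<in> H'" "\<pi>' g \<eta> = \<eta>" using \<eta> g by (auto simp: fixed_vectors_def)
    have g\<xi>: "\<pi>' g \<xi> \<in> H'" using g \<xi> by (rule M'.action_closed)
    have "hnorm ip' (\<pi>' g \<xi> - \<eta>) = hnorm ip' (\<pi>' g (\<xi> - \<eta>))"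
      using g \<xi> \<eta>H by (simp add: M'.action_diff)
    also have "\<dots> = hnorm ip' (\<xi> - \<eta>)" using g \<xi> \<eta>H by (simp add: M'.action_hnorm M'.H_diff)
    finally have "hnorm ip' (\<pi>' g \<xi> - \<xi>) \<le> 1/2"
      using M'.hnorm_triangle_diff[OF g\<xi> \<eta>H(1) \<xi>] M'.hnorm_minus_commute[OF \<xi> \<eta>H(1)] \<eta>(2) by simp
    then have "(hnorm ip' (\<pi>' g \<xi> - \<xi>))\<^sup>2 \<le> (1/2)\<^sup>2"
      using g\<xi> \<xi> by (intro power_mono) (auto simp: M'.hnorm_nonneg M'.H_diff)
    then have "7/8 \<le> exp (- s * (hnorm ip (b g))\<^sup>2)"
      using displacement[OF g] by (simp add: power2_eq_square)
    then have "exp (s * (hnorm ip (b g))\<^sup>2) \<le> 8/7"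
      by (simp add: exp_minus field_simps)
    then have "s * (hnorm ip (b g))\<^sup>2 \<le> 1"
      using exp_ge_add_one_self[of "s * (hnorm ip (b g))\<^sup>2"] by linarith
    then show ?thesis using s by (simp add: field_simps)
  qed
  then show ?thesis by (intro exI[of _ "sqrt (1 / s)"] ballI real_le_rsqrt)
qed

text \<open>The values of \<open>b\<close> form the orbit of 0 under the affine isometries
  \<open>x \<mapsto> \<pi> g x + b g\<close>, so these permute them and fix their circumcentre
  \<open>c\<close>. The convention \<open>\<pi> g v - v\<close> for coboundaries makes
  \<open>v\<close> the negative of \<open>c\<close>.\<close>

lemma (in unitary_module) bounded_cocycle_coboundary:
  assumes grp: "group G" and b: "b \<in> cocycles G T H ip \<pi>"
    and bounded: "\<And>g. g \<in> carrier G \<Longrightarrow> hnorm ip (b g) \<le> R"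
  shows "\<exists>v\<in>H. \<forall>g\<in>carrier G. b g = \<pi> g v - v"
proof -
  interpret group G by fact
  note bH = cocyclesD(4)[OF b]
  have "b ` carrier G \<subseteq> H" "b ` carrier G \<noteq> {}" using bH by auto
  from circumcentre[OF this, of R] bounded
  obtain c where c: "c \<in> H" and unique: "\<And>c'. \<lbrakk>c' \<in> H;
      \<And>r. (\<forall>x\<in>b ` carrier G. hnorm ip (c - x) \<le> r) \<Longrightarrow> (\<forall>x\<in>b ` carrier G. hnorm ip (c' - x) \<le> r)\<rbrakk> \<Longrightarrow> c' = c"
    by blast
  have "\<pi> g c + b g = c" if g: "g \<in> carrier G" for g
  proof (rule unique)
    show "\<pi> g c + b g \<in> H" using g c bH by (simp add: H_add action_closed)
    fix r assume r: "\<forall>x\<in>b ` carrier G. hnorm ip (c - x) \<le> r"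
    show "\<forall>x\<in>b ` carrier G. hnorm ip (\<pi> g c + b g - x) \<le> r"
    proof safe
      fix h assume h: "h \<in> carrier G"
      define k where "k = inv g \<otimes> h"
      have k: "k \<in> carrier G" "h = g \<otimes> k" using g h by (simp_all add: k_def m_assoc[symmetric])
      then have "\<pi> g c + b g - b h = \<pi> g (c - b k)"
        using g c bH by (simp add: cocyclesD(3)[OF b] action_diff)
      then show "hnorm ip (\<pi> g c + b g - b h) \<le> r"
        using r g c k bH by (simp add: action_hnorm H_diff)
    qed
  qed
  then have "b g = c - \<pi> g c" if "g \<in> carrier G" for g
    using that by (simp add: eq_diff_eq add.commute)
  then have "b g = \<pi> g (0 - c) - (0 - c)" if "g \<in> carrier G" for g
    using that action_diff[OF that H_zero c] action_smul[OF that H_zero, of 0] by simp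
  then show ?thesis using H_diff[OF H_zero c] by blast
qed

theorem (in unitary_module) property_T_cocycle_coboundary:
  assumes "topological_group G T" "property_T G T" "b \<in> cocycles G T H ip \<pi>"
  shows "\<exists>v\<in>H. \<forall>g\<in>carrier G. b g = \<pi> g v - v"
proof -
  interpret topological_group G T by fact
  show ?thesis
    using property_T_cocycle_bounded[OF assms] bounded_cocycle_coboundary[OF is_group assms(3)] by blast
qed

section \<open>Cocycles as a group\<close>

text \<open>If the quotient is trivial, each coset \<open>S #> x\<close> equals \<open>S\<close>,
  yet it contains \<open>x\<close>. Stated for subsets containing the unit, this applies directly to
  the closure of the coboundaries.\<close>

lemma (in group) trivial_group_Mod_iff:
  assumes "S \<subseteq> carrier G" "\<one> \<in> S"
  shows "trivial_group (G Mod S) \<longleftrightarrow> S = carrier G"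
proof
  assume triv: "trivial_group (G Mod S)"
  have "x \<in> S" if x: "x \<in> carrier G" for x
  proof -
    have "S #> x \<in> carrier (G Mod S)" using x by (auto simp: FactGroup_def RCOSETS_def)
    then have "S #> x = S" using triv by (simp add: trivial_group_def)
    moreover have "\<one> \<otimes> x \<in> S #> x" using assms(2) by (auto simp: r_coset_def)
    ultimately show ?thesis using x by simp
  qed
  then show "S = carrier G" using assms(1) by blast
next
  assume S: "S = carrier G"
  have "carrier G \<lhd> G"
    by (rule normalI[OF subgroup_self]) (auto simp: coset_join2[OF _ subgroup_self] coset_join3[OF _ subgroup_self])
  then have "group (G Mod carrier G)" by (rule normal.factorgroup_is_group)
  moreover have "carrier (G Mod carrier G) = {carrier G}"
    using one_closed by (auto simp: FactGroup_def RCOSETS_def coset_join2[OF _ subgroup_self])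
  ultimately show "trivial_group (G Mod S)" by (simp add: S trivial_group_def)
qed

context complex_hilbert_space
begin

lemma topspace_htopology [simp]: "topspace (htopology H ip) = H"
  by (simp add: htopology_def)

lemma continuous_map_htopology:
  "continuous_map X (htopology H ip) f \<longleftrightarrow> f \<in> topspace X \<rightarrow> H \<and>
    (\<forall>x\<in>topspace X. \<forall>e>0. \<exists>U. openin X U \<and> x \<in> U \<and> (\<forall>y\<in>U. hnorm ip (f y - f x) < e))"
proof (cases "f \<in> topspace X \<rightarrow> H")
  case True
  have eq: "(\<exists>U. openin X U \<and> x \<in> U \<and> (\<forall>y\<in>U. f y \<in> Hilb.mball (f x) e)) \<longleftrightarrow>
      (\<exists>U. openin X U \<and> x \<in> U \<and> (\<forall>y\<in>U. hnorm ip (f y - f x) < e))" if "x \<in> topspace X" for x e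
  proof -
    have "f y \<in> Hilb.mball (f x) e \<longleftrightarrow> hnorm ip (f y - f x) < e" if "openin X U" "y \<in> U" for U y
      using True \<open>x \<in> topspace X\<close> openin_subset[OF that(1)] that(2) hnorm_minus_commute[of "f x" "f y"]
      by (auto simp: hdist_def Pi_iff subset_iff)
    then show ?thesis by (intro ex_cong1 conj_cong ball_cong refl)
  qed
  show ?thesis
    using True unfolding htopology_def Hilb.continuous_map_to_metric by (simp only: eq simp_thms cong: ball_cong)
next
  case False
  then show ?thesis
    using continuous_map_image_subset_topspace[of X "htopology H ip" f] by auto
qed

lemma continuous_map_hilbert_diff:
  assumes f: "continuous_map X (htopology H ip) f" and g: "continuous_map X (htopology H ip) g"
  shows "continuous_map X (htopology H ip) (\<lambda>x. f x - g x)"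
  unfolding continuous_map_htopology
proof (intro conjI ballI allI impI)
  have fH: "f x \<in> H" and gH: "g x \<in> H" if "x \<in> topspace X" for x
    using f g that by (auto simp: continuous_map_htopology)
  show "(\<lambda>x. f x - g x) \<in> topspace X \<rightarrow> H" using fH gH by (auto intro: H_diff)
  fix x and e :: real assume x: "x \<in> topspace X" and "e > 0"
  then have "e / 2 > 0" by simp
  obtain U where U: "openin X U" "x \<in> U" "\<And>y. y \<in> U \<Longrightarrow> hnorm ip (f y - f x) < e / 2"
    using f x \<open>e / 2 > 0\<close> unfolding continuous_map_htopology by meson
  obtain V where V: "openin X V" "x \<in> V" "\<And>y. y \<in> V \<Longrightarrow> hnorm ip (g y - g x) < e / 2"
    using g x \<open>e / 2 > 0\<close> unfolding continuous_map_htopology by meson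
  have "hnorm ip (f y - g y - (f x - g x)) < e" if y: "y \<in> U \<inter> V" for y
  proof -
    have "y \<in> topspace X" using openin_subset[OF U(1)] y by blast
    note H = fH[OF this] gH[OF this] fH[OF x] gH[OF x]
    have "f y - g y - (f x - g x) = (f y - f x) + (g x - g y)" by simp
    then have "hnorm ip (f y - g y - (f x - g x)) \<le> hnorm ip (f y - f x) + hnorm ip (g x - g y)"
      using hnorm_triangle H H_diff by metis
    also have "\<dots> < e / 2 + e / 2"
      using U(3)[of y] V(3)[of y] y hnorm_minus_commute[OF H(2,4)] by (intro add_strict_mono) auto
    finally show ?thesis by simp
  qed
  then show "\<exists>U. openin X U \<and> x \<in> U \<and> (\<forall>y\<in>U. hnorm ip (f y - g y - (f x - g x)) < e)"
    using U(1,2) V(1,2) by (intro exI[of _ "U \<inter> V"]) auto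
qed

end

locale unitary_group_module = unitary_module + group G +
  assumes topspace_G: "topspace T = carrier G"
begin

lemma action_zero [simp]: "g \<in> carrier G \<Longrightarrow> \<pi> g 0 = 0"
  using action_smul[of g 0 0] by simp

abbreviation "Z \<equiv> cocycles G T H ip \<pi>"

lemma continuous_map_restrict_carrier:
  "continuous_map T X (\<lambda>g\<in>carrier G. f g) \<longleftrightarrow> continuous_map T X f"
  using continuous_map_eq[of T X f "\<lambda>g\<in>carrier G. f g"] continuous_map_eq[of T X "\<lambda>g\<in>carrier G. f g" f]
  by (auto simp: topspace_G)

lemma cocycle_diff:
  assumes "b \<in> Z" "c \<in> Z"
  shows "(\<lambda>g\<in>carrier G. b g - c g) \<in> Z"
  unfolding cocycles_def mem_Collect_eq continuous_map_restrict_carrier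
proof (intro conjI ballI)
  show "continuous_map T (htopology H ip) (\<lambda>g. b g - c g)"
    by (intro continuous_map_hilbert_diff cocyclesD(2)[OF assms(1)] cocyclesD(2)[OF assms(2)])
qed (use assms in \<open>auto simp: cocyclesD action_diff H_diff\<close>)

lemma zero_cocycle: "(\<lambda>g\<in>carrier G. 0) \<in> Z"
  unfolding cocycles_def mem_Collect_eq continuous_map_restrict_carrier by auto

lemma cocycle_add:
  assumes "b \<in> Z" "c \<in> Z"
  shows "(\<lambda>g\<in>carrier G. b g + c g) \<in> Z"
proof -
  have "(\<lambda>g\<in>carrier G. b g - (\<lambda>g\<in>carrier G. (\<lambda>g\<in>carrier G. 0) g - c g) g) \<in> Z"
    by (intro cocycle_diff zero_cocycle assms)
  moreover have "(\<lambda>g\<in>carrier G. b g - (\<lambda>g\<in>carrier G. (\<lambda>g\<in>carrier G. 0) g - c g) g) = (\<lambda>g\<in>carrier G. b g + c g)"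
    by (auto simp: restrict_def)
  ultimately show ?thesis by simp
qed

lemma group_cocycle_group: "group (cocycle_group G T H ip \<pi>)"
proof (rule groupI)
  fix b assume b: "b \<in> carrier (cocycle_group G T H ip \<pi>)"
  then have bE: "b \<in> extensional (carrier G)" by (auto simp: cocycle_group_def cocycles_def PiE_def)
  define c where "c = (\<lambda>g\<in>carrier G. (\<lambda>g\<in>carrier G. 0) g - b g)"
  have "c \<in> Z"
    unfolding c_def using b by (intro cocycle_diff zero_cocycle) (simp add: cocycle_group_def)
  moreover have "(\<lambda>g\<in>carrier G. c g + b g) = (\<lambda>g\<in>carrier G. 0)"
    by (auto simp: c_def restrict_def)
  ultimately show "\<exists>y\<in>carrier (cocycle_group G T H ip \<pi>).
      y \<otimes>\<^bsub>cocycle_group G T H ip \<pi>\<^esub> b = \<one>\<^bsub>cocycle_group G T H ip \<pi>\<^esub>"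
    by (auto simp: cocycle_group_def)
  show "\<one>\<^bsub>cocycle_group G T H ip \<pi>\<^esub> \<otimes>\<^bsub>cocycle_group G T H ip \<pi>\<^esub> b = b"
    using bE by (auto simp: cocycle_group_def restrict_def extensional_def fun_eq_iff)
qed (auto simp: cocycle_group_def add.assoc intro!: cocycle_add zero_cocycle restrict_ext)

lemma coboundary_cocycle:
  assumes "v \<in> H"
  shows "(\<lambda>g\<in>carrier G. \<pi> g v - v) \<in> Z"
  unfolding cocycles_def mem_Collect_eq continuous_map_restrict_carrier
proof (intro conjI ballI)
  show "continuous_map T (htopology H ip) (\<lambda>g. \<pi> g v - v)"
    using assms by (intro continuous_map_hilbert_diff strongly_continuous) auto
qed (use assms in \<open>auto simp: H_diff action_closed action_mult action_diff\<close>)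

lemma coboundaries_subset: "coboundaries G H \<pi> \<subseteq> Z"
  by (auto simp: coboundaries_def coboundary_cocycle)

lemma zero_coboundary: "(\<lambda>g\<in>carrier G. 0) \<in> coboundaries G H \<pi>"
  unfolding coboundaries_def by (rule image_eqI[of _ _ 0]) (auto simp: restrict_def)

lemma mem_coboundaries_iff:
  assumes "b \<in> Z"
  shows "b \<in> coboundaries G H \<pi> \<longleftrightarrow> (\<exists>v\<in>H. \<forall>g\<in>carrier G. b g = \<pi> g v - v)"
proof
  assume "\<exists>v\<in>H. \<forall>g\<in>carrier G. b g = \<pi> g v - v"
  then obtain v where v: "v \<in> H" "\<And>g. g \<in> carrier G \<Longrightarrow> b g = \<pi> g v - v" by blast
  have "b = (\<lambda>g\<in>carrier G. \<pi> g v - v)"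
    using cocyclesD(1)[OF assms] v(2) by (auto simp: PiE_def extensional_def fun_eq_iff)
  then show "b \<in> coboundaries G H \<pi>" using v(1) by (auto simp: coboundaries_def)
qed (auto simp: coboundaries_def)

lemma trivial_H1_iff:
  "trivial_group (H1 G T H ip \<pi>) \<longleftrightarrow> (\<forall>b\<in>Z. \<exists>v\<in>H. \<forall>g\<in>carrier G. b g = \<pi> g v - v)"
proof -
  interpret C: group "cocycle_group G T H ip \<pi>" by (rule group_cocycle_group)
  have "trivial_group (H1 G T H ip \<pi>) \<longleftrightarrow> coboundaries G H \<pi> = Z"
    unfolding H1_def
    by (subst C.trivial_group_Mod_iff)
      (use coboundaries_subset zero_coboundary in \<open>auto simp: cocycle_group_def\<close>)
  also have "\<dots> \<longleftrightarrow> (\<forall>b\<in>Z. b \<in> coboundaries G H \<pi>)" using coboundaries_subset by blast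
  finally show ?thesis by (simp add: mem_coboundaries_iff)
qed

lemma topspace_cocycle_topology: "topspace (cocycle_topology G T H ip \<pi>) = Z"
proof
  have "openin (cocycle_topology G T H ip \<pi>) Z"
    unfolding openin_cocycle_topology
    by (auto intro!: exI[of _ "{}"] exI[of _ "1::real"])
  then show "Z \<subseteq> topspace (cocycle_topology G T H ip \<pi>)" by (rule openin_subset)
  show "topspace (cocycle_topology G T H ip \<pi>) \<subseteq> Z"
    using openin_topspace[of "cocycle_topology G T H ip \<pi>"] unfolding openin_cocycle_topology by blast
qed

lemma in_closure_of_coboundaries_iff:
  assumes b: "b \<in> Z"
  shows "b \<in> cocycle_topology G T H ip \<pi> closure_of coboundaries G H \<pi> \<longleftrightarrow>
    (\<forall>K e. compactin T K \<longrightarrow> e > 0 \<longrightarrow> (\<exists>v\<in>H. \<forall>g\<in>K. hnorm ip (b g - (\<pi> g v - v)) < e))"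
    (is "?L \<longleftrightarrow> ?R")
proof
  assume L: ?L
  show ?R
  proof (intro allI impI)
    fix K and e :: real assume K: "compactin T K" and e: "e > 0"
    have KG: "K \<subseteq> carrier G" using compactin_subset_topspace[OF K] topspace_G by simp
    \<comment> \<open>The margin \<open>d\<close> is uniform over \<open>K\<close>. With it,
      openness of \<open>U\<close> is a triangle inequality with \<open>d / 2\<close>.\<close>
    define U where "U = {c \<in> Z. \<exists>d>0. \<forall>g\<in>K. hnorm ip (c g - b g) < e - d}"
    have "openin (cocycle_topology G T H ip \<pi>) U"
      unfolding openin_cocycle_topology
    proof (intro conjI ballI)
      fix c assume "c \<in> U"
      then obtain d where c: "c \<in> Z" and d: "d > 0" "\<And>g. g \<in> K \<Longrightarrow> hnorm ip (c g - b g) < e - d"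
        by (auto simp: U_def)
      have "c' \<in> U" if c': "c' \<in> Z" "\<And>g. g \<in> K \<Longrightarrow> hnorm ip (c' g - c g) < d / 2" for c'
      proof -
        have "hnorm ip (c' g - b g) < e - d / 2" if g: "g \<in> K" for g
          using hnorm_triangle_diff[of "c' g" "c g" "b g"] c'(2)[OF g] d(2)[OF g] b c c'(1) KG g
          by (auto simp: cocyclesD(4) subset_iff)
        then show ?thesis using c'(1) d(1) by (auto simp: U_def intro!: exI[of _ "d / 2"])
      qed
      then show "\<exists>K e. compactin T K \<and> e > 0 \<and> {c' \<in> Z. \<forall>g\<in>K. hnorm ip (c' g - c g) < e} \<subseteq> U"
        using K d(1) by (intro exI[of _ K] exI[of _ "d / 2"]) auto
    qed (auto simp: U_def)
    moreover have "b \<in> U" using b e by (auto simp: U_def intro!: exI[of _ "e / 2"])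
    ultimately obtain c where "c \<in> coboundaries G H \<pi>" "c \<in> U"
      using L by (auto simp: in_closure_of)
    then obtain v d where v: "v \<in> H" "d > 0" "\<And>g. g \<in> K \<Longrightarrow> hnorm ip (\<pi> g v - v - b g) < e - d"
      using KG by (auto simp: coboundaries_def U_def subset_iff)
    have "hnorm ip (b g - (\<pi> g v - v)) < e" if "g \<in> K" for g
      using v(3)[OF that] v(1,2) b that KG hnorm_minus_commute[of "b g" "\<pi> g v - v"]
      by (auto simp: cocyclesD(4) H_diff action_closed subset_iff)
    then show "\<exists>v\<in>H. \<forall>g\<in>K. hnorm ip (b g - (\<pi> g v - v)) < e" using v(1) by blast
  qed
next
  assume R: ?R
  show ?L
    unfolding in_closure_of topspace_cocycle_topology
  proof (intro conjI allI impI b)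
    fix U assume U: "b \<in> U \<and> openin (cocycle_topology G T H ip \<pi>) U"
    then obtain K e where K: "compactin T K" "e > 0" "{c \<in> Z. \<forall>g\<in>K. hnorm ip (c g - b g) < e} \<subseteq> U"
      unfolding openin_cocycle_topology by blast
    have KG: "K \<subseteq> carrier G" using compactin_subset_topspace[OF K(1)] topspace_G by simp
    obtain v where v: "v \<in> H" "\<And>g. g \<in> K \<Longrightarrow> hnorm ip (b g - (\<pi> g v - v)) < e"
      using R K(1,2) by blast
    have "hnorm ip (\<pi> g v - v - b g) < e" if "g \<in> K" for g
      using v(2)[OF that] v(1) b that KG hnorm_minus_commute[of "b g" "\<pi> g v - v"]
      by (auto simp: cocyclesD(4) H_diff action_closed subset_iff)
    then have "(\<lambda>g\<in>carrier G. \<pi> g v - v) \<in> U"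
      using K(3) KG coboundary_cocycle[OF v(1)] by (auto simp: subset_iff)
    then show "\<exists>y. y \<in> coboundaries G H \<pi> \<and> y \<in> U" using v(1) by (auto simp: coboundaries_def)
  qed
qed

lemma trivial_reduced_H1_iff:
  "trivial_group (reduced_H1 G T H ip \<pi>) \<longleftrightarrow>
    (\<forall>b\<in>Z. \<forall>K e. compactin T K \<longrightarrow> e > 0 \<longrightarrow> (\<exists>v\<in>H. \<forall>g\<in>K. hnorm ip (b g - (\<pi> g v - v)) < e))"
proof -
  interpret C: group "cocycle_group G T H ip \<pi>" by (rule group_cocycle_group)
  let ?B = "cocycle_topology G T H ip \<pi> closure_of coboundaries G H \<pi>"
  have sub: "?B \<subseteq> Z" using closure_of_subset_topspace topspace_cocycle_topology by metis
  moreover have "coboundaries G H \<pi> \<subseteq> ?B"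
    by (rule closure_of_subset) (simp add: topspace_cocycle_topology coboundaries_subset)
  ultimately have "trivial_group (reduced_H1 G T H ip \<pi>) \<longleftrightarrow> ?B = Z"
    unfolding reduced_H1_def
    by (subst C.trivial_group_Mod_iff) (use zero_coboundary in \<open>auto simp: cocycle_group_def\<close>)
  also have "\<dots> \<longleftrightarrow> (\<forall>b\<in>Z. b \<in> ?B)" using sub by blast
  finally show ?thesis by (simp add: in_closure_of_coboundaries_iff)
qed

end

section \<open>Modules over the semidirect product\<close>

locale semidirect_module = \<Gamma>: topological_group \<Gamma> T +
  unitary_module "semidirect_int \<Gamma> \<theta>" "semidirect_int_topology T" smul H ip \<pi>
  for \<Gamma> :: "('a, 'b) monoid_scheme" and T :: "'a topology" and \<theta> :: "'a \<Rightarrow> 'a"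
    and smul :: "complex \<Rightarrow> 'v::ab_group_add \<Rightarrow> 'v" and H ip \<pi> +
  assumes \<theta>: "\<theta> \<in> carrier (AutoGroup \<Gamma>)"
begin

abbreviation "G \<equiv> semidirect_int \<Gamma> \<theta>"
abbreviation "T\<^sub>G \<equiv> semidirect_int_topology T"
abbreviation "t \<equiv> int_generator \<Gamma>"
abbreviation "N \<equiv> fixed_vectors (carrier \<Gamma> \<times> {0}) H \<pi>"
abbreviation "\<theta>_power m \<equiv> \<theta> [^]\<^bsub>AutoGroup \<Gamma>\<^esub> (m::int)"

lemma group_G: "group G"
  by (rule group_semidirect_int[OF \<Gamma>.is_group \<theta>])

sublocale unitary_group_module G T\<^sub>G smul H ip \<pi>
proof -
  interpret G: group G by (rule group_G)
  show "unitary_group_module G T\<^sub>G smul H ip \<pi>"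
    by unfold_locales (simp add: semidirect_int_def semidirect_int_topology_def \<Gamma>.topspace_eq)
qed

lemma carrier_G: "carrier G = carrier \<Gamma> \<times> UNIV"
  by (simp add: semidirect_int_def)

lemma \<theta>_power_carrier: "\<theta>_power m \<in> carrier (AutoGroup \<Gamma>)"
  using group.int_pow_closed[OF \<Gamma>.AutoGroup \<theta>] .

lemma \<theta>_power_closed: "h \<in> carrier \<Gamma> \<Longrightarrow> \<theta>_power m h \<in> carrier \<Gamma>"
  using carrier_AutoGroup_hom[OF \<theta>_power_carrier] by (auto simp: hom_def)

lemma \<theta>_power_one: "\<theta>_power m \<one>\<^bsub>\<Gamma>\<^esub> = \<one>\<^bsub>\<Gamma>\<^esub>"
  by (rule hom_one[OF carrier_AutoGroup_hom[OF \<theta>_power_carrier] \<Gamma>.is_group \<Gamma>.is_group])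

lemma \<theta>_power_0: "h \<in> carrier \<Gamma> \<Longrightarrow> \<theta>_power 0 h = h"
  by (simp add: AutoGroup_one_apply)

lemma \<theta>_power_inverse: "h \<in> carrier \<Gamma> \<Longrightarrow> \<theta>_power m (\<theta>_power (- m) h) = h"
  using AutoGroup_mult_apply[OF \<theta>_power_carrier \<theta>_power_carrier, of h m "- m"]
    group.int_pow_mult[OF \<Gamma>.AutoGroup \<theta>, of m "- m"] \<theta>_power_0[of h] by simp

lemma mult_G: "(h, m) \<otimes>\<^bsub>G\<^esub> (k, n) = (h \<otimes>\<^bsub>\<Gamma>\<^esub> \<theta>_power m k, m + n)"
  by (simp add: semidirect_int_def)

lemma base_mult: "k \<in> carrier \<Gamma> \<Longrightarrow> (h, 0) \<otimes>\<^bsub>G\<^esub> (k, n) = (h \<otimes>\<^bsub>\<Gamma>\<^esub> k, n)"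
  by (simp add: mult_G \<theta>_power_0 AutoGroup_one_apply)

lemma power_mult: "(\<one>\<^bsub>\<Gamma>\<^esub>, m) \<otimes>\<^bsub>G\<^esub> (\<one>\<^bsub>\<Gamma>\<^esub>, n) = (\<one>\<^bsub>\<Gamma>\<^esub>, m + n)"
  by (simp add: mult_G \<theta>_power_one)

lemma one_G: "\<one>\<^bsub>G\<^esub> = (\<one>\<^bsub>\<Gamma>\<^esub>, 0)"
  by (simp add: semidirect_int_def)

lemma power_carrier [simp]: "(\<one>\<^bsub>\<Gamma>\<^esub>, m) \<in> carrier G"
  by (simp add: carrier_G)

lemma t_carrier: "t \<in> carrier G"
  by (simp add: int_generator_def)

text \<open>The base component can stand on the left, or on the right after a twist by a power of
  \<theta>. Evaluating a cocycle or an action through both factorisations is how invariance under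
  \<Gamma> is obtained below.\<close>

lemma decompose:
  assumes "h \<in> carrier \<Gamma>"
  shows "(h, m) = (h, 0) \<otimes>\<^bsub>G\<^esub> (\<one>\<^bsub>\<Gamma>\<^esub>, m)"
    and "(h, m) = (\<one>\<^bsub>\<Gamma>\<^esub>, m) \<otimes>\<^bsub>G\<^esub> (\<theta>_power (- m) h, 0)"
proof -
  show "(h, m) = (h, 0) \<otimes>\<^bsub>G\<^esub> (\<one>\<^bsub>\<Gamma>\<^esub>, m)"
    using assms by (simp add: base_mult)
  show "(h, m) = (\<one>\<^bsub>\<Gamma>\<^esub>, m) \<otimes>\<^bsub>G\<^esub> (\<theta>_power (- m) h, 0)"
    using assms \<theta>_power_inverse[OF assms, of m] by (simp add: mult_G)
qed

section \<open>The action on base-fixed vectors and cocycles vanishing on the base\<close>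

lemma N_subset: "N \<subseteq> H"
  by (auto simp: fixed_vectors_def)

lemma base_subset: "carrier \<Gamma> \<times> {0} \<subseteq> carrier G"
  by (auto simp: carrier_G)

lemma subspace_N: "subspace N"
  by (rule subspace_fixed_vectors[OF base_subset])

lemma N_hilbert: "complex_hilbert_space smul N ip"
proof (rule subspace_imp_hilbert[OF subspace_N N_subset])
  fix \<sigma> x assume \<sigma>: "range \<sigma> \<subseteq> N" and lim: "limitin Hilb.mtopology \<sigma> x sequentially"
  have x: "x \<in> H" "(\<lambda>n. hdist H ip (\<sigma> n) x) \<longlonglongrightarrow> 0"
    using lim Hilb.limitin_metric_dist_null by blast+
  have "\<sigma> n \<in> H" for n using \<sigma> N_subset by blast
  then have "(\<lambda>n. hnorm ip (\<sigma> n - x)) \<longlonglongrightarrow> 0" using x by (simp add: hdist_def)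
  then show "x \<in> N"
    by (rule_tac fixed_vectors_closed[OF base_subset _ x(1)]) (use \<sigma> in auto)
qed

text \<open>With the base component on the right it acts first, and trivially. So the group acts on
  \<open>N\<close> through its integer component, which also yields invariance of
  \<open>N\<close>.\<close>

lemma action_N:
  assumes v: "v \<in> N" and h: "h \<in> carrier \<Gamma>"
  shows "\<pi> (h, m) v = \<pi> (\<one>\<^bsub>\<Gamma>\<^esub>, m) v"
proof -
  have "(\<theta>_power (- m) h, 0) \<in> carrier G" "\<pi> (\<theta>_power (- m) h, 0) v = v"
    using v h \<theta>_power_closed by (auto simp: fixed_vectors_def carrier_G)
  then show ?thesis
    unfolding decompose(2)[OF h, of m] using v N_subset by (subst action_mult) auto
qed

lemma action_N_closed:
  assumes v: "v \<in> N"
  shows "\<pi> (\<one>\<^bsub>\<Gamma>\<^esub>, m) v \<in> N"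
proof -
  have vH: "v \<in> H" using v N_subset by blast
  have "\<pi> (h, 0) (\<pi> (\<one>\<^bsub>\<Gamma>\<^esub>, m) v) = \<pi> (\<one>\<^bsub>\<Gamma>\<^esub>, m) v" if h: "h \<in> carrier \<Gamma>" for h
    using action_mult[of "(h, 0)" "(\<one>\<^bsub>\<Gamma>\<^esub>, m)" v] vH h action_N[OF v h, of m]
    by (simp add: decompose(1)[OF h, of m, symmetric] carrier_G)
  then show ?thesis using vH by (auto simp: fixed_vectors_def action_closed)
qed

lemma t_N: "v \<in> N \<Longrightarrow> \<pi> t v \<in> N"
  unfolding int_generator_def by (rule action_N_closed)

text \<open>Evaluating \<open>b (h, 1)\<close> through the two factorisations gives
  \<open>\<pi> (h, 0) (b t)\<close> and \<open>b t\<close>, so \<open>b t\<close> is fixed. The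
  linear bound stands in for an explicit formula: it shows both that \<open>b\<close> is zero once
  \<open>b t\<close> is, and that \<open>b\<close> is small on compact sets when \<open>b t\<close>
  is small.\<close>

lemma cocycle_vanishing_on_base:
  assumes b: "b \<in> Z" and zero: "\<And>h. h \<in> carrier \<Gamma> \<Longrightarrow> b (h, 0) = 0"
  shows "b t \<in> N" and "h \<in> carrier \<Gamma> \<Longrightarrow> hnorm ip (b (h, n)) \<le> of_int \<bar>n\<bar> * hnorm ip (b t)"
proof -
  note mult = cocyclesD(3)[OF b] and bH = cocyclesD(4)[OF b]
  have "\<pi> (h, 0) (b t) = b t" if h: "h \<in> carrier \<Gamma>" for h
  proof -
    have k: "\<theta>_power (- 1) h \<in> carrier \<Gamma>" using h by (rule \<theta>_power_closed)
    have "\<pi> (h, 0) (b t) = b (h, 1)"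
      using mult[of "(h, 0)" t] h zero[OF h] t_carrier
      by (simp add: carrier_G int_generator_def decompose(1)[OF h, of 1, symmetric])
    also have "\<dots> = b t"
      using mult[of t "(\<theta>_power (- 1) h, 0)"] k zero[OF k] t_carrier
      by (simp add: carrier_G int_generator_def decompose(2)[OF h, of 1, symmetric])
    finally show ?thesis .
  qed
  then show "b t \<in> N" using bH[OF t_carrier] by (auto simp: fixed_vectors_def)
  define f where "f = (\<lambda>n. b (\<one>\<^bsub>\<Gamma>\<^esub>, n))"
  have fH: "f n \<in> H" for n by (simp add: f_def bH)
  have f_add: "f (m + n) = f m + \<pi> (\<one>\<^bsub>\<Gamma>\<^esub>, m) (f n)" for m n
    using mult[of "(\<one>\<^bsub>\<Gamma>\<^esub>, m)" "(\<one>\<^bsub>\<Gamma>\<^esub>, n)"] by (simp add: f_def power_mult)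
  have f0: "f 0 = 0" using zero by (simp add: f_def)
  have f_nat: "hnorm ip (f (int n)) \<le> real n * hnorm ip (b t)" for n
  proof (induction n)
    case (Suc n)
    have "hnorm ip (f (int n + 1)) \<le> hnorm ip (f (int n)) + hnorm ip (\<pi> (\<one>\<^bsub>\<Gamma>\<^esub>, int n) (f 1))"
      unfolding f_add by (intro hnorm_triangle fH action_closed power_carrier)
    also have "\<dots> = hnorm ip (f (int n)) + hnorm ip (b t)"
      by (simp add: action_hnorm fH) (simp add: f_def int_generator_def)
    finally show ?case using Suc by (simp add: algebra_simps)
  qed (simp add: f0)
  have f_minus: "hnorm ip (f (- n)) = hnorm ip (f n)" for n
  proof -
    have "f n + \<pi> (\<one>\<^bsub>\<Gamma>\<^esub>, n) (f (- n)) = 0" using f_add[of n "- n"] f0 by simp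
    then have "\<pi> (\<one>\<^bsub>\<Gamma>\<^esub>, n) (f (- n)) = 0 - f n" by (simp add: eq_neg_iff_add_eq_0 add.commute)
    then have "hnorm ip (\<pi> (\<one>\<^bsub>\<Gamma>\<^esub>, n) (f (- n))) = hnorm ip (f n - 0)"
      using hnorm_minus_commute[OF H_zero fH[of n]] by simp
    then show ?thesis by (simp add: action_hnorm fH)
  qed
  have f_int: "hnorm ip (f n) \<le> of_int \<bar>n\<bar> * hnorm ip (b t)"
    using f_nat[of "nat \<bar>n\<bar>"] f_minus[of n] by (cases "n \<ge> 0") auto
  assume h: "h \<in> carrier \<Gamma>"
  have "b (h, n) = \<pi> (h, 0) (f n)"
    using mult[of "(h, 0)" "(\<one>\<^bsub>\<Gamma>\<^esub>, n)"] h zero[OF h]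
    by (simp add: carrier_G f_def decompose(1)[OF h, of n, symmetric])
  then show "hnorm ip (b (h, n)) \<le> of_int \<bar>n\<bar> * hnorm ip (b t)"
    using f_int h fH by (simp add: action_hnorm carrier_G)
qed

lemma exists_cocycle_vanishing_on_base:
  assumes w: "w \<in> N"
  shows "\<exists>b\<in>Z. (\<forall>h\<in>carrier \<Gamma>. b (h, 0) = 0) \<and> b t = w"
proof -
  let ?p = "\<lambda>m. \<pi> (\<one>\<^bsub>\<Gamma>\<^esub>, m)"
  \<comment> \<open>For nonnegative \<open>n\<close> this is the sum of \<open>?p k w\<close> over
    exponents 0 to \<open>n - 1\<close>, for negative \<open>n\<close> minus the sum over
    \<open>n\<close> to \<open>- 1\<close>. Then \<open>c (n + 1) = c n + ?p n w\<close> holds for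
    all integers.\<close>
  define c where "c = (\<lambda>n::int. if n \<ge> 0 then \<Sum>k<nat n. ?p (int k) w else - (\<Sum>k<nat (- n). ?p (- int k - 1) w))"
  have pN: "?p m v \<in> N" if "v \<in> N" for m v using that by (rule action_N_closed)
  have cN: "c n \<in> N" for n
    unfolding c_def using subspace_N w by (auto intro!: subspace_sum subspace_neg pN)
  have cH: "c n \<in> H" for n using cN N_subset by blast
  have wH: "w \<in> H" using w N_subset by blast
  have c_Suc: "c (n + 1) = c n + ?p n w" for n
  proof (cases "n \<ge> 0")
    case True
    then have "nat (n + 1) = Suc (nat n)" by simp
    then show ?thesis using True by (simp add: c_def)
  next
    case False
    then have eq: "nat (- n) = Suc (nat (- (n + 1)))" by simp
    have "- int (nat (- (n + 1))) - 1 = n" using False by simp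
    then have "c n = - (\<Sum>k<nat (- (n + 1)). ?p (- int k - 1) w) - ?p n w"
      using False unfolding c_def eq by simp
    moreover have "c (n + 1) = - (\<Sum>k<nat (- (n + 1)). ?p (- int k - 1) w)"
    proof (cases "n = - 1")
      case True
      then show ?thesis by (simp add: c_def)
    qed (use False in \<open>simp add: c_def\<close>)
    ultimately show ?thesis by simp
  qed
  have p_mult: "?p (m + n) v = ?p m (?p n v)" if "v \<in> H" for m n v
    using action_mult[of "(\<one>\<^bsub>\<Gamma>\<^esub>, m)" "(\<one>\<^bsub>\<Gamma>\<^esub>, n)" v] that by (simp add: power_mult)
  have c0: "c 0 = 0" by (simp add: c_def)
  have c_add: "c (m + n) = c m + ?p m (c n)" for m n
  proof (induction n rule: int_induct[where k = 0])
    case base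
    then show ?case by (simp add: c0)
  next
    case (step1 n)
    have "c (m + (n + 1)) = c (m + n) + ?p (m + n) w" using c_Suc[of "m + n"] by (simp add: add.assoc)
    then show ?case
      using step1 wH cH by (simp add: c_Suc p_mult action_add action_closed add.assoc)
  next
    \<comment> \<open>Going down, the identity is shown with the same term added on both sides,
      which is then cancelled.\<close>
    case (step2 n)
    have "c (m + n) = c (m + (n - 1)) + ?p (m + (n - 1)) w" using c_Suc[of "m + (n - 1)"] by (simp add: algebra_simps)
    moreover have "c n = c (n - 1) + ?p (n - 1) w" using c_Suc[of "n - 1"] by simp
    ultimately have "c (m + (n - 1)) + ?p m (?p (n - 1) w) = c m + ?p m (c (n - 1)) + ?p m (?p (n - 1) w)"
      using step2 wH cH p_mult[OF wH, of m "n - 1"] by (simp add: action_add action_closed add.assoc)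
    then show ?case by simp
  qed
  define b where "b = (\<lambda>g\<in>carrier G. c (snd g))"
  have "b \<in> Z"
    unfolding cocycles_def mem_Collect_eq
  proof (intro conjI ballI)
    have "continuous_map T\<^sub>G (htopology H ip) (c \<circ> snd)"
      unfolding semidirect_int_topology_def
      by (rule continuous_map_compose[OF continuous_map_snd]) (auto simp: continuous_map_def cH Pi_iff)
    then show "continuous_map T\<^sub>G (htopology H ip) b"
      unfolding b_def continuous_map_restrict_carrier by (simp add: o_def)
    fix x y assume xy: "x \<in> carrier G" "y \<in> carrier G"
    then obtain h m k n where eq: "x = (h, m)" "y = (k, n)" and h: "h \<in> carrier \<Gamma>"
      by (auto simp: carrier_G)
    have "snd (x \<otimes>\<^bsub>G\<^esub> y) = m + n" by (simp add: eq mult_G)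
    \<comment> \<open>As \<open>c n\<close> is fixed by the base, the component \<open>h\<close> of
      \<open>x\<close> does not affect it, and the cocycle identity reduces to
      \<open>c_add\<close>.\<close>
    then show "b (x \<otimes>\<^bsub>G\<^esub> y) = b x + \<pi> x (b y)"
      using xy c_add[of m n] action_N[OF cN h, of m n] by (simp add: b_def eq)
  qed (auto simp: b_def cH)
  moreover have "b (h, 0) = 0" if "h \<in> carrier \<Gamma>" for h using that by (simp add: b_def carrier_G c0)
  moreover have "c 1 = w"
    using c_Suc[of 0] c0 action_one[OF group_G wH] by (simp add: one_G)
  then have "b t = w" using t_carrier by (simp add: b_def int_generator_def)
  ultimately show ?thesis by blast
qed

lemma base_module: "unitary_module \<Gamma> T smul H ip (\<lambda>h. \<pi> (h, 0))"
proof unfold_locales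
  fix h assume h: "h \<in> carrier \<Gamma>"
  then show "unitary_operator smul H ip (\<pi> (h, 0))" using unitary by (simp add: carrier_G)
  fix k v assume "k \<in> carrier \<Gamma>" "v \<in> H"
  then show "\<pi> (h \<otimes>\<^bsub>\<Gamma>\<^esub> k, 0) v = \<pi> (h, 0) (\<pi> (k, 0) v)"
    using h action_mult[of "(h, 0)" "(k, 0)" v] by (simp add: carrier_G base_mult)
next
  fix v assume "v \<in> H"
  have "continuous_map T T\<^sub>G (\<lambda>h. (h, 0))"
    unfolding semidirect_int_topology_def by (intro continuous_map_pairedI) auto
  from continuous_map_compose[OF this strongly_continuous[OF \<open>v \<in> H\<close>]]
  show "continuous_map T (htopology H ip) (\<lambda>h. \<pi> (h, 0) v)" by (simp add: o_def)
qed

lemma base_cocycle: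
  assumes b: "b \<in> Z"
  shows "(\<lambda>h\<in>carrier \<Gamma>. b (h, 0)) \<in> cocycles \<Gamma> T H ip (\<lambda>h. \<pi> (h, 0))"
  unfolding cocycles_def mem_Collect_eq
proof (intro conjI ballI)
  have "continuous_map T T\<^sub>G (\<lambda>h. (h, 0))"
    unfolding semidirect_int_topology_def by (intro continuous_map_pairedI) auto
  from continuous_map_compose[OF this cocyclesD(2)[OF b]]
  have "continuous_map T (htopology H ip) (\<lambda>h. b (h, 0))" by (simp add: o_def)
  then show "continuous_map T (htopology H ip) (\<lambda>h\<in>carrier \<Gamma>. b (h, 0))"
    by (rule continuous_map_eq) (simp add: \<Gamma>.topspace_eq)
next
  fix h k assume hk: "h \<in> carrier \<Gamma>" "k \<in> carrier \<Gamma>"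
  then show "(\<lambda>h\<in>carrier \<Gamma>. b (h, 0)) (h \<otimes>\<^bsub>\<Gamma>\<^esub> k) =
      (\<lambda>h\<in>carrier \<Gamma>. b (h, 0)) h + \<pi> (h, 0) ((\<lambda>h\<in>carrier \<Gamma>. b (h, 0)) k)"
    using cocyclesD(3)[OF b, of "(h, 0)" "(k, 0)"] by (simp add: carrier_G base_mult)
qed (use cocyclesD(4)[OF b] in \<open>auto simp: carrier_G\<close>)

lemma coboundary_vanishing_on_base:
  assumes "v \<in> H" "\<And>h. h \<in> carrier \<Gamma> \<Longrightarrow> \<pi> (h, 0) v - v = 0"
  shows "v \<in> N"
  using assms by (auto simp: fixed_vectors_def)

text \<open>
  By Property (T) every cocycle is cohomologous to one vanishing on \<open>\<Gamma>\<close>, and those are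
  determined by their value at \<open>t\<close>, which can be any \<open>\<Gamma>\<close>-fixed vector.
\<close>

lemma cocycle_normal_form:
  assumes PT: "property_T \<Gamma> T" and b: "b \<in> Z"
  shows "\<exists>v\<in>H. \<exists>c\<in>Z. (\<forall>h\<in>carrier \<Gamma>. c (h, 0) = 0) \<and> (\<forall>g\<in>carrier G. b g = c g + (\<pi> g v - v))"
proof -
  interpret B: unitary_module \<Gamma> T smul H ip "\<lambda>h. \<pi> (h, 0)" by (rule base_module)
  obtain v where v: "v \<in> H" "\<And>h. h \<in> carrier \<Gamma> \<Longrightarrow> b (h, 0) = \<pi> (h, 0) v - v"
    using B.property_T_cocycle_coboundary[OF \<Gamma>.topological_group_axioms PT base_cocycle[OF b]] by auto
  have "(\<lambda>g\<in>carrier G. b g - (\<lambda>g\<in>carrier G. \<pi> g v - v) g) \<in> Z"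
    by (intro cocycle_diff b coboundary_cocycle v(1))
  then show ?thesis
    using v by (intro bexI[of _ v] bexI[of _ "\<lambda>g\<in>carrier G. b g - (\<lambda>g\<in>carrier G. \<pi> g v - v) g"])
      (auto simp: carrier_G)
qed

section \<open>Cohomology in terms of \<open>\<pi> t - 1\<close> on the fixed vectors\<close>

lemma H1_trivial_iff_surjective:
  assumes PT: "property_T \<Gamma> T"
  shows "trivial_group (H1 G T\<^sub>G H ip \<pi>) \<longleftrightarrow> (\<forall>w\<in>N. \<exists>v\<in>N. w = \<pi> t v - v)"
  unfolding trivial_H1_iff
proof (intro iffI ballI)
  fix w assume L: "\<forall>b\<in>Z. \<exists>v\<in>H. \<forall>g\<in>carrier G. b g = \<pi> g v - v" and w: "w \<in> N"
  obtain b where b: "b \<in> Z" "\<And>h. h \<in> carrier \<Gamma> \<Longrightarrow> b (h, 0) = 0" "b t = w"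
    using exists_cocycle_vanishing_on_base[OF w] by blast
  obtain v where v: "v \<in> H" "\<And>g. g \<in> carrier G \<Longrightarrow> b g = \<pi> g v - v" using L b(1) by blast
  have "v \<in> N"
    by (rule coboundary_vanishing_on_base[OF v(1)]) (use v(2) b(2) in \<open>simp add: carrier_G\<close>)
  then show "\<exists>v\<in>N. w = \<pi> t v - v" using v(2)[OF t_carrier] b(3) by auto
next
  fix b assume R: "\<forall>w\<in>N. \<exists>v\<in>N. w = \<pi> t v - v" and b: "b \<in> Z"
  obtain v c where v: "v \<in> H" and c: "c \<in> Z" "\<And>h. h \<in> carrier \<Gamma> \<Longrightarrow> c (h, 0) = 0"
    and bc: "\<And>g. g \<in> carrier G \<Longrightarrow> b g = c g + (\<pi> g v - v)"
    using cocycle_normal_form[OF PT b] by blast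
  obtain u where u: "u \<in> N" "c t = \<pi> t u - u"
    using R cocycle_vanishing_on_base(1)[OF c] by blast
  have uH: "u \<in> H" using u N_subset by blast
  \<comment> \<open>The difference of \<open>c\<close> and the coboundary of \<open>u\<close>
    vanishes on the base, because \<open>u\<close> is fixed there, and at \<open>t\<close>; the
    linear bound makes it vanish everywhere.\<close>
  define d where "d = (\<lambda>g\<in>carrier G. c g - (\<lambda>g\<in>carrier G. \<pi> g u - u) g)"
  have d: "d \<in> Z" unfolding d_def by (intro cocycle_diff c coboundary_cocycle uH)
  have d0: "d (h, 0) = 0" if "h \<in> carrier \<Gamma>" for h
    using that c(2) u(1) by (simp add: d_def carrier_G fixed_vectors_def)
  have "d t = 0" using u(2) t_carrier by (simp add: d_def)
  have "d g = 0" if g: "g \<in> carrier G" for g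
  proof -
    have dH: "d g \<in> H" using d g by (rule cocyclesD(4))
    have "hnorm ip (d g) \<le> 0"
      using cocycle_vanishing_on_base(2)[OF d d0, of "fst g" "snd g"] g \<open>d t = 0\<close> by (auto simp: carrier_G)
    then show ?thesis using hnorm_nonneg[OF dH] hnorm_eq_0_iff[OF dH] by simp
  qed
  then have "c g = \<pi> g u - u" if "g \<in> carrier G" for g using that by (simp add: d_def)
  then show "\<exists>v\<in>H. \<forall>g\<in>carrier G. b g = \<pi> g v - v"
    using bc v uH by (intro bexI[of _ "u + v"]) (auto simp: action_add H_add)
qed

text \<open>The range of \<open>\<pi> t - 1\<close> is orthogonal to its kernel,
  \<open>\<pi> t\<close> being isometric. Here \<open>u\<close> ranges over all of \<open>H\<close>,
  since approximating coboundaries in the reduced case need not come from base-fixed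
  vectors.\<close>

lemma t_fixed_orthogonal:
  assumes "u \<in> H" "w \<in> H" "\<pi> t w = w"
  shows "ip (\<pi> t u - u) w = 0"
proof -
  have "ip (\<pi> t u) w = ip u w" using action_ip[OF t_carrier assms(1,2)] assms(3) by simp
  then show ?thesis using assms by (simp add: ip_diff_left action_closed t_carrier)
qed

lemma not_spectral_value_iff_surjective:
  "1 \<notin> spectral_values smul N ip (\<pi> t) \<longleftrightarrow> (\<forall>w\<in>N. \<exists>v\<in>N. w = \<pi> t v - v)"
proof -
  interpret N: complex_hilbert_space smul N ip by (rule N_hilbert)
  have tH: "\<pi> t v \<in> H" if "v \<in> N" for v using that N_subset t_N by blast
  have NH: "v \<in> H" if "v \<in> N" for v using that N_subset by blast
  show ?thesis
  proof
    assume "1 \<notin> spectral_values smul N ip (\<pi> t)"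
    then obtain B where B: "bounded_operator smul N ip B" "\<And>v. v \<in> N \<Longrightarrow> B v - \<pi> t (B v) = v"
      by (auto simp: spectral_values_def)
    show "\<forall>w\<in>N. \<exists>v\<in>N. w = \<pi> t v - v"
    proof
      fix w assume w: "w \<in> N"
      have Bw: "B w \<in> N" using B(1) w by (auto simp: bounded_operator_def linear_on_space_def)
      \<comment> \<open>Spectral values concern \<open>1 - \<pi> t\<close> but coboundaries
        \<open>\<pi> t - 1\<close>, hence the sign of the preimage.\<close>
      have "\<pi> t (0 - B w) = 0 - \<pi> t (B w)"
        using action_diff[OF t_carrier H_zero NH[OF Bw]] by (simp add: t_carrier)
      then have "w = \<pi> t (0 - B w) - (0 - B w)" using B(2)[OF w] by (simp add: algebra_simps)
      then show "\<exists>v\<in>N. w = \<pi> t v - v" using N.H_diff[OF N.H_zero Bw] by blast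
    qed
  next
    assume surj: "\<forall>w\<in>N. \<exists>v\<in>N. w = \<pi> t v - v"
    define A where "A = (\<lambda>v. v - \<pi> t v)"
    have A_N: "A v \<in> N" if "v \<in> N" for v using that by (simp add: A_def N.H_diff t_N)
    have A_diff: "A (u - v) = A u - A v" and A_add: "A (u + v) = A u + A v" if "u \<in> N" "v \<in> N" for u v
      using that NH by (simp_all add: A_def action_diff action_add t_carrier)
    have A_smul: "A (smul c v) = smul c (A v)" if "v \<in> N" for c v
      by (simp only: A_def scale_right_diff_distrib action_smul[OF t_carrier NH[OF that]])
    have "\<exists>v\<in>N. A v = w" if w: "w \<in> N" for w
    proof -
      obtain v where v: "v \<in> N" "w = \<pi> t v - v" using bspec[OF surj w] by blast
      have "A 0 = 0" by (simp add: A_def t_carrier)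
      then have "A (0 - v) = w" using A_diff[OF N.H_zero v(1)] v(2) by (simp add: A_def)
      then show ?thesis using N.H_diff[OF N.H_zero v(1)] by blast
    qed
    then obtain B where B: "\<And>w. w \<in> N \<Longrightarrow> B w \<in> N" "\<And>w. w \<in> N \<Longrightarrow> A (B w) = w" by metis
    \<comment> \<open>A vector killed by \<open>A\<close> is orthogonal to the range of
      \<open>\<pi> t - 1\<close>; by surjectivity it also lies in that range, so it is orthogonal to
      itself.\<close>
    have A_inj: "u = v" if uv: "u \<in> N" "v \<in> N" "A u = A v" for u v
    proof -
      have d: "u - v \<in> N" using uv by (simp add: N.H_diff)
      have "A (u - v) = 0" using uv A_diff by simp
      then have fix_d: "\<pi> t (u - v) = u - v" by (simp add: A_def)
      obtain x where x: "x \<in> N" "u - v = \<pi> t x - x" using bspec[OF surj d] by blast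
      have "ip (\<pi> t x - x) (u - v) = 0" by (rule t_fixed_orthogonal[OF NH[OF x(1)] NH[OF d] fix_d])
      then have "ip (u - v) (u - v) = 0" using x(2) by simp
      then have "u - v = 0" using N.ip_pos[OF d] by (cases "u - v = 0") auto
      then show ?thesis by simp
    qed
    have BA: "B (A v) = v" if "v \<in> N" for v
      using that A_inj[of "B (A v)" v] A_N B by simp
    have B_add: "B (u + v) = B u + B v" if "u \<in> N" "v \<in> N" for u v
      using that A_inj[of "B (u + v)" "B u + B v"] by (simp add: B A_add N.H_add)
    have B_smul: "B (smul c v) = smul c (B v)" if "v \<in> N" for c v
      using that A_inj[of "B (smul c v)" "smul c (B v)"] by (simp add: B A_smul N.H_smul)
    txt \<open>As \<open>\<pi> t\<close> is unitary, the inverse \<open>B\<close> of \<open>1 - \<pi> t\<close> has the adjoint \<open>- \<pi> t \<circ> B\<close>.\<close>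
    have adj: "ip (0 - \<pi> t (B v)) u = ip v (B u)" if "u \<in> N" "v \<in> N" for u v
    proof -
      let ?x = "B u" and ?y = "B v"
      note xy = B(1)[OF that(1)] B(1)[OF that(2)]
      note H = NH[OF xy(1)] NH[OF xy(2)] tH[OF xy(1)] tH[OF xy(2)]
      have "ip (0 - \<pi> t ?y) (A ?x) = ip ?y ?x - ip (\<pi> t ?y) ?x"
        using H action_ip[OF t_carrier H(2,1)] by (simp add: A_def ip_diff_left ip_diff_right H_diff del: diff_0)
      also have "\<dots> = ip (A ?y) ?x" using H by (simp add: A_def ip_diff_left)
      finally show ?thesis using B(2) that by simp
    qed
    have "\<exists>C. \<forall>u\<in>N. hnorm ip (B u) \<le> C * hnorm ip u"
      by (rule N.Hellinger_Toeplitz[of B "\<lambda>v. 0 - \<pi> t (B v)"])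
        (use B(1) B_smul adj t_N N.H_diff[OF N.H_zero] in \<open>auto simp del: diff_0\<close>)
    then have "bounded_operator smul N ip B"
      using B(1) B_add B_smul by (auto simp: bounded_operator_def linear_on_space_def)
    moreover have "\<forall>v\<in>N. B (smul 1 v - \<pi> t v) = v \<and> smul 1 (B v) - \<pi> t (B v) = v"
      using BA B(2) by (auto simp: A_def)
    ultimately show "1 \<notin> spectral_values smul N ip (\<pi> t)"
      unfolding spectral_values_def by blast
  qed
qed

lemma reduced_H1_trivial_iff_no_fixed_vector:
  assumes PT: "property_T \<Gamma> T"
  shows "trivial_group (reduced_H1 G T\<^sub>G H ip \<pi>) \<longleftrightarrow> 1 \<notin> eigenvalues smul N (\<pi> t)"
  unfolding trivial_reduced_H1_iff
proof
  assume L: "\<forall>b\<in>Z. \<forall>K e. compactin T\<^sub>G K \<longrightarrow> e > 0 \<longrightarrow> (\<exists>v\<in>H. \<forall>g\<in>K. hnorm ip (b g - (\<pi> g v - v)) < e)"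
  have "w = 0" if w: "w \<in> N" "\<pi> t w = w" for w
  proof (rule ccontr)
    assume "w \<noteq> 0"
    have wH: "w \<in> H" using w N_subset by blast
    then have pos: "hnorm ip w > 0" using \<open>w \<noteq> 0\<close> hnorm_eq_0_iff hnorm_nonneg by (metis less_eq_real_def)
    obtain b where b: "b \<in> Z" "b t = w" using exists_cocycle_vanishing_on_base[OF w(1)] by blast
    \<comment> \<open>A single point is compact enough: \<open>w\<close> is orthogonal to every
      \<open>\<pi> t v - v\<close>, so its distance to these vectors is never below its own
      norm.\<close>
    have "compactin T\<^sub>G {t}" using t_carrier topspace_G by simp
    then obtain v where v: "v \<in> H" "hnorm ip (w - (\<pi> t v - v)) < hnorm ip w"
      using L b pos by blast
    have d: "\<pi> t v - v \<in> H" using v t_carrier by (simp add: H_diff action_closed)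
    have "ip w (\<pi> t v - v) = 0"
      by (rule orthogonal_sym[OF d wH t_fixed_orthogonal[OF v(1) wH w(2)]])
    then have "(hnorm ip (w - (\<pi> t v - v)))\<^sup>2 = (hnorm ip w)\<^sup>2 + (hnorm ip (\<pi> t v - v))\<^sup>2"
      using wH d by (simp add: hnorm_diff_power2)
    then have "(hnorm ip w)\<^sup>2 \<le> (hnorm ip (w - (\<pi> t v - v)))\<^sup>2" by simp
    then have "hnorm ip w \<le> hnorm ip (w - (\<pi> t v - v))"
      by (rule power2_le_imp_le) (rule hnorm_nonneg[OF H_diff[OF wH d]])
    then show False using v(2) by simp
  qed
  then show "1 \<notin> eigenvalues smul N (\<pi> t)" by (auto simp: eigenvalues_def)
next
  assume R: "1 \<notin> eigenvalues smul N (\<pi> t)"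
  interpret N: complex_hilbert_space smul N ip by (rule N_hilbert)
  define P where "P = (\<lambda>v. \<pi> t v - v) ` N"
  have NH: "v \<in> H" if "v \<in> N" for v using that N_subset by blast
  have PN: "P \<subseteq> N" by (auto simp: P_def N.H_diff t_N)
  have P: "subspace P"
    unfolding subspace_def
  proof (intro conjI ballI allI)
    show "0 \<in> P" unfolding P_def by (rule image_eqI[of _ _ 0]) (auto simp: t_carrier)
    fix x assume "x \<in> P"
    then obtain u where u: "u \<in> N" "x = \<pi> t u - u" by (auto simp: P_def)
    show "smul c x \<in> P" for c
      unfolding P_def using u NH
      by (intro image_eqI[of _ _ "smul c u"]) (auto simp: action_smul t_carrier scale_right_diff_distrib N.H_smul)
    fix y assume "y \<in> P"
    then obtain v where v: "v \<in> N" "y = \<pi> t v - v" by (auto simp: P_def)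
    show "x + y \<in> P"
      unfolding P_def using u v NH
      by (intro image_eqI[of _ _ "u + v"]) (auto simp: action_add t_carrier N.H_add)
  qed
  have dense: "\<exists>v\<in>N. hnorm ip (w - (\<pi> t v - v)) < e" if w: "w \<in> N" and e: "e > 0" for w e
  proof -
    obtain \<sigma> z where \<sigma>: "\<And>n. \<sigma> n \<in> P" and z: "z \<in> N" "\<And>p. p \<in> P \<Longrightarrow> ip z p = 0"
      and lim: "(\<lambda>n. hnorm ip (\<sigma> n - (w - z))) \<longlonglongrightarrow> 0"
      using N.orthogonal_approximation[OF P PN w] by blast
    have zH: "z \<in> H" "\<pi> t z \<in> H" using z(1) NH t_N by auto
    \<comment> \<open>Orthogonality to the range is tested on \<open>\<pi> t z - z\<close> alone.
      For an isometry this already forces \<open>\<pi> t z = z\<close>.\<close>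
    have "ip z (\<pi> t z) = ip z z"
      using z(2)[of "\<pi> t z - z"] z(1) zH by (simp add: P_def ip_diff_right)
    then have "(hnorm ip (z - \<pi> t z))\<^sup>2 = 0"
      using zH t_carrier by (simp add: hnorm_diff_power2 action_hnorm hnorm_power2)
    then have "z - \<pi> t z = 0" using zH hnorm_eq_0_iff[of "z - \<pi> t z"] by (simp add: H_diff)
    then have "z = 0" using R z(1) by (auto simp: eigenvalues_def)
    then have "(\<lambda>n. hnorm ip (\<sigma> n - w)) \<longlonglongrightarrow> 0" using lim by simp
    from order_tendstoD(2)[OF this e] obtain n where n: "hnorm ip (\<sigma> n - w) < e"
      by (auto simp: eventually_sequentially)
    obtain v where v: "v \<in> N" "\<sigma> n = \<pi> t v - v" using \<sigma>[of n] by (auto simp: P_def)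
    have "\<sigma> n \<in> H" using \<sigma> PN NH by blast
    then have "hnorm ip (w - (\<pi> t v - v)) < e"
      using n hnorm_minus_commute[OF NH[OF w], of "\<sigma> n"] unfolding v(2) by simp
    then show ?thesis using v(1) by blast
  qed
  show "\<forall>b\<in>Z. \<forall>K e. compactin T\<^sub>G K \<longrightarrow> e > 0 \<longrightarrow> (\<exists>v\<in>H. \<forall>g\<in>K. hnorm ip (b g - (\<pi> g v - v)) < e)"
  proof (intro ballI allI impI)
    fix b K and e :: real assume b: "b \<in> Z" and K: "compactin T\<^sub>G K" and e: "e > 0"
    have KG: "K \<subseteq> carrier G" using compactin_subset_topspace[OF K] topspace_G by simp
    \<comment> \<open>Projecting to the discrete factor leaves a finite set, so the exponents of
      \<open>t\<close> occurring in \<open>K\<close> are bounded.\<close>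
    have "compactin (discrete_topology UNIV) (snd ` K)"
      using image_compactin[OF K[unfolded semidirect_int_topology_def] continuous_map_snd] .
    then have "finite (snd ` K)" by (simp add: compactin_discrete_topology)
    from bdd_above_finite[OF finite_imageI[OF this]]
    have "bdd_above ((\<lambda>n. real_of_int \<bar>n\<bar>) ` snd ` K)" .
    then obtain m where m: "\<And>g. g \<in> K \<Longrightarrow> real_of_int \<bar>snd g\<bar> \<le> m" by (auto simp: bdd_above_def)
    obtain v c where v: "v \<in> H" and c: "c \<in> Z" "\<And>h. h \<in> carrier \<Gamma> \<Longrightarrow> c (h, 0) = 0"
      and bc: "\<And>g. g \<in> carrier G \<Longrightarrow> b g = c g + (\<pi> g v - v)"
      using cocycle_normal_form[OF PT b] by blast
    \<comment> \<open>The tolerance at \<open>t\<close> anticipates the linear growth on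
      \<open>K\<close>. The bound \<open>m\<close> is arbitrary when \<open>K\<close> is empty,
      hence the absolute value; the \<open>+ 1\<close> avoids a zero denominator.\<close>
    have "e / (\<bar>m\<bar> + 1) > 0" using e by simp
    then obtain u where u: "u \<in> N" "hnorm ip (c t - (\<pi> t u - u)) < e / (\<bar>m\<bar> + 1)"
      using dense[OF cocycle_vanishing_on_base(1)[OF c]] by blast
    have uH: "u \<in> H" using u NH by blast
    define d where "d = (\<lambda>g\<in>carrier G. c g - (\<lambda>g\<in>carrier G. \<pi> g u - u) g)"
    have d: "d \<in> Z" unfolding d_def by (intro cocycle_diff c coboundary_cocycle uH)
    have d0: "d (h, 0) = 0" if "h \<in> carrier \<Gamma>" for h
      using that c(2) u(1) by (simp add: d_def carrier_G fixed_vectors_def)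
    have dt: "hnorm ip (d t) < e / (\<bar>m\<bar> + 1)" using u(2) t_carrier by (simp add: d_def)
    have dt0: "hnorm ip (d t) \<ge> 0" using cocyclesD(4)[OF d t_carrier] by (rule hnorm_nonneg)
    have "hnorm ip (b g - (\<pi> g (u + v) - (u + v))) < e" if g: "g \<in> K" for g
    proof -
      have gG: "g \<in> carrier G" using g KG by blast
      have eq: "b g - (\<pi> g (u + v) - (u + v)) = d g"
        using gG uH v by (simp add: bc d_def action_add)
      have "hnorm ip (d g) \<le> real_of_int \<bar>snd g\<bar> * hnorm ip (d t)"
        using cocycle_vanishing_on_base(2)[OF d d0, of "fst g" "snd g"] gG by (auto simp: carrier_G)
      also have "\<dots> \<le> (\<bar>m\<bar> + 1) * hnorm ip (d t)"
        using m[OF g] dt0 by (intro mult_right_mono) auto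
      also have "\<dots> < e"
        using dt by (simp add: pos_less_divide_eq[of "\<bar>m\<bar> + 1"] add_nonneg_pos mult.commute)
      finally show ?thesis unfolding eq .
    qed
    then show "\<exists>v\<in>H. \<forall>g\<in>K. hnorm ip (b g - (\<pi> g v - v)) < e"
      using uH v by (intro bexI[of _ "u + v"]) (auto intro: H_add)
  qed
qed

end

theorem corollary4:
  fixes \<Gamma> :: "('a, 'b) monoid_scheme" and T :: "'a topology" and \<theta> :: "'a \<Rightarrow> 'a"
    and smul :: "complex \<Rightarrow> 'v::ab_group_add \<Rightarrow> 'v" and M :: "'v set"
    and ip :: "'v \<Rightarrow> 'v \<Rightarrow> complex" and \<pi> :: "'a \<times> int \<Rightarrow> 'v \<Rightarrow> 'v"
    and G :: "('a \<times> int) monoid" and T\<^sub>G :: "('a \<times> int) topology"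
    and M\<Gamma> :: "'v set" and t :: "'a \<times> int"
  assumes "locally_compact_group \<Gamma> T"
    and "property_T \<Gamma> T"
    and "\<theta> \<in> topological_auto \<Gamma> T"
    and "G = semidirect_int \<Gamma> \<theta>"
    and "T\<^sub>G = semidirect_int_topology T"
    and "unitary_module G T\<^sub>G smul M ip \<pi>"
    and "M\<Gamma> = fixed_vectors (carrier \<Gamma> \<times> {0}) M \<pi>"
    and "t = int_generator \<Gamma>"
  shows "(trivial_group (H1 G T\<^sub>G M ip \<pi>) \<longleftrightarrow> 1 \<notin> spectral_values smul M\<Gamma> ip (\<pi> t)) \<and>
    (trivial_group (reduced_H1 G T\<^sub>G M ip \<pi>) \<longleftrightarrow> 1 \<notin> eigenvalues smul M\<Gamma> (\<pi> t))"
proof -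
  interpret locally_compact_group \<Gamma> T by fact
  interpret module: unitary_module "semidirect_int \<Gamma> \<theta>" "semidirect_int_topology T" smul M ip \<pi>
    using assms(4-6) by simp
  interpret S: semidirect_module \<Gamma> T \<theta> smul M ip \<pi>
    by unfold_locales (rule topological_auto_in_AutoGroup[OF assms(3)])
  show ?thesis
    unfolding assms(4,5,7,8)
    using S.H1_trivial_iff_surjective[OF assms(2)] S.not_spectral_value_iff_surjective
      S.reduced_H1_trivial_iff_no_fixed_vector[OF assms(2)] by simp
qed

end
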